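(* Let $G$ be a diffeological group and $F$ a fixed diffeological space with a smooth $G$-action. Let $\mathbf{Diffeol}_{\mathrm{HSP}}$ be the full subcategory of diffeological spaces consisting of the Hausdorff, second-countable, smoothly paracompact ones. Let $\mathcal{B}^F_G(\cdot)$ be the (contravariant) functor from $\mathbf{Diffeol}_{\mathrm{HSP}}$ to $\mathbf{Set}$ sending an object $X$ to the set of isomorphism classes of locally trivial diffeological fibre bundles over $X$ with fibre the $G$-space $F$ (and structure group $G$), and let $[\cdot,BG]$ be the functor sending $X$ to the set of smooth homotopy classes of smooth maps $X\to BG$, where $BG$ is the diffeological Milnor classifying space of $G$ (both functors act on morphisms by pullback). Then there is a natural surjection from $[\cdot,BG]$ to $\mathcal{B}^F_G(\cdot)$.
   Context: Diffeology. A diffeology on a set $X$ is a collection of maps $p\colon U\to X$ ("plots"), $U$ open in some $\mathbb{R}^n$, $n\ge 0$, that contains constant maps, is closed under precomposition with smooth maps between open subsets of Euclidean spaces, and contains every map that is locally a plot. A map is smooth if its composition with every plot is a plot. The D-topology is the finest topology making all plots continuous; topological terms refer to it. Subsets, products, quotients carry the subset, product, quotient diffeologies; $[0,1]\subseteq\mathbb{R}$ has the subset diffeology. A diffeological group is a group with a diffeology for which multiplication and inversion are smooth. $X$ is smoothly paracompact if its D-topology is paracompact and every open cover admits a subordinate smooth partition of unity. Two smooth maps $f_0,f_1\colon X\to Y$ are smoothly homotopic if there is a smooth $H\colon X\times\mathbb{R}\to Y$ with $H(\cdot,0)=f_0$, $H(\cdot,1)=f_1$. Bundles. For a smooth surjection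 $\pi\colon E\to X$ and smooth $f\colon Y\to X$, $f^*E=\{(y,e)\in Y\times E\mid f(y)=\pi(e)\}$. $\pi$ is trivial with fibre $F$ if there is a diffeomorphism $E\to X\times F$ over $X$; it is locally trivial if there is a D-open cover $\{U_\alpha\}$ of $X$ with each $E|_{U_\alpha}$ trivial with fibre $F$; $\pi$ is a diffeological fibre bundle if $p^*E\to U$ is locally trivial for every plot $p\colon U\to X$. It is a principal $G$-bundle if moreover $G$ acts smoothly on $E$ and for every plot $p\colon U\to X$ and $u\in U$ there are an open neighbourhood $V$ of $u$ and a plot $q\colon V\to E$ with $\pi\circ q=p|_V$ such that $V\times G\to(p|_V)^*E$, $(v,g)\mapsto(v,g\cdot q(v))$ is an equivariant diffeomorphism. Given a principal $G$-bundle $E\to X$ and a $G$-space $F$, the associated bundle with fibre $F$ is $E\times_GF:=(E\times F)/G\to X$ ($G$ acting diagonally). A diffeological fibre bundle with fibre the $G$-space $F$ and structure group $G$ is one that arises as an associated bundle $E\times_GF$ of some principal $G$-bundle $E$. Milnor construction. Let $S_G\subseteq[0,1]^{\mathbb{N}}\times G^{\mathbb{N}}$ be the set of $(t_i,g_i)_{i\in\mathbb{N}}$ with only finitely many $t_i\ne 0$ and $\sum_i t_i=1$, with the subset diffeology of the product diffeology. Define $(t_i,g_i)\sim(t_i',g_i')$ iff $t_i=t_i'$ for all $i$ and $g_i=g_i'$ whenever $t_i=t'_i\neq0$. $EG:=S_G/\!\sim$ with the quotient diffeology, with elements $(t_ig_i)$; $G$ acts on $EG$ by $h\cdot(t_ig_i)=(t_ig_ih^{-1})$,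 and $BG:=EG/G$ with the quotient diffeology.
   Formalization: The locally trivial bundles with fibre the G-space F are taken to be those associated to a principal G-bundle that is itself locally trivial (otherwise surjectivity can fail), and for empty F the projection need not be surjective. *)

theory Defs
  imports "HOL-Analysis.Analysis" "HOL-Algebra.Group_Action"
begin

section \<open>Smooth maps between open subsets of Euclidean spaces\<close>

text \<open>
  Plots have domains in \<open>\<real>\<^sup>n\<close> with \<open>n\<close> varying inside a single diffeology, so \<open>\<real>\<^sup>n\<close> is the space
  \<^term>\<open>Euclidean_space n\<close> of sequences vanishing from index \<open>n\<close> on.
\<close>

definition partial_deriv :: "nat \<Rightarrow> ((nat \<Rightarrow> real) \<Rightarrow> real) \<Rightarrow> (nat \<Rightarrow> real) \<Rightarrow> real" where
  "partial_deriv i f x = deriv (\<lambda>t. f (x(i := t))) (x i)"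

primrec Ck_on :: "nat \<Rightarrow> nat \<Rightarrow> (nat \<Rightarrow> real) set \<Rightarrow> ((nat \<Rightarrow> real) \<Rightarrow> real) \<Rightarrow> bool" where
  "Ck_on 0 n U f \<longleftrightarrow> continuous_map (subtopology (Euclidean_space n) U) euclideanreal f"
| "Ck_on (Suc k) n U f \<longleftrightarrow>
     continuous_map (subtopology (Euclidean_space n) U) euclideanreal f \<and>
     (\<forall>i<n. (\<forall>x\<in>U. (\<lambda>t. f (x(i := t))) differentiable (at (x i))) \<and>
            Ck_on k n U (partial_deriv i f))"

definition smooth_real :: "nat \<Rightarrow> (nat \<Rightarrow> real) set \<Rightarrow> ((nat \<Rightarrow> real) \<Rightarrow> real) \<Rightarrow> bool" where
  "smooth_real n U f \<longleftrightarrow> (\<forall>k. Ck_on k n U f)"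

definition smooth_eucl ::
  "nat \<Rightarrow> (nat \<Rightarrow> real) set \<Rightarrow> nat \<Rightarrow> (nat \<Rightarrow> real) set \<Rightarrow> ((nat \<Rightarrow> real) \<Rightarrow> nat \<Rightarrow> real) \<Rightarrow> bool" where
  "smooth_eucl m V n U f \<longleftrightarrow> f \<in> V \<rightarrow> U \<and> (\<forall>j<n. smooth_real m V (\<lambda>x. f x j))"


section \<open>Diffeological spaces\<close>

text \<open>
  \<^term>\<open>plots D n U p\<close> says that \<open>p\<close>, restricted to the open set \<open>U \<subseteq> \<real>\<^sup>n\<close>, is a plot; the values
  of the total function \<open>p\<close> outside \<open>U\<close> are irrelevant.  The last axiom, applied with \<open>V = U\<close>, makes
  every diffeology insensitive to these values.
\<close>

record 'a diffspace =
  pts :: "'a set"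
  plots :: "nat \<Rightarrow> (nat \<Rightarrow> real) set \<Rightarrow> ((nat \<Rightarrow> real) \<Rightarrow> 'a) \<Rightarrow> bool"

definition diffeological_space :: "'a diffspace \<Rightarrow> bool" where
  "diffeological_space D \<longleftrightarrow>
     (\<forall>n U p. plots D n U p \<longrightarrow> openin (Euclidean_space n) U \<and> p \<in> U \<rightarrow> pts D) \<and>
     (\<forall>n U x. openin (Euclidean_space n) U \<and> x \<in> pts D \<longrightarrow> plots D n U (\<lambda>_. x)) \<and>
     (\<forall>n U p m V f. plots D n U p \<and> openin (Euclidean_space m) V \<and> smooth_eucl m V n U f
        \<longrightarrow> plots D m V (p \<circ> f)) \<and>
     (\<forall>n U p. openin (Euclidean_space n) U \<and>
        (\<forall>u\<in>U. \<exists>V q. openin (Euclidean_space n) V \<and> u \<in> V \<and> V \<subseteq> U \<and>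
                     plots D n V q \<and> (\<forall>v\<in>V. p v = q v))
        \<longrightarrow> plots D n U p)"

definition smooth_map :: "'a diffspace \<Rightarrow> 'b diffspace \<Rightarrow> ('a \<Rightarrow> 'b) \<Rightarrow> bool" where
  "smooth_map A B f \<longleftrightarrow>
     f \<in> pts A \<rightarrow> pts B \<and> (\<forall>n U p. plots A n U p \<longrightarrow> plots B n U (f \<circ> p))"

definition diffeomorphism :: "'a diffspace \<Rightarrow> 'b diffspace \<Rightarrow> ('a \<Rightarrow> 'b) \<Rightarrow> bool" where
  "diffeomorphism A B f \<longleftrightarrow>
     bij_betw f (pts A) (pts B) \<and> smooth_map A B f \<and> smooth_map B A (inv_into (pts A) f)"

definition D_topology :: "'a diffspace \<Rightarrow> 'a topology" where
  "D_topology A = topology (\<lambda>S. S \<subseteq> pts A \<and>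
     (\<forall>n U p. plots A n U p \<longrightarrow> openin (Euclidean_space n) {u \<in> U. p u \<in> S}))"

lemma openin_D_topology:
  "openin (D_topology A) S \<longleftrightarrow> S \<subseteq> pts A \<and>
    (\<forall>n U p. plots A n U p \<longrightarrow> openin (Euclidean_space n) {u \<in> U. p u \<in> S})"
proof -
  define P where "P S \<longleftrightarrow> S \<subseteq> pts A \<and>
    (\<forall>n U p. plots A n U p \<longrightarrow> openin (Euclidean_space n) {u \<in> U. p u \<in> S})" for S
  have "istopology P"
    unfolding istopology_def
  proof (intro conjI allI impI)
    fix S T assume S: "P S" and T: "P T"
    have "openin (Euclidean_space n) {u \<in> U. p u \<in> S \<inter> T}" if pl: "plots A n U p" for n U p
    proof -
      have "{u \<in> U. p u \<in> S \<inter> T} = {u \<in> U. p u \<in> S} \<inter> {u \<in> U. p u \<in> T}" by auto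
      moreover have "openin (Euclidean_space n) {u \<in> U. p u \<in> S}"
        using S pl unfolding P_def by blast
      moreover have "openin (Euclidean_space n) {u \<in> U. p u \<in> T}"
        using T pl unfolding P_def by blast
      ultimately show ?thesis by (simp only: openin_Int)
    qed
    moreover have "S \<inter> T \<subseteq> pts A" using S unfolding P_def by blast
    ultimately show "P (S \<inter> T)" unfolding P_def by blast
  next
    fix K assume K: "\<forall>S\<in>K. P S"
    have "openin (Euclidean_space n) {u \<in> U. p u \<in> \<Union>K}" if pl: "plots A n U p" for n U p
    proof -
      have "{u \<in> U. p u \<in> \<Union>K} = \<Union>((\<lambda>S. {u \<in> U. p u \<in> S}) ` K)" by auto
      moreover have "openin (Euclidean_space n) {u \<in> U. p u \<in> S}" if "S \<in> K" for S
        using K pl that unfolding P_def by blast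
      then have "openin (Euclidean_space n) (\<Union>((\<lambda>S. {u \<in> U. p u \<in> S}) ` K))"
        by (intro openin_Union) blast
      ultimately show ?thesis by (simp only:)
    qed
    moreover have "\<Union>K \<subseteq> pts A" using K unfolding P_def by blast
    ultimately show "P (\<Union>K)" unfolding P_def by blast
  qed
  moreover have "D_topology A = topology P"
    unfolding D_topology_def P_def ..
  ultimately show ?thesis
    by (simp add: topology_inverse' P_def)
qed

definition real_diff :: "real diffspace" where
  "real_diff = \<lparr>pts = UNIV, plots = \<lambda>n U p. openin (Euclidean_space n) U \<and> smooth_real n U p\<rparr>"

definition eucl_diff :: "nat \<Rightarrow> (nat \<Rightarrow> real) set \<Rightarrow> (nat \<Rightarrow> real) diffspace" where
  "eucl_diff n U =
     \<lparr>pts = U, plots = \<lambda>m V p. openin (Euclidean_space m) V \<and> smooth_eucl m V n U p\<rparr>"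

definition subset_diff :: "'a diffspace \<Rightarrow> 'a set \<Rightarrow> 'a diffspace" where
  "subset_diff A S =
     \<lparr>pts = pts A \<inter> S, plots = \<lambda>n U p. plots A n U p \<and> p \<in> U \<rightarrow> S\<rparr>"

definition prod_diff :: "'a diffspace \<Rightarrow> 'b diffspace \<Rightarrow> ('a \<times> 'b) diffspace" where
  "prod_diff A B =
     \<lparr>pts = pts A \<times> pts B, plots = \<lambda>n U p. plots A n U (fst \<circ> p) \<and> plots B n U (snd \<circ> p)\<rparr>"

definition seq_diff :: "'a diffspace \<Rightarrow> (nat \<Rightarrow> 'a) diffspace" where
  "seq_diff A =
     \<lparr>pts = {s. \<forall>i. s i \<in> pts A}, plots = \<lambda>n U p. \<forall>i. plots A n U (\<lambda>u. p u i)\<rparr>"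

definition quotient_diff :: "'a diffspace \<Rightarrow> ('a \<times> 'a) set \<Rightarrow> 'a set diffspace" where
  "quotient_diff A r =
     \<lparr>pts = pts A // r,
      plots = \<lambda>n U p. openin (Euclidean_space n) U \<and>
        (\<forall>u\<in>U. \<exists>V q. openin (Euclidean_space n) V \<and> u \<in> V \<and> V \<subseteq> U \<and>
                     plots A n V q \<and> (\<forall>v\<in>V. p v = r `` {q v}))\<rparr>"


section \<open>Hausdorff, second-countable, smoothly paracompact spaces\<close>

definition paracompact_space :: "'a topology \<Rightarrow> bool" where
  "paracompact_space T \<longleftrightarrow>
     (\<forall>\<U>. (\<forall>U\<in>\<U>. openin T U) \<and> \<Union>\<U> = topspace T \<longrightarrow>
        (\<exists>\<V>. (\<forall>V\<in>\<V>. openin T V) \<and> \<Union>\<V> = topspace T \<and>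
             (\<forall>V\<in>\<V>. \<exists>U\<in>\<U>. V \<subseteq> U) \<and> locally_finite_in T \<V>))"

definition smooth_partition_of_unity ::
  "'a diffspace \<Rightarrow> 'a set set \<Rightarrow> ('a set \<Rightarrow> 'a \<Rightarrow> real) \<Rightarrow> bool" where
  "smooth_partition_of_unity X \<U> \<rho> \<longleftrightarrow>
     (\<forall>U\<in>\<U>. smooth_map X real_diff (\<rho> U) \<and> (\<forall>x\<in>pts X. 0 \<le> \<rho> U x) \<and>
            D_topology X closure_of {x \<in> pts X. \<rho> U x \<noteq> 0} \<subseteq> U) \<and>
     (\<forall>x\<in>pts X. \<exists>W. openin (D_topology X) W \<and> x \<in> W \<and>
                   finite {U \<in> \<U>. \<exists>y\<in>W. \<rho> U y \<noteq> 0}) \<and>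
     (\<forall>x\<in>pts X. (\<Sum>U | U \<in> \<U> \<and> \<rho> U x \<noteq> 0. \<rho> U x) = 1)"

definition smoothly_paracompact :: "'a diffspace \<Rightarrow> bool" where
  "smoothly_paracompact X \<longleftrightarrow>
     paracompact_space (D_topology X) \<and>
     (\<forall>\<U>. (\<forall>U\<in>\<U>. openin (D_topology X) U) \<and> \<Union>\<U> = pts X \<longrightarrow>
        (\<exists>\<rho>. smooth_partition_of_unity X \<U> \<rho>))"

text \<open>
  Objects are spaces with carrier in an ambient type.  A Hausdorff second-countable space has at most
  continuum many points, so every such space is diffeomorphic to one with carrier in any type of at
  least that size, e.g. \<^typ>\<open>real\<close>.
\<close>

definition HSP :: "'a diffspace \<Rightarrow> bool" where
  "HSP X \<longleftrightarrow> diffeological_space X \<and> Hausdorff_space (D_topology X) \<and>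
     second_countable (D_topology X) \<and> smoothly_paracompact X"


section \<open>Smooth homotopy classes\<close>

definition smooth_homotopy_rel :: "'a diffspace \<Rightarrow> 'b diffspace \<Rightarrow> (('a \<Rightarrow> 'b) \<times> ('a \<Rightarrow> 'b)) set" where
  "smooth_homotopy_rel X Y =
     {(f0, f1). smooth_map X Y f0 \<and> smooth_map X Y f1 \<and>
        (\<exists>H. smooth_map (prod_diff X real_diff) Y H \<and>
             (\<forall>x\<in>pts X. H (x, 0) = f0 x \<and> H (x, 1) = f1 x))}"

text \<open>
  Functions agreeing on \<^term>\<open>pts X\<close> are homotopic by a constant homotopy, so the classes do not
  depend on values outside \<^term>\<open>pts X\<close>.
\<close>

definition homotopy_classes :: "'a diffspace \<Rightarrow> 'b diffspace \<Rightarrow> ('a \<Rightarrow> 'b) set set" where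
  "homotopy_classes X Y = {f. smooth_map X Y f} // smooth_homotopy_rel X Y"

definition homotopy_pullback ::
  "'a diffspace \<Rightarrow> 'c diffspace \<Rightarrow> ('a \<Rightarrow> 'b) \<Rightarrow> ('b \<Rightarrow> 'c) set \<Rightarrow> ('a \<Rightarrow> 'c) set" where
  "homotopy_pullback X B f c = smooth_homotopy_rel X B `` ((\<lambda>g. g \<circ> f) ` c)"


section \<open>Diffeological groups and smooth actions\<close>

definition diffeological_group :: "('g, 'm) monoid_scheme \<Rightarrow> 'g diffspace \<Rightarrow> bool" where
  "diffeological_group G DG \<longleftrightarrow>
     group G \<and> diffeological_space DG \<and> pts DG = carrier G \<and>
     smooth_map (prod_diff DG DG) DG (\<lambda>(g, h). g \<otimes>\<^bsub>G\<^esub> h) \<and>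
     smooth_map DG DG (\<lambda>g. inv\<^bsub>G\<^esub> g)"

definition smooth_action ::
  "('g, 'm) monoid_scheme \<Rightarrow> 'g diffspace \<Rightarrow> 'e diffspace \<Rightarrow> ('g \<Rightarrow> 'e \<Rightarrow> 'e) \<Rightarrow> bool" where
  "smooth_action G DG E \<phi> \<longleftrightarrow>
     group_action G (pts E) \<phi> \<and> smooth_map (prod_diff DG E) E (\<lambda>(g, e). \<phi> g e)"

definition orbit_rel ::
  "('g, 'm) monoid_scheme \<Rightarrow> ('g \<Rightarrow> 'e \<Rightarrow> 'e) \<Rightarrow> 'e set \<Rightarrow> ('e \<times> 'e) set" where
  "orbit_rel G \<phi> E = {(x, y). x \<in> E \<and> y \<in> orbit G \<phi> x}"

definition orbit_space ::
  "('g, 'm) monoid_scheme \<Rightarrow> 'e diffspace \<Rightarrow> ('g \<Rightarrow> 'e \<Rightarrow> 'e) \<Rightarrow> 'e set diffspace" where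
  "orbit_space G E \<phi> = quotient_diff E (orbit_rel G \<phi> (pts E))"


section \<open>Fibre bundles\<close>
definition bundle_iso ::
  "'e diffspace \<Rightarrow> ('e \<Rightarrow> 'x) \<Rightarrow> 'd diffspace \<Rightarrow> ('d \<Rightarrow> 'x) \<Rightarrow> bool" where
  "bundle_iso E \<pi> E' \<pi>' \<longleftrightarrow>
     (\<exists>\<Phi>. diffeomorphism E E' \<Phi> \<and> (\<forall>e\<in>pts E. \<pi>' (\<Phi> e) = \<pi> e))"

definition pullback_space ::
  "'y diffspace \<Rightarrow> ('y \<Rightarrow> 'x) \<Rightarrow> 'e diffspace \<Rightarrow> ('e \<Rightarrow> 'x) \<Rightarrow> ('y \<times> 'e) diffspace" where
  "pullback_space Y f E \<pi> = subset_diff (prod_diff Y E) {(y, e). f y = \<pi> e}"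

definition trivial_bundle ::
  "'e diffspace \<Rightarrow> ('e \<Rightarrow> 'x) \<Rightarrow> 'x diffspace \<Rightarrow> 'f diffspace \<Rightarrow> bool" where
  "trivial_bundle E \<pi> X F \<longleftrightarrow> smooth_map E X \<pi> \<and> bundle_iso E \<pi> (prod_diff X F) fst"

definition locally_trivial ::
  "'e diffspace \<Rightarrow> ('e \<Rightarrow> 'x) \<Rightarrow> 'x diffspace \<Rightarrow> 'f diffspace \<Rightarrow> bool" where
  "locally_trivial E \<pi> X F \<longleftrightarrow> smooth_map E X \<pi> \<and>
     (\<exists>\<U>. (\<forall>U\<in>\<U>. openin (D_topology X) U) \<and> \<Union>\<U> = pts X \<and>
        (\<forall>U\<in>\<U>. trivial_bundle (subset_diff E {e. \<pi> e \<in> U}) \<pi> (subset_diff X U) F))"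

text \<open>
  The projection of a bundle is a surjection.  If the fibre is empty, this can only hold over the
  empty base; it is therefore required for nonempty fibres only, so that the empty \<open>G\<close>-space \<open>F\<close>
  need not be excluded: its associated bundles are empty.
\<close>

definition diffeological_fibre_bundle ::
  "'e diffspace \<Rightarrow> ('e \<Rightarrow> 'x) \<Rightarrow> 'x diffspace \<Rightarrow> 'f diffspace \<Rightarrow> bool" where
  "diffeological_fibre_bundle E \<pi> X F \<longleftrightarrow>
     diffeological_space E \<and> smooth_map E X \<pi> \<and> (pts F \<noteq> {} \<longrightarrow> \<pi> ` pts E = pts X) \<and>
     (\<forall>n U p. plots X n U p \<longrightarrow>
        locally_trivial (pullback_space (eucl_diff n U) p E \<pi>) fst (eucl_diff n U) F)"

text \<open>
  Equivariance of the local diffeomorphisms \<open>(v, g) \<mapsto> (v, g \<cdot> q v)\<close> is part of the action laws.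
\<close>

definition principal_bundle ::
  "('g, 'm) monoid_scheme \<Rightarrow> 'g diffspace \<Rightarrow> 'e diffspace \<Rightarrow> ('e \<Rightarrow> 'x) \<Rightarrow> 'x diffspace
     \<Rightarrow> ('g \<Rightarrow> 'e \<Rightarrow> 'e) \<Rightarrow> bool" where
  "principal_bundle G DG E \<pi> X \<phi> \<longleftrightarrow>
     diffeological_fibre_bundle E \<pi> X DG \<and> smooth_action G DG E \<phi> \<and>
     (\<forall>n U p u. plots X n U p \<and> u \<in> U \<longrightarrow>
        (\<exists>V q. openin (Euclidean_space n) V \<and> u \<in> V \<and> V \<subseteq> U \<and> plots E n V q \<and>
               (\<forall>v\<in>V. \<pi> (q v) = p v) \<and>
               diffeomorphism (prod_diff (eucl_diff n V) DG)
                 (pullback_space (eucl_diff n V) p E \<pi>) (\<lambda>(v, g). (v, \<phi> g (q v)))))"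

definition associated_space ::
  "('g, 'm) monoid_scheme \<Rightarrow> 'e diffspace \<Rightarrow> ('g \<Rightarrow> 'e \<Rightarrow> 'e) \<Rightarrow> 'f diffspace \<Rightarrow> ('g \<Rightarrow> 'f \<Rightarrow> 'f)
     \<Rightarrow> ('e \<times> 'f) set diffspace" where
  "associated_space G E \<phi> F \<psi> =
     orbit_space G (prod_diff E F) (\<lambda>g (e, y). (\<phi> g e, \<psi> g y))"

definition associated_proj :: "('e \<Rightarrow> 'x) \<Rightarrow> ('e \<times> 'f) set \<Rightarrow> 'x" where
  "associated_proj \<pi> c = the_elem ((\<lambda>(e, y). \<pi> e) ` c)"

text \<open>
  A bundle with fibre the \<open>G\<close>-space \<open>F\<close> and structure group \<open>G\<close> arises as an associated bundle of a
  principal \<open>G\<close>-bundle \<open>P\<close>.  Local triviality of such a bundle is understood with respect to the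
  structure group, i.e. \<open>P\<close> itself is locally trivial over the \<open>D\<close>-topology of \<open>X\<close>.  This is stronger
  than local triviality of the total space over \<open>X\<close> as a mere bundle with fibre the space \<open>F\<close>.

  A principal \<open>G\<close>-bundle over \<open>X\<close> is fibrewise in bijection with \<open>X \<times> G\<close>, and a bundle over \<open>X\<close>
  with fibre \<open>F\<close> is fibrewise in bijection with \<open>X \<times> F\<close>.  Up to isomorphism, their total spaces can
  thus be taken in the types \<open>'x \<times> 'g\<close> and \<open>'x \<times> 'f\<close>, which here serve as universes.
\<close>

definition structured_bundle ::
  "('g, 'm) monoid_scheme \<Rightarrow> 'g diffspace \<Rightarrow> 'f diffspace \<Rightarrow> ('g \<Rightarrow> 'f \<Rightarrow> 'f) \<Rightarrow>
     'x diffspace \<Rightarrow> 'e diffspace \<Rightarrow> ('e \<Rightarrow> 'x) \<Rightarrow> bool" where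
  "structured_bundle G DG F \<psi> X E \<pi> \<longleftrightarrow>
     diffeological_fibre_bundle E \<pi> X F \<and> locally_trivial E \<pi> X F \<and>
     (\<exists>(P :: ('x \<times> 'g) diffspace) \<kappa> \<phi>.
        principal_bundle G DG P \<kappa> X \<phi> \<and> locally_trivial P \<kappa> X DG \<and>
        bundle_iso E \<pi> (associated_space G P \<phi> F \<psi>) (associated_proj \<kappa>))"

type_synonym ('x, 'f) fbundle = "('x \<times> 'f) diffspace \<times> ('x \<times> 'f \<Rightarrow> 'x)"

definition bundles ::
  "('g, 'm) monoid_scheme \<Rightarrow> 'g diffspace \<Rightarrow> 'f diffspace \<Rightarrow> ('g \<Rightarrow> 'f \<Rightarrow> 'f) \<Rightarrow>
     'x diffspace \<Rightarrow> ('x, 'f) fbundle set" where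
  "bundles G DG F \<psi> X = {(E, \<pi>). structured_bundle G DG F \<psi> X E \<pi>}"

definition bundle_classes ::
  "('g, 'm) monoid_scheme \<Rightarrow> 'g diffspace \<Rightarrow> 'f diffspace \<Rightarrow> ('g \<Rightarrow> 'f \<Rightarrow> 'f) \<Rightarrow>
     'x diffspace \<Rightarrow> ('x, 'f) fbundle set set" where
  "bundle_classes G DG F \<psi> X =
     bundles G DG F \<psi> X //
       {((E, \<pi>), (E', \<pi>')). (E, \<pi>) \<in> bundles G DG F \<psi> X \<and> (E', \<pi>') \<in> bundles G DG F \<psi> X \<and>
                           bundle_iso E \<pi> E' \<pi>'}"

text \<open>
  The class of the pullback is represented by the bundles with total space in \<open>'x \<times> 'f\<close> that are
  isomorphic to it.
\<close>

definition bundle_pullback ::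
  "('g, 'm) monoid_scheme \<Rightarrow> 'g diffspace \<Rightarrow> 'f diffspace \<Rightarrow> ('g \<Rightarrow> 'f \<Rightarrow> 'f) \<Rightarrow>
     'x diffspace \<Rightarrow> ('x \<Rightarrow> 'y) \<Rightarrow> ('y, 'f) fbundle set \<Rightarrow> ('x, 'f) fbundle set" where
  "bundle_pullback G DG F \<psi> X f c =
     {(E', \<pi>'). (E', \<pi>') \<in> bundles G DG F \<psi> X \<and>
        (\<exists>(E, \<pi>)\<in>c. bundle_iso E' \<pi>' (pullback_space X f E \<pi>) fst)}"


section \<open>The Milnor construction\<close>

definition milnor_S ::
  "('g, 'm) monoid_scheme \<Rightarrow> 'g diffspace \<Rightarrow> ((nat \<Rightarrow> real) \<times> (nat \<Rightarrow> 'g)) diffspace" where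
  "milnor_S G DG =
     subset_diff (prod_diff (seq_diff (subset_diff real_diff {0..1})) (seq_diff DG))
       {(t, g). finite {i. t i \<noteq> 0} \<and> (\<Sum>i | t i \<noteq> 0. t i) = 1}"

definition milnor_rel ::
  "('g, 'm) monoid_scheme \<Rightarrow> 'g diffspace \<Rightarrow>
     (((nat \<Rightarrow> real) \<times> (nat \<Rightarrow> 'g)) \<times> ((nat \<Rightarrow> real) \<times> (nat \<Rightarrow> 'g))) set" where
  "milnor_rel G DG =
     {((t, g), (t', g')). (t, g) \<in> pts (milnor_S G DG) \<and> (t', g') \<in> pts (milnor_S G DG) \<and>
        (\<forall>i. t i = t' i) \<and> (\<forall>i. t i \<noteq> 0 \<longrightarrow> g i = g' i)}"

definition milnor_E ::
  "('g, 'm) monoid_scheme \<Rightarrow> 'g diffspace \<Rightarrow> ((nat \<Rightarrow> real) \<times> (nat \<Rightarrow> 'g)) set diffspace" where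
  "milnor_E G DG = quotient_diff (milnor_S G DG) (milnor_rel G DG)"

definition milnor_action ::
  "('g, 'm) monoid_scheme \<Rightarrow> 'g \<Rightarrow> ((nat \<Rightarrow> real) \<times> (nat \<Rightarrow> 'g)) set
     \<Rightarrow> ((nat \<Rightarrow> real) \<times> (nat \<Rightarrow> 'g)) set" where
  "milnor_action G h c = (\<lambda>(t, g). (t, \<lambda>i. g i \<otimes>\<^bsub>G\<^esub> inv\<^bsub>G\<^esub> h)) ` c"

definition milnor_B ::
  "('g, 'm) monoid_scheme \<Rightarrow> 'g diffspace
     \<Rightarrow> ((nat \<Rightarrow> real) \<times> (nat \<Rightarrow> 'g)) set set diffspace" where
  "milnor_B G DG = orbit_space G (milnor_E G DG) (milnor_action G)"

end

theory Submission
  imports Defs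
begin

text \<open>
  The Milnor bundle \<open>EG \<rightarrow> BG\<close> has smooth sections over the \<open>D\<close>-open sets \<open>t\<^sub>j \<noteq> 0\<close>.  A map \<open>f: X \<rightarrow> BG\<close> is sent
  to the bundle with fibre \<open>F\<close> associated with \<open>f\<^sup>*EG\<close>, and an equivariant map \<open>P \<rightarrow> EG\<close> over \<open>f\<close> identifies
  this bundle with the one associated with \<open>P\<close>.  Surjectivity: given countably many sections \<open>\<sigma>\<^sub>n\<close> of a
  principal bundle \<open>P\<close> and a subordinate partition of unity \<open>\<rho>\<^sub>n\<close>, the map
  \<open>e \<mapsto> (\<rho>\<^sub>n (\<kappa> e), g\<^sub>n e)\<close> with \<open>g\<^sub>n e \<cdot> e = \<sigma>\<^sub>n (\<kappa> e)\<close> is equivariant.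

  Homotopy invariance: if every path \<open>H(x, [0,1])\<close> lies in a single set \<open>t\<^sub>j \<noteq> 0\<close>, the sections provide a
  transport along these paths; it is carried out in countably many, locally finitely many, steps
  \<open>H(x, \<rho>\<^sub>0 x + \<dots> + \<rho>\<^sub>k\<^sub>-\<^sub>1 x)\<close> with a partition of unity subordinate to the sets of \<open>x\<close> having a common \<open>j\<close>.
  For a general \<open>H\<close>, let \<open>W\<^sub>N\<close> be the set of \<open>x\<close> for which the pieces of \<open>H(x, -)\<close> of length \<open>1/(N+1)\<close> are
  short in this sense; the same steps for a partition of unity subordinate to the \<open>W\<^sub>N\<close>, with the
  \<open>N\<close>-th one divided into \<open>N+1\<close> equal parts, reduce to the former case.  No bump functions on \<open>\<real>\<close> are needed.
\<close>

section \<open>Smooth functions on open subsets of Euclidean spaces\<close>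

text \<open>The obstacle is Milnor's space: a germ in \<open>EG\<close> has to lift to
  \<open>SG\<close> with all infinitely many group coordinates smooth on one common neighbourhood,
  also where weights vanish, whereas g_n exists only over the domain of its section and need not
  extend. Near a point finitely many weights are active, and the other coordinates may be
  overwritten by the unit since the relation ignores them. Coordinates are numbered by naturals, so
  countably many sections must suffice; second countability provides them through the Lindeloef
  property.

  Smoothness is therefore treated by germs and neighbourhood filters, and isomorphisms are
  recognised by lifting germs through smooth injections instead of inverting maps on quotients. The
  key isomorphisms between associated bundles and their pullbacks come from one lemma about
  equivariant maps of torsors: it serves pullbacks, the change of carrier type, classifying maps and
  homotopies alike. For homotopies, the infinitely many steps compose because each is exactly the
  identity where its weight vanishes; this property is carried through the nested construction as a
  second conclusion.\<close>

abbreviation eucl_nhds :: "nat \<Rightarrow> (nat \<Rightarrow> real) \<Rightarrow> (nat \<Rightarrow> real) filter" where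
  "eucl_nhds n x \<equiv> nhdsin (Euclidean_space n) x"

text \<open>Cubes serve as the neighbourhood base: coordinates from \<open>n\<close> on vanish on
  \<open>Euclidean_space n\<close>, so finitely many inequalities suffice.\<close>

definition eucl_box :: "nat \<Rightarrow> (nat \<Rightarrow> real) \<Rightarrow> real \<Rightarrow> (nat \<Rightarrow> real) set" where
  "eucl_box n x e = {y \<in> topspace (Euclidean_space n). \<forall>i<n. \<bar>y i - x i\<bar> < e}"

lemma openin_eucl_box: "openin (Euclidean_space n) (eucl_box n x e)"
proof -
  have "open ((\<lambda>y::nat \<Rightarrow> real. y i) -` {x i - e<..<x i + e})" for i
    by (intro open_vimage continuous_on_product_coordinates) auto
  then have "open (\<Inter>i\<in>{..<n}. (\<lambda>y::nat \<Rightarrow> real. y i) -` {x i - e<..<x i + e})"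
    by (intro open_INT) auto
  moreover have "eucl_box n x e = (\<Inter>i\<in>{..<n}. (\<lambda>y::nat \<Rightarrow> real. y i) -` {x i - e<..<x i + e})
      \<inter> topspace (Euclidean_space n)"
    by (force simp: eucl_box_def abs_less_iff)
  ultimately show ?thesis
    unfolding Euclidean_space_def topspace_Euclidean_space
    by (auto simp: openin_subtopology euclidean_product_topology)
qed

lemma eucl_box_subset_open:
  assumes U: "openin (Euclidean_space n) U" and x: "x \<in> U"
  shows "\<exists>e>0. eucl_box n x e \<subseteq> U"
proof -
  obtain S where S: "openin (powertop_real UNIV) S" and US: "U = S \<inter> topspace (Euclidean_space n)"
    using U unfolding Euclidean_space_def by (auto simp: openin_subtopology)
  obtain W where fin: "finite {i. W i \<noteq> (UNIV::real set)}" and W: "\<And>i. open (W i)"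
    and xW: "\<And>i. x i \<in> W i" and WS: "Pi\<^sub>E UNIV W \<subseteq> S"
    using S x US unfolding openin_product_topology_alt by (auto simp: PiE_def Pi_def)
  have "\<exists>e>0. \<forall>y. \<bar>y - x i\<bar> < e \<longrightarrow> y \<in> W i" for i
    using W[of i] xW[of i] unfolding open_dist dist_real_def by blast
  then obtain e where e: "\<And>i. e i > 0" "\<And>i y. \<bar>y - x i\<bar> < e i \<Longrightarrow> y \<in> W i" by metis
  \<comment> \<open>Basic open sets of the product topology constrain finitely many coordinates, so
    the minimum of their radii is positive; the entry 1 covers the case of no constraint.\<close>
  define d where "d = Min (insert 1 (e ` {i. W i \<noteq> UNIV}))"
  have d: "d > 0" "\<And>i. W i \<noteq> UNIV \<Longrightarrow> d \<le> e i"
    using fin e by (auto simp: d_def)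
  have "y \<in> U" if y: "y \<in> eucl_box n x d" for y
  proof -
    have "y i \<in> W i" for i
    proof (cases "i < n \<and> W i \<noteq> UNIV")
      case True
      then show ?thesis using y d(2)[of i] by (intro e(2)) (auto simp: eucl_box_def)
    next
      case False
      moreover have "y i = x i" if "i \<ge> n"
        using y x US that by (auto simp: eucl_box_def topspace_Euclidean_space)
      ultimately show ?thesis using xW[of i] by (cases "W i = UNIV") auto
    qed
    then show ?thesis using WS US y by (auto simp: eucl_box_def)
  qed
  with d show ?thesis by blast
qed

lemma eventually_eucl_nhds:
  assumes "x \<in> topspace (Euclidean_space n)"
  shows "eventually P (eucl_nhds n x) \<longleftrightarrow> (\<exists>e>0. \<forall>y\<in>eucl_box n x e. P y)"
proof
  assume "eventually P (eucl_nhds n x)"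
  then obtain S where "openin (Euclidean_space n) S" "x \<in> S" "\<forall>y\<in>S. P y"
    using assms by (auto simp: eventually_nhdsin)
  then show "\<exists>e>0. \<forall>y\<in>eucl_box n x e. P y" by (meson eucl_box_subset_open subsetD)
next
  assume "\<exists>e>0. \<forall>y\<in>eucl_box n x e. P y"
  then obtain e where "e > 0" "\<forall>y\<in>eucl_box n x e. P y" by blast
  moreover have "x \<in> eucl_box n x e" using assms \<open>e > 0\<close> by (auto simp: eucl_box_def)
  ultimately show "eventually P (eucl_nhds n x)"
    unfolding eventually_nhdsin using openin_eucl_box[of n x e] by meson
qed

lemma eventually_in_openin:
  assumes "openin T U" "x \<in> U" shows "eventually (\<lambda>y. y \<in> U) (nhdsin T x)"
  using assms unfolding eventually_nhdsin by blast

lemma eventually_nhdsin_topspace: "eventually (\<lambda>y. y \<in> topspace T) (nhdsin T x)"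
  by (auto simp: eventually_nhdsin)

lemma eventually_nhdsin_self:
  assumes "eventually P (nhdsin T x)" "x \<in> topspace T" shows "P x"
  using assms by (auto simp: eventually_nhdsin)

text \<open>Allows openness to be checked with filters at each point, so that several local
  conditions can be combined by \<open>eventually_elim\<close> instead of intersecting open
  sets.\<close>

lemma openin_eventually_iff:
  "openin T U \<longleftrightarrow> U \<subseteq> topspace T \<and> (\<forall>x\<in>U. eventually (\<lambda>y. y \<in> U) (nhdsin T x))"
proof
  assume "openin T U"
  then show "U \<subseteq> topspace T \<and> (\<forall>x\<in>U. eventually (\<lambda>y. y \<in> U) (nhdsin T x))"
    by (auto simp: openin_subset intro: eventually_in_openin)
next
  assume "U \<subseteq> topspace T \<and> (\<forall>x\<in>U. eventually (\<lambda>y. y \<in> U) (nhdsin T x))"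
  then have "\<forall>x\<in>U. \<exists>S. openin T S \<and> x \<in> S \<and> S \<subseteq> U"
    unfolding eventually_nhdsin by (meson subsetD subsetI)
  then show "openin T U" by (subst openin_subopen) blast
qed

text \<open>Replaces the subspace continuity in \<open>Ck_on\<close> by limits in the ambient
  neighbourhood filter; the two agree because \<open>U\<close> is open.\<close>

lemma continuous_map_real_iff:
  assumes U: "openin T U"
  shows "continuous_map (subtopology T U) euclideanreal f \<longleftrightarrow> (\<forall>x\<in>U. (f \<longlongrightarrow> f x) (nhdsin T x))"
proof
  assume c: "continuous_map (subtopology T U) euclideanreal f"
  show "\<forall>x\<in>U. (f \<longlongrightarrow> f x) (nhdsin T x)"
  proof (intro ballI topological_tendstoI)
    fix x S assume x: "x \<in> U" and S: "open S" "f x \<in> S"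
    have "openin (subtopology T U) {x \<in> topspace (subtopology T U). f x \<in> S}"
      using c S by (intro openin_continuous_map_preimage[OF c]) auto
    then have "openin T {x \<in> topspace (subtopology T U). f x \<in> S}"
      using U by (simp add: openin_open_subtopology)
    moreover have "x \<in> {x \<in> topspace (subtopology T U). f x \<in> S}"
      using x S U openin_subset by fastforce
    ultimately show "eventually (\<lambda>x. f x \<in> S) (nhdsin T x)"
      by (auto simp: eventually_nhdsin)
  qed
next
  assume l: "\<forall>x\<in>U. (f \<longlongrightarrow> f x) (nhdsin T x)"
  show "continuous_map (subtopology T U) euclideanreal f"
    unfolding continuous_map_def
  proof (intro conjI allI impI)
    fix S :: "real set" assume "openin euclidean S"
    then have S: "open S" by simp
    have "openin T {x \<in> U. f x \<in> S}"
      unfolding openin_eventually_iff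
    proof (intro conjI ballI)
      fix x assume x: "x \<in> {x \<in> U. f x \<in> S}"
      have "eventually (\<lambda>y. f y \<in> S) (nhdsin T x)"
        using l x S topological_tendstoD by blast
      moreover have "eventually (\<lambda>y. y \<in> U) (nhdsin T x)"
        using U x by (intro eventually_in_openin) auto
      ultimately show "eventually (\<lambda>y. y \<in> {x \<in> U. f x \<in> S}) (nhdsin T x)"
        by eventually_elim auto
    qed (use U openin_subset in blast)
    moreover have "{x \<in> topspace (subtopology T U). f x \<in> S} = {x \<in> U. f x \<in> S}"
      using U openin_subset by auto
    ultimately show "openin (subtopology T U) {x \<in> topspace (subtopology T U). f x \<in> S}"
      using U by (auto simp: openin_open_subtopology)
  qed auto
qed

text \<open>By the cube base only the first \<open>n\<close> coordinates have to converge; the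
  remaining ones are zero once the values lie in the space.\<close>

lemma filterlim_eucl_nhds:
  assumes "\<And>i. i < n \<Longrightarrow> ((\<lambda>z. c z i) \<longlongrightarrow> x i) F" and x: "x \<in> topspace (Euclidean_space n)"
    and top: "eventually (\<lambda>z. c z \<in> topspace (Euclidean_space n)) F"
  shows "filterlim c (eucl_nhds n x) F"
  unfolding filterlim_iff
proof (intro allI impI)
  fix P assume "eventually P (eucl_nhds n x)"
  then obtain e where e: "e > 0" "\<forall>y\<in>eucl_box n x e. P y"
    using eventually_eucl_nhds[OF x] by blast
  have "eventually (\<lambda>z. \<forall>i<n. \<bar>c z i - x i\<bar> < e) F"
  proof -
    have "eventually (\<lambda>z. \<bar>c z i - x i\<bar> < e) F" if "i < n" for i
      using assms(1)[OF that] e(1) by (auto simp: tendsto_iff dist_real_def)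
    then have "eventually (\<lambda>z. \<forall>i\<in>{..<n}. \<bar>c z i - x i\<bar> < e) F"
      by (intro eventually_ball_finite) auto
    then show ?thesis by (simp add: lessThan_def)
  qed
  with top show "eventually (\<lambda>z. P (c z)) F"
    by eventually_elim (use e in \<open>auto simp: eucl_box_def\<close>)
qed

lemma tendsto_coordinate:
  assumes "x \<in> topspace (Euclidean_space n)"
  shows "((\<lambda>y. y i) \<longlongrightarrow> x i) (eucl_nhds n x)"
proof (cases "i < n")
  case True
  show ?thesis
    unfolding tendsto_iff eventually_eucl_nhds[OF assms]
    using True by (auto simp: eucl_box_def dist_real_def)
next
  case False
  have "eventually (\<lambda>y. y i = x i) (eucl_nhds n x)"
    using eventually_nhdsin_topspace
    by eventually_elim (use False assms in \<open>auto simp: topspace_Euclidean_space\<close>)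
  then show ?thesis by (rule tendsto_eventually)
qed

lemma fun_upd_in_Euclidean:
  "x \<in> topspace (Euclidean_space n) \<Longrightarrow> i < n \<Longrightarrow> x(i := t) \<in> topspace (Euclidean_space n)"
  by (auto simp: topspace_Euclidean_space)

lemma filterlim_fun_upd:
  assumes "x \<in> topspace (Euclidean_space n)" "i < n"
  shows "filterlim (\<lambda>t. x(i := t)) (eucl_nhds n x) (nhds (x i))"
proof (rule filterlim_eucl_nhds[OF _ assms(1)])
  show "((\<lambda>t. (x(i := t)) j) \<longlongrightarrow> x j) (nhds (x i))" for j
    by (cases "j = i") (auto simp: filterlim_ident)
qed (use assms in \<open>auto simp: fun_upd_in_Euclidean intro!: always_eventually\<close>)

lemma eventually_fun_upd:
  assumes "openin (Euclidean_space n) U" "x \<in> U" "i < n"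
  shows "eventually (\<lambda>t. x(i := t) \<in> U) (nhds (x i))"
proof -
  have "x \<in> topspace (Euclidean_space n)" using assms(1,2) openin_subset by blast
  from filterlim_fun_upd[OF this assms(3)] eventually_in_openin[OF assms(1,2)]
  show ?thesis unfolding filterlim_iff by blast
qed

section \<open>Calculus of \<open>Ck_on\<close>: dependence on germs, sums and products, chain
  rule\<close>

lemma Ck_on_Suc_iff:
  assumes "openin (Euclidean_space n) U"
  shows "Ck_on (Suc k) n U f \<longleftrightarrow> (\<forall>x\<in>U. (f \<longlongrightarrow> f x) (eucl_nhds n x)) \<and>
    (\<forall>i<n. (\<forall>x\<in>U. ((\<lambda>t. f (x(i := t))) has_field_derivative partial_deriv i f x) (at (x i))) \<and>
       Ck_on k n U (partial_deriv i f))"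
  by (simp add: continuous_map_real_iff[OF assms] partial_deriv_def DERIV_deriv_iff_real_differentiable)

lemma Ck_on_0_iff:
  assumes "openin (Euclidean_space n) U"
  shows "Ck_on 0 n U f \<longleftrightarrow> (\<forall>x\<in>U. (f \<longlongrightarrow> f x) (eucl_nhds n x))"
  by (simp add: continuous_map_real_iff[OF assms])

lemma Ck_on_tendsto:
  assumes "openin (Euclidean_space n) U" "Ck_on k n U f" "x \<in> U"
  shows "(f \<longlongrightarrow> f x) (eucl_nhds n x)"
  using assms Ck_on_0_iff[OF assms(1)] Ck_on_Suc_iff[OF assms(1)] by (cases k) blast+

text \<open>Partial derivatives at a point of the open set \<open>U\<close> see only the germ of the
  function: the coordinate line through \<open>x\<close> stays in \<open>U\<close> near
  \<open>x i\<close>. This is why values outside \<open>U\<close> may be arbitrary.\<close>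

lemma Ck_on_cong:
  assumes U: "openin (Euclidean_space n) U"
  shows "Ck_on k n U f \<Longrightarrow> (\<And>x. x \<in> U \<Longrightarrow> f x = g x) \<Longrightarrow> Ck_on k n U g"
proof (induction k arbitrary: f g)
  case 0
  have "continuous_map (subtopology (Euclidean_space n) U) euclideanreal g"
    using 0 by (intro continuous_map_eq[of _ _ f g]) auto
  then show ?case by simp
next
  case (Suc k)
  have ev: "eventually (\<lambda>t. f (x(i := t)) = g (x(i := t))) (nhds (x i))" if "x \<in> U" "i < n" for x i
    using eventually_fun_upd[OF U that] by eventually_elim (use Suc.prems in auto)
  have pd: "partial_deriv i f x = partial_deriv i g x" if "x \<in> U" "i < n" for x i
    unfolding partial_deriv_def by (rule deriv_cong_ev[OF ev[OF that] refl])
  have "continuous_map (subtopology (Euclidean_space n) U) euclideanreal g"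
    using Suc.prems by (intro continuous_map_eq[of _ _ f g]) auto
  moreover have "((\<lambda>t. g (x(i := t))) has_field_derivative partial_deriv i g x) (at (x i))"
    if "x \<in> U" "i < n" for x i
    using Suc.prems(1) that DERIV_cong_ev[OF refl ev[OF that] pd[OF that]]
    unfolding Ck_on_Suc_iff[OF U] by blast
  moreover have "Ck_on k n U (partial_deriv i g)" if "i < n" for i
    using Suc.IH[of "partial_deriv i f" "partial_deriv i g"] Suc.prems(1) pd that by auto
  ultimately show ?case
    unfolding Ck_on_Suc_iff[OF U] continuous_map_real_iff[OF U, symmetric] by blast
qed

text \<open>Lets an explicit candidate \<open>f'\<close> stand in for \<open>partial_deriv\<close>,
  which is only given through \<open>deriv\<close>; uniqueness of derivatives identifies the two on
  \<open>U\<close>.\<close>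

lemma Ck_on_SucI:
  assumes U: "openin (Euclidean_space n) U"
    and "\<And>x. x \<in> U \<Longrightarrow> (f \<longlongrightarrow> f x) (eucl_nhds n x)"
    and d: "\<And>i x. i < n \<Longrightarrow> x \<in> U \<Longrightarrow>
      ((\<lambda>t. f (x(i := t))) has_field_derivative f' i x) (at (x i))"
    and ck: "\<And>i. i < n \<Longrightarrow> Ck_on k n U (f' i)"
  shows "Ck_on (Suc k) n U f"
proof -
  have pd: "partial_deriv i f x = f' i x" if "i < n" "x \<in> U" for i x
    unfolding partial_deriv_def by (rule DERIV_imp_deriv[OF d[OF that]])
  have "Ck_on k n U (partial_deriv i f)" if "i < n" for i
    by (rule Ck_on_cong[OF U ck[OF that]]) (simp add: pd that)
  then show ?thesis unfolding Ck_on_Suc_iff[OF U] using assms(2) d pd by auto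
qed

lemma Ck_on_Suc_imp: "Ck_on (Suc k) n U f \<Longrightarrow> Ck_on k n U f"
proof (induction k arbitrary: f)
  case (Suc k)
  then show ?case by (simp (no_asm_use)) (metis Ck_on.simps(2))
qed auto

lemma Ck_on_const:
  assumes "openin (Euclidean_space n) U" shows "Ck_on k n U (\<lambda>_. c)"
proof (induction k arbitrary: c)
  case 0 then show ?case by simp
next
  case (Suc k)
  show ?case by (rule Ck_on_SucI[OF assms, where f' = "\<lambda>_ _. 0"]) (auto intro: Suc)
qed

lemma Ck_on_coordinate:
  assumes U: "openin (Euclidean_space n) U" shows "Ck_on k n U (\<lambda>x. x j)"
proof -
  have t: "((\<lambda>y. y j) \<longlongrightarrow> x j) (eucl_nhds n x)" if "x \<in> U" for x
    using tendsto_coordinate U that openin_subset by blast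
  show ?thesis
  proof (cases k)
    case 0 with t show ?thesis unfolding 0 Ck_on_0_iff[OF U] by blast
  next
    case (Suc k)
    have "((\<lambda>t. (x(i := t)) j) has_field_derivative (if i = j then 1 else 0)) (at (x i))" for x :: "nat \<Rightarrow> real" and i
      by (auto intro!: derivative_eq_intros)
    then show ?thesis
      unfolding Suc by (intro Ck_on_SucI[OF U t, where f' = "\<lambda>i _. if i = j then 1 else 0"] Ck_on_const[OF U])
  qed
qed

lemma Ck_on_add:
  assumes U: "openin (Euclidean_space n) U"
  shows "Ck_on k n U f \<Longrightarrow> Ck_on k n U g \<Longrightarrow> Ck_on k n U (\<lambda>x. f x + g x)"
proof (induction k arbitrary: f g)
  case 0
  then show ?case unfolding Ck_on_0_iff[OF U] by (auto intro: tendsto_add)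
next
  case (Suc k)
  note fg = Suc.prems[unfolded Ck_on_Suc_iff[OF U]]
  show ?case
    by (rule Ck_on_SucI[OF U, where f' = "\<lambda>i x. partial_deriv i f x + partial_deriv i g x"])
      (use fg in \<open>auto intro: tendsto_add DERIV_add Suc.IH simp del: fun_upd_apply\<close>)
qed

text \<open>The product rule pairs a derivative with an undifferentiated factor, so the induction
  hypothesis is applied to the latter after lowering its order by
  \<open>Ck_on_Suc_imp\<close>.\<close>

lemma Ck_on_mult:
  assumes U: "openin (Euclidean_space n) U"
  shows "Ck_on k n U f \<Longrightarrow> Ck_on k n U g \<Longrightarrow> Ck_on k n U (\<lambda>x. f x * g x)"
proof (induction k arbitrary: f g)
  case 0
  then show ?case unfolding Ck_on_0_iff[OF U] by (auto intro: tendsto_mult)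
next
  case (Suc k)
  have "((\<lambda>t. f (x(i := t)) * g (x(i := t))) has_field_derivative
      partial_deriv i f x * g x + f x * partial_deriv i g x) (at (x i))" if "i < n" "x \<in> U" for i x
  proof -
    have "((\<lambda>t. f (x(i := t))) has_field_derivative partial_deriv i f x) (at (x i))"
      "((\<lambda>t. g (x(i := t))) has_field_derivative partial_deriv i g x) (at (x i))"
      using Suc.prems that unfolding Ck_on_Suc_iff[OF U] by blast+
    from DERIV_mult[OF this] show ?thesis by (simp add: algebra_simps)
  qed
  moreover have "Ck_on k n U (\<lambda>x. partial_deriv i f x * g x + f x * partial_deriv i g x)"
    if "i < n" for i
    using Suc.prems that
    by (intro Ck_on_add[OF U] Suc.IH Ck_on_Suc_imp[OF Suc.prems(1)] Ck_on_Suc_imp[OF Suc.prems(2)]) auto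
  moreover have "((\<lambda>x. f x * g x) \<longlongrightarrow> f x * g x) (eucl_nhds n x)" if "x \<in> U" for x
    using Suc.prems Ck_on_tendsto[OF U _ that] by (intro tendsto_mult) blast+
  ultimately show ?case
    by (intro Ck_on_SucI[OF U, where f' = "\<lambda>i x. partial_deriv i f x * g x + f x * partial_deriv i g x"])
      (auto simp del: fun_upd_apply)
qed

lemma Ck_on_sum:
  assumes U: "openin (Euclidean_space n) U" and "\<And>j. j \<in> A \<Longrightarrow> Ck_on k n U (f j)"
  shows "Ck_on k n U (\<lambda>x. \<Sum>j\<in>A. f j x)"
  using assms(2)
  by (induction A rule: infinite_finite_induct) (auto intro!: Ck_on_add[OF U] Ck_on_const[OF U] simp del: Ck_on.simps)

text \<open>
  Telescoping over the points agreeing with \<open>c t\<close> in the first \<open>j\<close> coordinates and with \<open>c t0\<close> in the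
  others reduces to the mean value theorem in one coordinate.
\<close>

lemma has_derivative_along_curve:
  assumes V: "openin (Euclidean_space n) V" and f: "Ck_on (Suc 0) n V f"
    and c0: "c t0 \<in> V" and cV: "eventually (\<lambda>t. c t \<in> topspace (Euclidean_space n)) (at t0)"
    and c: "\<And>j. j < n \<Longrightarrow> ((\<lambda>t. c t j) has_field_derivative c' j) (at t0)"
  shows "((\<lambda>t. f (c t)) has_field_derivative (\<Sum>j<n. partial_deriv j f (c t0) * c' j)) (at t0)"
proof -
  let ?T = "topspace (Euclidean_space n)"
  have c0T: "c t0 \<in> ?T" using c0 V openin_subset by blast
  define z where "z j t = (\<lambda>i. if i < j then c t i else c t0 i)" for j t
  obtain e where e: "e > 0" "eucl_box n (c t0) e \<subseteq> V"
    using eucl_box_subset_open[OF V c0] by blast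
  have cont: "((\<lambda>t. c t j) \<longlongrightarrow> c t0 j) (at t0)" if "j < n" for j
    using DERIV_isCont[OF c[OF that]] by (simp add: isCont_def)
  have near: "eventually (\<lambda>t. c t \<in> eucl_box n (c t0) d) (at t0)" if "d > 0" for d
  proof -
    have "filterlim c (eucl_nhds n (c t0)) (at t0)"
      by (intro filterlim_eucl_nhds c0T cV cont)
    moreover have "eventually (\<lambda>y. y \<in> eucl_box n (c t0) d) (eucl_nhds n (c t0))"
      using that eventually_eucl_nhds[OF c0T] by blast
    ultimately show ?thesis unfolding filterlim_iff by blast
  qed
  have step: "\<exists>\<zeta>. (\<forall>i<n. \<bar>\<zeta> i - c t0 i\<bar> \<le> \<bar>c t i - c t0 i\<bar>) \<and> \<zeta> \<in> ?T \<and>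
      f (z (Suc j) t) - f (z j t) = partial_deriv j f \<zeta> * (c t j - c t0 j)"
    if ct: "c t \<in> eucl_box n (c t0) e" and j: "j < n" for t j
  proof -
    have zT: "z j t \<in> ?T" using ct c0T j by (auto simp: z_def eucl_box_def topspace_Euclidean_space)
    have z_Suc: "z (Suc j) t = (z j t)(j := c t j)" by (auto simp: z_def fun_eq_iff less_Suc_eq)
    have zj: "z j t = (z j t)(j := c t0 j)" by (auto simp: z_def fun_eq_iff)
    let ?g = "\<lambda>s. f ((z j t)(j := s))"
    have close: "\<bar>((z j t)(j := s)) i - c t0 i\<bar> \<le> \<bar>c t i - c t0 i\<bar>"
      if "\<bar>s - c t0 j\<bar> \<le> \<bar>c t j - c t0 j\<bar>" for s i
      using that by (auto simp: z_def)
    \<comment> \<open>Each coordinate of an intermediate point is at most as far from that of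
      \<open>c t0\<close> as the coordinate of \<open>c t\<close> is, so the whole segment stays in
      the cube and hence in \<open>V\<close>.\<close>
    have inV: "(z j t)(j := s) \<in> V" if "\<bar>s - c t0 j\<bar> \<le> \<bar>c t j - c t0 j\<bar>" for s
    proof -
      have "\<bar>((z j t)(j := s)) i - c t0 i\<bar> < e" if "i < n" for i
        using close[OF \<open>\<bar>s - c t0 j\<bar> \<le> _\<close>, of i] ct that by (force simp: eucl_box_def)
      then have "(z j t)(j := s) \<in> eucl_box n (c t0) e"
        using fun_upd_in_Euclidean[OF zT j] unfolding eucl_box_def by blast
      then show ?thesis using e(2) by blast
    qed
    have der: "(?g has_field_derivative partial_deriv j f ((z j t)(j := s))) (at s)"
      if "\<bar>s - c t0 j\<bar> \<le> \<bar>c t j - c t0 j\<bar>" for s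
    proof -
      have "((\<lambda>r. f (((z j t)(j := s))(j := r))) has_field_derivative
          partial_deriv j f ((z j t)(j := s))) (at (((z j t)(j := s)) j))"
        using f inV[OF that] j unfolding Ck_on_Suc_iff[OF V] by blast
      then show ?thesis by simp
    qed
    obtain s where s: "\<bar>s - c t0 j\<bar> \<le> \<bar>c t j - c t0 j\<bar>"
      "?g (c t j) - ?g (c t0 j) = (c t j - c t0 j) * partial_deriv j f ((z j t)(j := s))"
    \<comment> \<open>The mean value theorem wants ordered end points; if they coincide, both sides
      are zero.\<close>
    proof (cases "c t j" "c t0 j" rule: linorder_cases)
      case less
      obtain s where "c t j < s" "s < c t0 j"
        "?g (c t0 j) - ?g (c t j) = (c t0 j - c t j) * partial_deriv j f ((z j t)(j := s))"
        using MVT2[OF less, of ?g "\<lambda>s. partial_deriv j f ((z j t)(j := s))"] der by force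
      then show ?thesis by (intro that[of s]) (auto simp: algebra_simps)
    next
      case equal then show ?thesis by (intro that[of "c t j"]) auto
    next
      case greater
      obtain s where "c t0 j < s" "s < c t j"
        "?g (c t j) - ?g (c t0 j) = (c t j - c t0 j) * partial_deriv j f ((z j t)(j := s))"
        using MVT2[OF greater, of ?g "\<lambda>s. partial_deriv j f ((z j t)(j := s))"] der by force
      then show ?thesis by (intro that[of s]) (auto simp: algebra_simps)
    qed
    then show ?thesis
      using close[OF s(1)] fun_upd_in_Euclidean[OF zT j, of s] z_Suc zj
      by (intro exI[of _ "(z j t)(j := s)"]) (auto simp: mult.commute)
  qed
  have lim: "((\<lambda>t. (f (z (Suc j) t) - f (z j t)) / (t - t0)) \<longlongrightarrow> partial_deriv j f (c t0) * c' j) (at t0)"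
    if j: "j < n" for j
  proof -
    obtain \<zeta> where \<zeta>: "\<And>t. c t \<in> eucl_box n (c t0) e \<Longrightarrow>
      (\<forall>i<n. \<bar>\<zeta> t i - c t0 i\<bar> \<le> \<bar>c t i - c t0 i\<bar>) \<and> \<zeta> t \<in> ?T \<and>
      f (z (Suc j) t) - f (z j t) = partial_deriv j f (\<zeta> t) * (c t j - c t0 j)"
      using step[OF _ j] by metis
    \<comment> \<open>The mean value points are squeezed towards \<open>c t0\<close>, so continuity
      of the partial derivative gives its limit along them.\<close>
    have "filterlim \<zeta> (eucl_nhds n (c t0)) (at t0)"
    proof (rule filterlim_eucl_nhds[OF _ c0T])
      show "eventually (\<lambda>t. \<zeta> t \<in> ?T) (at t0)"
        using near[OF e(1)] by eventually_elim (use \<zeta> in blast)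
      fix i assume i: "i < n"
      have "((\<lambda>t. \<zeta> t i - c t0 i) \<longlongrightarrow> 0) (at t0)"
      proof (rule Lim_null_comparison)
        show "eventually (\<lambda>t. norm (\<zeta> t i - c t0 i) \<le> \<bar>c t i - c t0 i\<bar>) (at t0)"
          using near[OF e(1)] by eventually_elim (use \<zeta> i in auto)
        show "((\<lambda>t. \<bar>c t i - c t0 i\<bar>) \<longlongrightarrow> 0) (at t0)"
          using cont[OF i] by (intro tendsto_rabs_zero) (simp add: LIM_zero)
      qed
      then show "((\<lambda>t. \<zeta> t i) \<longlongrightarrow> c t0 i) (at t0)" by (rule LIM_zero_cancel)
    qed
    moreover have "Ck_on 0 n V (partial_deriv j f)" using f j unfolding Ck_on_Suc_iff[OF V] by blast
    then have "(partial_deriv j f \<longlongrightarrow> partial_deriv j f (c t0)) (eucl_nhds n (c t0))"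
      using c0 unfolding Ck_on_0_iff[OF V] by blast
    ultimately have "((\<lambda>t. partial_deriv j f (\<zeta> t)) \<longlongrightarrow> partial_deriv j f (c t0)) (at t0)"
      by (rule filterlim_compose[rotated])
    moreover have "((\<lambda>t. (c t j - c t0 j) / (t - t0)) \<longlongrightarrow> c' j) (at t0)"
      using c[OF j] by (simp add: has_field_derivative_iff)
    ultimately have "((\<lambda>t. partial_deriv j f (\<zeta> t) * ((c t j - c t0 j) / (t - t0)))
        \<longlongrightarrow> partial_deriv j f (c t0) * c' j) (at t0)"
      by (rule tendsto_mult)
    moreover have "eventually (\<lambda>t. partial_deriv j f (\<zeta> t) * ((c t j - c t0 j) / (t - t0)) =
        (f (z (Suc j) t) - f (z j t)) / (t - t0)) (at t0)"
      using near[OF e(1)] by eventually_elim (use \<zeta> in auto)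
    ultimately show ?thesis by (rule Lim_transform_eventually)
  qed
  have "((\<lambda>t. \<Sum>j<n. (f (z (Suc j) t) - f (z j t)) / (t - t0)) \<longlongrightarrow>
      (\<Sum>j<n. partial_deriv j f (c t0) * c' j)) (at t0)"
    by (intro tendsto_sum lim) auto
  moreover have "eventually (\<lambda>t. (\<Sum>j<n. (f (z (Suc j) t) - f (z j t)) / (t - t0)) =
      (f (c t) - f (c t0)) / (t - t0)) (at t0)"
    using cV
  proof eventually_elim
    case (elim t)
    have "z n t = c t" using elim c0T by (auto simp: z_def topspace_Euclidean_space fun_eq_iff)
    moreover have "z 0 t = c t0" by (auto simp: z_def)
    ultimately show ?case
      using sum_lessThan_telescope[of "\<lambda>j. f (z j t)" n]
      by (simp add: sum_divide_distrib[symmetric])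
  qed
  ultimately have "((\<lambda>t. (f (c t) - f (c t0)) / (t - t0)) \<longlongrightarrow>
      (\<Sum>j<n. partial_deriv j f (c t0) * c' j)) (at t0)"
    by (rule Lim_transform_eventually)
  then show ?thesis by (simp add: has_field_derivative_iff)
qed

text \<open>Induction on the order: by the chain rule the partial derivatives of the composite are
  sums of products, one factor being a partial derivative of \<open>f\<close> composed with
  \<open>h\<close>, the other a partial derivative of a component of \<open>h\<close>. Both have one
  order less.\<close>

lemma Ck_on_compose:
  assumes V: "openin (Euclidean_space n) V" and U: "openin (Euclidean_space m) U"
    and h: "h \<in> U \<rightarrow> V"
  shows "Ck_on k n V f \<Longrightarrow> (\<And>j. j < n \<Longrightarrow> Ck_on k m U (\<lambda>x. h x j)) \<Longrightarrow> Ck_on k m U (\<lambda>x. f (h x))"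
proof (induction k arbitrary: f)
  case (0 f)
  have cont: "((\<lambda>x. f (h x)) \<longlongrightarrow> f (h x)) (eucl_nhds m x)" if x: "x \<in> U" for x
  proof -
    have hx: "h x \<in> V" using h x by blast
    have "filterlim h (eucl_nhds n (h x)) (eucl_nhds m x)"
    proof (rule filterlim_eucl_nhds)
      show "eventually (\<lambda>z. h z \<in> topspace (Euclidean_space n)) (eucl_nhds m x)"
        using eventually_in_openin[OF U x]
        by eventually_elim (use h V openin_subset in blast)
      show "h x \<in> topspace (Euclidean_space n)" using hx V openin_subset by blast
    qed (use 0 x Ck_on_tendsto[OF U] in blast)
    then show ?thesis using Ck_on_tendsto[OF V 0(1) hx] filterlim_compose by blast
  qed
  then show ?case unfolding Ck_on_0_iff[OF U] by blast
next
  case (Suc k f)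
  have IH: "Ck_on k m U (\<lambda>x. partial_deriv j f (h x))" if "j < n" for j
  proof (rule Suc.IH)
    show "Ck_on k n V (partial_deriv j f)" using Suc.prems(1) that by simp
    show "Ck_on k m U (\<lambda>x. h x l)" if "l < n" for l
      by (rule Ck_on_Suc_imp[OF Suc.prems(2)[OF that]])
  qed
  \<comment> \<open>The chain rule along a curve needs only order 1, whatever \<open>k\<close> is;
    order \<open>k\<close> of the partial derivatives gives their continuity.\<close>
  have f1: "Ck_on (Suc 0) n V f"
  proof -
    have "Ck_on 0 n V g" if "Ck_on k n V g" for g
      using that Ck_on_tendsto[OF V] unfolding Ck_on_0_iff[OF V] by blast
    then show ?thesis using Suc.prems(1) unfolding Ck_on_Suc_iff[OF V] by blast
  qed
  have der: "((\<lambda>t. f (h (x(i := t)))) has_field_derivative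
      (\<Sum>j<n. partial_deriv j f (h x) * partial_deriv i (\<lambda>x. h x j) x)) (at (x i))"
    if i: "i < m" and x: "x \<in> U" for i x
  proof -
    have "((\<lambda>t. f (h (x(i := t)))) has_field_derivative
      (\<Sum>j<n. partial_deriv j f (h (x(i := x i))) * partial_deriv i (\<lambda>x. h x j) x)) (at (x i))"
    proof (rule has_derivative_along_curve[OF V f1])
      show "h (x(i := x i)) \<in> V" using h x by auto
      have "eventually (\<lambda>t. x(i := t) \<in> U) (at (x i))"
        using eventually_fun_upd[OF U x i] unfolding eventually_at_filter
        by (auto elim: eventually_mono)
      then show "eventually (\<lambda>t. h (x(i := t)) \<in> topspace (Euclidean_space n)) (at (x i))"
        by eventually_elim (use h V openin_subset in blast)
      fix j assume j: "j < n"
      show "((\<lambda>t. h (x(i := t)) j) has_field_derivative partial_deriv i (\<lambda>x. h x j) x) (at (x i))"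
        using Suc.prems(2)[OF j] i x unfolding Ck_on_Suc_iff[OF U] by blast
    qed
    then show ?thesis by simp
  qed
  have cont: "((\<lambda>x. f (h x)) \<longlongrightarrow> f (h x)) (eucl_nhds m x)" if "x \<in> U" for x
  proof (rule Ck_on_tendsto[OF U _ that])
    show "Ck_on k m U (\<lambda>x. f (h x))"
      by (rule Suc.IH[OF Ck_on_Suc_imp[OF Suc.prems(1)] Ck_on_Suc_imp[OF Suc.prems(2)]])
  qed
  show ?case
  proof (rule Ck_on_SucI[OF U cont der])
    fix i assume i: "i < m"
    have "Ck_on k m U (partial_deriv i (\<lambda>x. h x j))" if "j < n" for j
      using Suc.prems(2)[OF that] i by simp
    then show "Ck_on k m U (\<lambda>x. \<Sum>j<n. partial_deriv j f (h x) * partial_deriv i (\<lambda>x. h x j) x)"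
      by (intro Ck_on_sum[OF U] Ck_on_mult[OF U] IH) auto
  qed
qed

lemma smooth_real_compose:
  assumes "openin (Euclidean_space n) V" "openin (Euclidean_space m) U" "smooth_real n V f"
    "smooth_eucl m U n V h"
  shows "smooth_real m U (f \<circ> h)"
  using assms Ck_on_compose[of n V m U h] unfolding smooth_real_def smooth_eucl_def comp_def by blast

text \<open>Limits and derivatives at \<open>u\<close> depend on the germ of the total function
  only, so the neighbourhoods \<open>V\<close> may vary from point to point and may leave
  \<open>U\<close>.\<close>

lemma Ck_on_local:
  assumes U: "openin (Euclidean_space n) U"
    and "\<And>u. u \<in> U \<Longrightarrow> \<exists>V. openin (Euclidean_space n) V \<and> u \<in> V \<and> Ck_on k n V f"
  shows "Ck_on k n U f"
  using assms(2)
proof (induction k arbitrary: f)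
  case 0
  have "(f \<longlongrightarrow> f x) (eucl_nhds n x)" if x: "x \<in> U" for x
  proof -
    obtain V where "openin (Euclidean_space n) V" "x \<in> V" "Ck_on 0 n V f"
      using 0[OF x] by blast
    then show ?thesis by (intro Ck_on_tendsto[of n V 0])
  qed
  then show ?case unfolding Ck_on_0_iff[OF U] by blast
next
  case (Suc k)
  have "(f \<longlongrightarrow> f x) (eucl_nhds n x) \<and>
      (\<forall>i<n. ((\<lambda>t. f (x(i := t))) has_field_derivative partial_deriv i f x) (at (x i)))"
    if x: "x \<in> U" for x
  proof -
    obtain V where V: "openin (Euclidean_space n) V" "x \<in> V" "Ck_on (Suc k) n V f"
      using Suc.prems[OF x] by blast
    then show ?thesis using Ck_on_Suc_iff[OF V(1), of k f] by blast
  qed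
  moreover have "Ck_on k n U (partial_deriv i f)" if i: "i < n" for i
  proof (rule Suc.IH)
    fix u assume u: "u \<in> U"
    obtain V where V: "openin (Euclidean_space n) V" "u \<in> V" "Ck_on (Suc k) n V f"
      using Suc.prems[OF u] by blast
    then have "Ck_on k n V (partial_deriv i f)" using i by simp
    with V show "\<exists>V. openin (Euclidean_space n) V \<and> u \<in> V \<and> Ck_on k n V (partial_deriv i f)"
      by blast
  qed
  ultimately show ?case unfolding Ck_on_Suc_iff[OF U] by blast
qed

lemma smooth_real_local:
  assumes U: "openin (Euclidean_space n) U"
    and loc: "\<And>u. u \<in> U \<Longrightarrow> \<exists>V. openin (Euclidean_space n) V \<and> u \<in> V \<and> smooth_real n V f"
  shows "smooth_real n U f"
  unfolding smooth_real_def
proof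
  fix k show "Ck_on k n U f"
    by (rule Ck_on_local[OF U]) (use loc in \<open>unfold smooth_real_def, blast\<close>)
qed

section \<open>Germs of plots\<close>

lemma diffeological_spaceI:
  assumes "\<And>n U p. plots D n U p \<Longrightarrow> openin (Euclidean_space n) U"
    and "\<And>n U p u. plots D n U p \<Longrightarrow> u \<in> U \<Longrightarrow> p u \<in> pts D"
    and "\<And>n U x. openin (Euclidean_space n) U \<Longrightarrow> x \<in> pts D \<Longrightarrow> plots D n U (\<lambda>_. x)"
    and "\<And>n U p m V f. plots D n U p \<Longrightarrow> openin (Euclidean_space m) V \<Longrightarrow> smooth_eucl m V n U f \<Longrightarrow>
      plots D m V (\<lambda>v. p (f v))"
    and "\<And>n U p. openin (Euclidean_space n) U \<Longrightarrow>
      (\<And>u. u \<in> U \<Longrightarrow> \<exists>V q. openin (Euclidean_space n) V \<and> u \<in> V \<and> V \<subseteq> U \<and> plots D n V q \<and>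
        (\<forall>v\<in>V. p v = q v)) \<Longrightarrow> plots D n U p"
  shows "diffeological_space D"
  unfolding diffeological_space_def comp_def
proof (intro conjI allI impI)
  show "p \<in> U \<rightarrow> pts D" if "plots D n U p" for n U p
    using assms(2)[OF that] by blast
  show "plots D n U p" if "openin (Euclidean_space n) U \<and>
      (\<forall>u\<in>U. \<exists>V q. openin (Euclidean_space n) V \<and> u \<in> V \<and> V \<subseteq> U \<and> plots D n V q \<and>
        (\<forall>v\<in>V. p v = q v))" for n U p
  proof (rule assms(5))
    show "openin (Euclidean_space n) U" using that by (rule conjunct1)
    show "\<exists>V q. openin (Euclidean_space n) V \<and> u \<in> V \<and> V \<subseteq> U \<and> plots D n V q \<and>
        (\<forall>v\<in>V. p v = q v)" if u: "u \<in> U" for u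
      by (rule bspec[OF conjunct2[OF \<open>_ \<and> _\<close>] u])
  qed
  show "openin (Euclidean_space n) U" if "plots D n U p" for n U p
    by (rule assms(1)[OF that])
  show "plots D n U (\<lambda>_. x)" if "openin (Euclidean_space n) U \<and> x \<in> pts D" for n U x
    by (rule assms(3)[OF conjunct1[OF that] conjunct2[OF that]])
  show "plots D m V (\<lambda>x. p (f x))"
    if "plots D n U p \<and> openin (Euclidean_space m) V \<and> smooth_eucl m V n U f" for n U p m V f
    using that by (elim conjE) (rule assms(4))
qed

lemma
  assumes "diffeological_space D"
  shows plots_open: "plots D n U p \<Longrightarrow> openin (Euclidean_space n) U"
    and plots_into: "plots D n U p \<Longrightarrow> u \<in> U \<Longrightarrow> p u \<in> pts D"
    and plots_const: "openin (Euclidean_space n) U \<Longrightarrow> x \<in> pts D \<Longrightarrow> plots D n U (\<lambda>_. x)"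
proof -
  note D = assms[unfolded diffeological_space_def]
  show "plots D n U p \<Longrightarrow> openin (Euclidean_space n) U"
    by (rule conjunct1[OF conjunct1[OF D, rule_format, of n U p]])
  show "plots D n U p \<Longrightarrow> u \<in> U \<Longrightarrow> p u \<in> pts D"
    by (rule funcset_mem[OF conjunct2[OF conjunct1[OF D, rule_format, of n U p]]])
  show "openin (Euclidean_space n) U \<Longrightarrow> x \<in> pts D \<Longrightarrow> plots D n U (\<lambda>_. x)"
    by (rule conjunct1[OF conjunct2[OF D], rule_format, OF conjI])
qed

lemma plots_compose:
  assumes "diffeological_space D" "plots D n U p" "openin (Euclidean_space m) V" "smooth_eucl m V n U f"
  shows "plots D m V (\<lambda>v. p (f v))"
  using conjunct1[OF conjunct2[OF conjunct2[OF assms(1)[unfolded diffeological_space_def]]],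
      rule_format, of n U p m V f] assms(2-4)
  by (simp only: simp_thms comp_def)

lemma plots_local:
  assumes "diffeological_space D" "openin (Euclidean_space n) U"
    and "\<And>u. u \<in> U \<Longrightarrow> \<exists>V q. openin (Euclidean_space n) V \<and> u \<in> V \<and> V \<subseteq> U \<and> plots D n V q \<and>
        (\<forall>v\<in>V. p v = q v)"
  shows "plots D n U p"
  by (rule conjunct2[OF conjunct2[OF conjunct2[OF assms(1)[unfolded diffeological_space_def]]],
      rule_format, OF conjI[OF assms(2) ballI[OF assms(3)]]])

lemma plots_cong:
  assumes D: "diffeological_space D" and p: "plots D n U p" and eq: "\<And>u. u \<in> U \<Longrightarrow> q u = p u"
  shows "plots D n U q"
proof (rule plots_local[OF D plots_open[OF D p]])
  fix u assume "u \<in> U"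
  then show "\<exists>V q'. openin (Euclidean_space n) V \<and> u \<in> V \<and> V \<subseteq> U \<and> plots D n V q' \<and> (\<forall>v\<in>V. q v = q' v)"
    using plots_open[OF D p] p eq by (intro exI[of _ U] exI[of _ p]) auto
qed

lemma smooth_eucl_inclusion:
  assumes "openin (Euclidean_space n) V" "V \<subseteq> U"
  shows "smooth_eucl n V n U (\<lambda>v. v)"
  using assms Ck_on_coordinate[OF assms(1)] by (auto simp: smooth_eucl_def smooth_real_def)

lemma plots_subset:
  assumes "diffeological_space D" "plots D n U p" "openin (Euclidean_space n) V" "V \<subseteq> U"
  shows "plots D n V p"
  using plots_compose[OF assms(1-3) smooth_eucl_inclusion[OF assms(3,4)]] .

text \<open>Germs of plots. By the locality axiom a plot is the same as a germ at each point of its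
  domain (\<open>plots_iff_lplot\<close>), and germs combine with \<open>eventually\<close> facts
  without shrinking domains by hand.\<close>

definition lplot :: "'a diffspace \<Rightarrow> nat \<Rightarrow> (nat \<Rightarrow> real) \<Rightarrow> ((nat \<Rightarrow> real) \<Rightarrow> 'a) \<Rightarrow> bool" where
  "lplot D n u p \<longleftrightarrow> (\<exists>V. openin (Euclidean_space n) V \<and> u \<in> V \<and> plots D n V p)"

lemma lplotI: "diffeological_space D \<Longrightarrow> plots D n V p \<Longrightarrow> u \<in> V \<Longrightarrow> lplot D n u p"
  using plots_open unfolding lplot_def by blast

lemma plots_iff_lplot:
  assumes D: "diffeological_space D"
  shows "plots D n U p \<longleftrightarrow> openin (Euclidean_space n) U \<and> (\<forall>u\<in>U. lplot D n u p)"
proof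
  assume "plots D n U p"
  then show "openin (Euclidean_space n) U \<and> (\<forall>u\<in>U. lplot D n u p)"
    using plots_open[OF D] lplotI[OF D] by blast
next
  assume *: "openin (Euclidean_space n) U \<and> (\<forall>u\<in>U. lplot D n u p)"
  show "plots D n U p"
  proof (rule plots_local[OF D])
    show "openin (Euclidean_space n) U" using * by blast
    fix u assume u: "u \<in> U"
    then obtain V where V: "openin (Euclidean_space n) V" "u \<in> V" "plots D n V p"
      using * unfolding lplot_def by blast
    have "openin (Euclidean_space n) (V \<inter> U)" using V * by blast
    moreover have "plots D n (V \<inter> U) p"
      using plots_subset[OF D V(3) calculation] by blast
    ultimately show "\<exists>V q. openin (Euclidean_space n) V \<and> u \<in> V \<and> V \<subseteq> U \<and> plots D n V q \<and>
        (\<forall>v\<in>V. p v = q v)"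
      using V u by (intro exI[of _ "V \<inter> U"] exI[of _ p]) auto
  qed
qed

lemma lplot_topspace: "lplot D n u p \<Longrightarrow> u \<in> topspace (Euclidean_space n)"
  unfolding lplot_def using openin_subset by blast

lemma lplot_pts: "diffeological_space D \<Longrightarrow> lplot D n u p \<Longrightarrow> p u \<in> pts D"
  unfolding lplot_def using plots_into by blast

lemma lplot_eventually:
  assumes "diffeological_space D" "lplot D n u p"
  shows "eventually (\<lambda>v. lplot D n v p) (eucl_nhds n u)"
  using assms unfolding lplot_def eventually_nhdsin by blast

lemma lplot_eventually_pts:
  assumes "diffeological_space D" "lplot D n u p"
  shows "eventually (\<lambda>v. p v \<in> pts D) (eucl_nhds n u)"
  using lplot_eventually[OF assms] by eventually_elim (rule lplot_pts[OF assms(1)])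

text \<open>The device that makes functions defined by \<open>THE\<close>, \<open>SOME\<close>,
  \<open>inv_into\<close> or case distinction smooth: near \<open>u\<close> they agree with an
  expression already known to be smooth.\<close>

lemma lplot_cong:
  assumes D: "diffeological_space D" and p: "lplot D n u p"
    and ev: "eventually (\<lambda>v. q v = p v) (eucl_nhds n u)"
  shows "lplot D n u q"
proof -
  obtain V where V: "openin (Euclidean_space n) V" "u \<in> V" "plots D n V p"
    using p unfolding lplot_def by blast
  obtain W where W: "openin (Euclidean_space n) W" "u \<in> W" "\<forall>v\<in>W. q v = p v"
    using ev lplot_topspace[OF p] by (auto simp: eventually_nhdsin)
  have o: "openin (Euclidean_space n) (V \<inter> W)" using V W by blast
  have "plots D n (V \<inter> W) p" by (rule plots_subset[OF D V(3) o]) auto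
  then have "plots D n (V \<inter> W) q" by (rule plots_cong[OF D]) (use W in auto)
  with o V W show ?thesis unfolding lplot_def by blast
qed

lemma lplot_const:
  "diffeological_space D \<Longrightarrow> u \<in> topspace (Euclidean_space n) \<Longrightarrow> x \<in> pts D \<Longrightarrow> lplot D n u (\<lambda>_. x)"
  by (rule lplotI[OF _ plots_const[OF _ openin_topspace]])

lemma zero_in_Euclidean: "(\<lambda>_. 0) \<in> topspace (Euclidean_space n)"
  by (simp add: topspace_Euclidean_space)

section \<open>The D-topology and smooth maps, tested on germs\<close>

lemma eventually_plot_in_D_open:
  assumes A: "diffeological_space A" and S: "openin (D_topology A) S"
    and p: "lplot A n u p" "p u \<in> S"
  shows "eventually (\<lambda>v. p v \<in> S) (eucl_nhds n u)"
proof -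
  obtain V where V: "openin (Euclidean_space n) V" "u \<in> V" "plots A n V p"
    using p unfolding lplot_def by blast
  then have "openin (Euclidean_space n) {u \<in> V. p u \<in> S}"
    using S unfolding openin_D_topology by blast
  then have "eventually (\<lambda>v. v \<in> {u \<in> V. p u \<in> S}) (eucl_nhds n u)"
    by (rule eventually_in_openin) (use V p in simp)
  then show ?thesis by eventually_elim simp
qed

lemma openin_D_topologyI:
  assumes A: "diffeological_space A" and "S \<subseteq> pts A"
    and ev: "\<And>n u p. lplot A n u p \<Longrightarrow> p u \<in> S \<Longrightarrow> eventually (\<lambda>v. p v \<in> S) (eucl_nhds n u)"
  shows "openin (D_topology A) S"
  unfolding openin_D_topology
proof (intro conjI allI impI)
  fix n U p assume p: "plots A n U p"
  have U: "openin (Euclidean_space n) U" using plots_open[OF A p] .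
  show "openin (Euclidean_space n) {u \<in> U. p u \<in> S}"
    unfolding openin_eventually_iff
  proof (intro conjI ballI)
    show "{u \<in> U. p u \<in> S} \<subseteq> topspace (Euclidean_space n)" using openin_subset[OF U] by blast
    fix u assume u: "u \<in> {u \<in> U. p u \<in> S}"
    have "eventually (\<lambda>v. p v \<in> S) (eucl_nhds n u)"
      using u by (intro ev lplotI[OF A p]) auto
    moreover have "eventually (\<lambda>v. v \<in> U) (eucl_nhds n u)"
      using u by (intro eventually_in_openin[OF U]) auto
    ultimately show "eventually (\<lambda>v. v \<in> {u \<in> U. p u \<in> S}) (eucl_nhds n u)"
      by eventually_elim auto
  qed
qed fact

lemma openin_D_subset: "openin (D_topology A) S \<Longrightarrow> S \<subseteq> pts A"
  unfolding openin_D_topology by blast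

lemma topspace_D_topology:
  assumes A: "diffeological_space A" shows "topspace (D_topology A) = pts A"
proof -
  have "openin (D_topology A) (pts A)"
    by (rule openin_D_topologyI[OF A]) (auto intro: lplot_eventually_pts[OF A])
  moreover have "topspace (D_topology A) \<subseteq> pts A"
    using openin_D_subset[OF openin_topspace] .
  ultimately show ?thesis using openin_subset by blast
qed

lemma smooth_map_pts: "smooth_map A B f \<Longrightarrow> x \<in> pts A \<Longrightarrow> f x \<in> pts B"
  unfolding smooth_map_def by blast

lemma smooth_map_lplot:
  "smooth_map A B f \<Longrightarrow> lplot A n u p \<Longrightarrow> lplot B n u (\<lambda>v. f (p v))"
  unfolding smooth_map_def lplot_def comp_def by blast

lemma smooth_mapI:
  assumes A: "diffeological_space A" and B: "diffeological_space B"
    and "\<And>x. x \<in> pts A \<Longrightarrow> f x \<in> pts B"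
    and "\<And>n u p. lplot A n u p \<Longrightarrow> lplot B n u (\<lambda>v. f (p v))"
  shows "smooth_map A B f"
  unfolding smooth_map_def comp_def
proof (intro conjI allI impI)
  show "f \<in> pts A \<rightarrow> pts B" using assms(3) by blast
  fix n U p assume "plots A n U p"
  then have p: "openin (Euclidean_space n) U" "\<And>u. u \<in> U \<Longrightarrow> lplot A n u p"
    unfolding plots_iff_lplot[OF A] by auto
  show "plots B n U (\<lambda>x. f (p x))"
    unfolding plots_iff_lplot[OF B] using p(1) assms(4)[OF p(2)] by simp
qed

lemma smooth_map_cong:
  assumes A: "diffeological_space A" and B: "diffeological_space B" and f: "smooth_map A B f"
    and eq: "\<And>x. x \<in> pts A \<Longrightarrow> g x = f x"
  shows "smooth_map A B g"
proof (rule smooth_mapI[OF A B])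
  show "g x \<in> pts B" if "x \<in> pts A" for x using smooth_map_pts[OF f that] eq[OF that] by simp
  fix n u p assume p: "lplot A n u p"
  show "lplot B n u (\<lambda>v. g (p v))"
    by (rule lplot_cong[OF B smooth_map_lplot[OF f p]])
      (use lplot_eventually_pts[OF A p] eq in \<open>auto elim: eventually_mono\<close>)
qed

lemma smooth_map_comp:
  "smooth_map A B f \<Longrightarrow> smooth_map B C g \<Longrightarrow> smooth_map A C (\<lambda>x. g (f x))"
  unfolding smooth_map_def comp_def by auto

lemma openin_D_preimage:
  assumes A: "diffeological_space A" and B: "diffeological_space B" and f: "smooth_map A B f"
    and S: "openin (D_topology B) S"
  shows "openin (D_topology A) {x \<in> pts A. f x \<in> S}"
proof (rule openin_D_topologyI[OF A])
  fix n u p assume p: "lplot A n u p" "p u \<in> {x \<in> pts A. f x \<in> S}"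
  have "eventually (\<lambda>v. f (p v) \<in> S) (eucl_nhds n u)"
    by (rule eventually_plot_in_D_open[OF B S smooth_map_lplot[OF f p(1)]]) (use p in auto)
  with lplot_eventually_pts[OF A p(1)]
  show "eventually (\<lambda>v. p v \<in> {x \<in> pts A. f x \<in> S}) (eucl_nhds n u)"
    by eventually_elim auto
qed auto

section \<open>Constructions of diffeological spaces\<close>

lemma pts_subset_diff [simp]: "pts (subset_diff A S) = pts A \<inter> S"
  by (simp add: subset_diff_def)

lemma pts_prod_diff [simp]: "pts (prod_diff A B) = pts A \<times> pts B"
  by (simp add: prod_diff_def)

lemma pts_real_diff [simp]: "pts real_diff = UNIV"
  by (simp add: real_diff_def)

lemma pts_eucl_diff [simp]: "pts (eucl_diff n U) = U"
  by (simp add: eucl_diff_def)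

lemma diffeological_real: "diffeological_space real_diff"
proof (rule diffeological_spaceI)
  fix n U and p :: "(nat \<Rightarrow> real) \<Rightarrow> real" and m V f
  assume "plots real_diff n U p" "openin (Euclidean_space m) V" "smooth_eucl m V n U f"
  then show "plots real_diff m V (\<lambda>v. p (f v))"
    using smooth_real_compose[of n U m V p f] by (auto simp: real_diff_def comp_def)
next
  fix n U and p :: "(nat \<Rightarrow> real) \<Rightarrow> real"
  assume U: "openin (Euclidean_space n) U"
    and loc: "\<And>u. u \<in> U \<Longrightarrow> \<exists>V q. openin (Euclidean_space n) V \<and> u \<in> V \<and> V \<subseteq> U \<and>
      plots real_diff n V q \<and> (\<forall>v\<in>V. p v = q v)"
  have "smooth_real n U p"
  proof (rule smooth_real_local[OF U])
    fix u assume "u \<in> U"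
    then obtain V q where V: "openin (Euclidean_space n) V" "u \<in> V" "smooth_real n V q" "\<forall>v\<in>V. p v = q v"
      using loc[of u] by (auto simp: real_diff_def)
    then have "smooth_real n V p"
      unfolding smooth_real_def using Ck_on_cong[OF V(1), of _ q p] by auto
    with V show "\<exists>V. openin (Euclidean_space n) V \<and> u \<in> V \<and> smooth_real n V p" by blast
  qed
  then show "plots real_diff n U p" using U by (simp add: real_diff_def)
qed (auto simp: real_diff_def smooth_real_def intro: Ck_on_const simp del: Ck_on.simps)

lemma lplot_real:
  "lplot real_diff n u p \<longleftrightarrow> (\<exists>V. openin (Euclidean_space n) V \<and> u \<in> V \<and> smooth_real n V p)"
  by (auto simp: lplot_def real_diff_def)

lemma lplot_real_tendsto:
  assumes "lplot real_diff n u p" shows "(p \<longlongrightarrow> p u) (eucl_nhds n u)"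
proof -
  obtain V where "openin (Euclidean_space n) V" "u \<in> V" "Ck_on 0 n V p"
    using assms unfolding lplot_real smooth_real_def by blast
  then show ?thesis by (intro Ck_on_tendsto[of n V 0])
qed

text \<open>Sum and product share this argument: the two germs live on different domains, which are
  intersected before \<open>h\<close> is applied.\<close>

lemma lplot_real_binop:
  assumes op: "\<And>V f g k. openin (Euclidean_space n) V \<Longrightarrow> Ck_on k n V f \<Longrightarrow> Ck_on k n V g \<Longrightarrow>
      Ck_on k n V (\<lambda>v. h (f v) (g v))"
    and p: "lplot real_diff n u p" and q: "lplot real_diff n u q"
  shows "lplot real_diff n u (\<lambda>v. h (p v) (q v))"
proof -
  obtain V where V: "openin (Euclidean_space n) V" "u \<in> V" "plots real_diff n V p"
    using p unfolding lplot_def by blast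
  obtain W where W: "openin (Euclidean_space n) W" "u \<in> W" "plots real_diff n W q"
    using q unfolding lplot_def by blast
  have o: "openin (Euclidean_space n) (V \<inter> W)" using V W by blast
  have "plots real_diff n (V \<inter> W) p" "plots real_diff n (V \<inter> W) q"
    using plots_subset[OF diffeological_real V(3) o] plots_subset[OF diffeological_real W(3) o] by auto
  then have "smooth_real n (V \<inter> W) (\<lambda>v. h (p v) (q v))"
    using op[OF o] by (auto simp: real_diff_def smooth_real_def simp del: Ck_on.simps)
  then show ?thesis using o V W unfolding lplot_real by blast
qed

lemma lplot_real_add:
  "lplot real_diff n u p \<Longrightarrow> lplot real_diff n u q \<Longrightarrow> lplot real_diff n u (\<lambda>v. p v + q v)"
  using Ck_on_add by (rule lplot_real_binop)

lemma lplot_real_mult: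
  "lplot real_diff n u p \<Longrightarrow> lplot real_diff n u q \<Longrightarrow> lplot real_diff n u (\<lambda>v. p v * q v)"
  using Ck_on_mult by (rule lplot_real_binop)

lemma lplot_real_const: "u \<in> topspace (Euclidean_space n) \<Longrightarrow> lplot real_diff n u (\<lambda>_. c)"
  using lplot_const[OF diffeological_real] by auto

lemma lplot_real_sum:
  assumes "u \<in> topspace (Euclidean_space n)" "\<And>i. i \<in> I \<Longrightarrow> lplot real_diff n u (\<lambda>v. p i v)"
  shows "lplot real_diff n u (\<lambda>v. \<Sum>i\<in>I. p i v)"
  using assms(2)
  by (induction I rule: infinite_finite_induct) (auto intro!: lplot_real_const lplot_real_add assms(1))

lemma diffeological_eucl:
  assumes U: "openin (Euclidean_space n) U" shows "diffeological_space (eucl_diff n U)"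
proof (rule diffeological_spaceI)
  fix k W p m V f
  assume p: "plots (eucl_diff n U) k W p" and V: "openin (Euclidean_space m) V"
    and f: "smooth_eucl m V k W f"
  have "smooth_real m V (\<lambda>x. p (f x) j)" if "j < n" for j
    using smooth_real_compose[of k W m V "\<lambda>x. p x j" f] p V f that
    by (auto simp: eucl_diff_def smooth_eucl_def comp_def)
  then show "plots (eucl_diff n U) m V (\<lambda>v. p (f v))"
    using p V f by (auto simp: eucl_diff_def smooth_eucl_def)
next
  fix k W x assume "openin (Euclidean_space k) W" "x \<in> pts (eucl_diff n U)"
  then show "plots (eucl_diff n U) k W (\<lambda>_. x)"
    by (auto simp: eucl_diff_def smooth_eucl_def smooth_real_def intro: Ck_on_const simp del: Ck_on.simps)
next
  fix k W p
  assume W: "openin (Euclidean_space k) W"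
    and loc: "\<And>u. u \<in> W \<Longrightarrow> \<exists>V q. openin (Euclidean_space k) V \<and> u \<in> V \<and> V \<subseteq> W \<and>
      plots (eucl_diff n U) k V q \<and> (\<forall>v\<in>V. p v = q v)"
  have "smooth_real k W (\<lambda>x. p x j)" if j: "j < n" for j
  proof (rule smooth_real_local[OF W])
    fix u assume "u \<in> W"
    then obtain V q where V: "openin (Euclidean_space k) V" "u \<in> V" "smooth_real k V (\<lambda>x. q x j)"
      "\<forall>v\<in>V. p v = q v"
      using loc[of u] j by (auto simp: eucl_diff_def smooth_eucl_def)
    then have "smooth_real k V (\<lambda>x. p x j)"
      unfolding smooth_real_def using Ck_on_cong[OF V(1), of _ "\<lambda>x. q x j" "\<lambda>x. p x j"] by auto
    with V show "\<exists>V. openin (Euclidean_space k) V \<and> u \<in> V \<and> smooth_real k V (\<lambda>x. p x j)" by blast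
  qed
  moreover have "p \<in> W \<rightarrow> U"
  proof
    fix u assume "u \<in> W"
    then obtain V q where "u \<in> V" "q \<in> V \<rightarrow> U" "\<forall>v\<in>V. p v = q v"
      using loc[of u] by (auto simp: eucl_diff_def smooth_eucl_def)
    then show "p u \<in> U" by auto
  qed
  ultimately show "plots (eucl_diff n U) k W p" using W by (auto simp: eucl_diff_def smooth_eucl_def)
qed (auto simp: eucl_diff_def smooth_eucl_def)

text \<open>The identity of \<open>U\<close> is itself a plot, which gives one direction; the other
  is the composition axiom. Plots thus become smooth maps, along which bundles can be pulled
  back.\<close>

lemma smooth_map_eucl_iff:
  assumes D: "diffeological_space D" and U: "openin (Euclidean_space n) U"
  shows "smooth_map (eucl_diff n U) D p \<longleftrightarrow> plots D n U p"
proof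
  assume "smooth_map (eucl_diff n U) D p"
  moreover have "plots (eucl_diff n U) n U (\<lambda>v. v)"
    using smooth_eucl_inclusion[OF U] U by (auto simp: eucl_diff_def)
  ultimately show "plots D n U p" unfolding smooth_map_def by (force simp: comp_def)
next
  assume p: "plots D n U p"
  show "smooth_map (eucl_diff n U) D p"
    using plots_compose[OF D p] plots_into[OF D p]
    by (auto simp: smooth_map_def eucl_diff_def comp_def)
qed

lemma diffeological_subset:
  assumes A: "diffeological_space A" shows "diffeological_space (subset_diff A S)"
proof (rule diffeological_spaceI)
  fix n U p
  assume U: "openin (Euclidean_space n) U"
    and loc: "\<And>u. u \<in> U \<Longrightarrow> \<exists>V q. openin (Euclidean_space n) V \<and> u \<in> V \<and> V \<subseteq> U \<and>
      plots (subset_diff A S) n V q \<and> (\<forall>v\<in>V. p v = q v)"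
  have "plots A n U p"
  proof (rule plots_local[OF A U])
    fix u assume "u \<in> U"
    then obtain V q where "openin (Euclidean_space n) V" "u \<in> V" "V \<subseteq> U" "plots A n V q" "\<forall>v\<in>V. p v = q v"
      using loc[of u] by (auto simp: subset_diff_def)
    then show "\<exists>V q. openin (Euclidean_space n) V \<and> u \<in> V \<and> V \<subseteq> U \<and> plots A n V q \<and> (\<forall>v\<in>V. p v = q v)"
      by (intro exI[of _ V] exI[of _ q]) auto
  qed
  moreover have "p \<in> U \<rightarrow> S"
  proof
    fix u assume "u \<in> U"
    then obtain V q where "u \<in> V" "q \<in> V \<rightarrow> S" "\<forall>v\<in>V. p v = q v"
      using loc[of u] by (auto simp: subset_diff_def)
    then show "p u \<in> S" by auto
  qed
  ultimately show "plots (subset_diff A S) n U p" by (simp add: subset_diff_def)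
next
  fix n U p m V f
  assume "plots (subset_diff A S) n U p" "openin (Euclidean_space m) V" "smooth_eucl m V n U f"
  then show "plots (subset_diff A S) m V (\<lambda>v. p (f v))"
    using plots_compose[OF A, of n U p m V f] by (auto simp: subset_diff_def smooth_eucl_def)
qed (use plots_open[OF A] plots_into[OF A] plots_const[OF A] in \<open>auto simp: subset_diff_def\<close>)

lemma diffeological_prod:
  assumes A: "diffeological_space A" and B: "diffeological_space B"
  shows "diffeological_space (prod_diff A B)"
proof (rule diffeological_spaceI)
  fix n U p
  assume U: "openin (Euclidean_space n) U"
    and loc: "\<And>u. u \<in> U \<Longrightarrow> \<exists>V q. openin (Euclidean_space n) V \<and> u \<in> V \<and> V \<subseteq> U \<and>
      plots (prod_diff A B) n V q \<and> (\<forall>v\<in>V. p v = q v)"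
  have "plots A n U (\<lambda>v. fst (p v))"
  proof (rule plots_local[OF A U])
    fix u assume "u \<in> U"
    then obtain V q where "openin (Euclidean_space n) V" "u \<in> V" "V \<subseteq> U" "plots A n V (\<lambda>v. fst (q v))"
      "\<forall>v\<in>V. p v = q v"
      using loc[of u] by (auto simp: prod_diff_def comp_def)
    then show "\<exists>V q. openin (Euclidean_space n) V \<and> u \<in> V \<and> V \<subseteq> U \<and> plots A n V q \<and>
        (\<forall>v\<in>V. fst (p v) = q v)"
      by (intro exI[of _ V] exI[of _ "\<lambda>v. fst (q v)"]) auto
  qed
  moreover have "plots B n U (\<lambda>v. snd (p v))"
  proof (rule plots_local[OF B U])
    fix u assume "u \<in> U"
    then obtain V q where "openin (Euclidean_space n) V" "u \<in> V" "V \<subseteq> U" "plots B n V (\<lambda>v. snd (q v))"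
      "\<forall>v\<in>V. p v = q v"
      using loc[of u] by (auto simp: prod_diff_def comp_def)
    then show "\<exists>V q. openin (Euclidean_space n) V \<and> u \<in> V \<and> V \<subseteq> U \<and> plots B n V q \<and>
        (\<forall>v\<in>V. snd (p v) = q v)"
      by (intro exI[of _ V] exI[of _ "\<lambda>v. snd (q v)"]) auto
  qed
  ultimately show "plots (prod_diff A B) n U p" by (simp add: prod_diff_def comp_def)
next
  fix n U p u assume p: "plots (prod_diff A B) n U p" "u \<in> U"
  show "p u \<in> pts (prod_diff A B)"
    using plots_into[OF A _ p(2), of n "fst \<circ> p"] plots_into[OF B _ p(2), of n "snd \<circ> p"] p(1)
    by (auto simp: prod_diff_def mem_Times_iff)
next
  fix n U p m V f
  assume "plots (prod_diff A B) n U p" "openin (Euclidean_space m) V" "smooth_eucl m V n U f"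
  then show "plots (prod_diff A B) m V (\<lambda>v. p (f v))"
    using plots_compose[OF A, of n U "fst \<circ> p" m V f] plots_compose[OF B, of n U "snd \<circ> p" m V f]
    by (auto simp: prod_diff_def comp_def)
qed (use plots_open[OF A] plots_const[OF A] plots_const[OF B] in \<open>auto simp: prod_diff_def comp_def\<close>)

lemma diffeological_seq:
  assumes A: "diffeological_space A" shows "diffeological_space (seq_diff A)"
proof (rule diffeological_spaceI)
  fix n U p
  assume U: "openin (Euclidean_space n) U"
    and loc: "\<And>u. u \<in> U \<Longrightarrow> \<exists>V q. openin (Euclidean_space n) V \<and> u \<in> V \<and> V \<subseteq> U \<and>
      plots (seq_diff A) n V q \<and> (\<forall>v\<in>V. p v = q v)"
  have "plots A n U (\<lambda>v. p v i)" for i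
  proof (rule plots_local[OF A U])
    fix u assume "u \<in> U"
    then obtain V q where "openin (Euclidean_space n) V" "u \<in> V" "V \<subseteq> U"
      "plots A n V (\<lambda>v. q v i)" "\<forall>v\<in>V. p v = q v"
      using loc[of u] by (auto simp: seq_diff_def)
    then show "\<exists>V q. openin (Euclidean_space n) V \<and> u \<in> V \<and> V \<subseteq> U \<and> plots A n V q \<and> (\<forall>v\<in>V. p v i = q v)"
      by (intro exI[of _ V] exI[of _ "\<lambda>v. q v i"]) auto
  qed
  then show "plots (seq_diff A) n U p" by (simp add: seq_diff_def)
next
  fix n U p u assume p: "plots (seq_diff A) n U p" "u \<in> U"
  have "p u i \<in> pts A" for i
    using plots_into[OF A _ p(2), of n "\<lambda>u. p u i"] p(1) by (auto simp: seq_diff_def)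
  then show "p u \<in> pts (seq_diff A)" by (simp add: seq_diff_def)
next
  fix n U p m V f
  assume "plots (seq_diff A) n U p" "openin (Euclidean_space m) V" "smooth_eucl m V n U f"
  then show "plots (seq_diff A) m V (\<lambda>v. p (f v))"
    using plots_compose[OF A, of n U "\<lambda>v. p v i" m V f for i] by (auto simp: seq_diff_def)
qed (use plots_open[OF A] plots_const[OF A] in \<open>auto simp: seq_diff_def\<close>)

lemma diffeological_quotient:
  assumes A: "diffeological_space A" shows "diffeological_space (quotient_diff A r)"
proof (rule diffeological_spaceI)
  fix n U p u assume p: "plots (quotient_diff A r) n U p" "u \<in> U"
  then obtain V q where "u \<in> V" "plots A n V q" "p u = r `` {q u}"
    by (auto simp: quotient_diff_def)
  then show "p u \<in> pts (quotient_diff A r)"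
    using plots_into[OF A] by (auto simp: quotient_diff_def quotient_def)
next
  fix n U x assume U: "openin (Euclidean_space n) U" and "x \<in> pts (quotient_diff A r)"
  then obtain a where a: "a \<in> pts A" "x = r `` {a}" by (auto simp: quotient_diff_def quotient_def)
  have "\<exists>V q. openin (Euclidean_space n) V \<and> u \<in> V \<and> V \<subseteq> U \<and> plots A n V q \<and> (\<forall>v\<in>V. x = r `` {q v})"
    if "u \<in> U" for u
    using plots_const[OF A U a(1)] a(2) U that by (intro exI[of _ U] exI[of _ "\<lambda>_. a"]) auto
  then show "plots (quotient_diff A r) n U (\<lambda>_. x)"
    using U by (simp add: quotient_diff_def)
next
  fix n U p m V f
  assume p: "plots (quotient_diff A r) n U p" and V: "openin (Euclidean_space m) V"
    and f: "smooth_eucl m V n U f"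
  have "\<exists>W q. openin (Euclidean_space m) W \<and> v \<in> W \<and> W \<subseteq> V \<and> plots A m W q \<and>
      (\<forall>w\<in>W. p (f w) = r `` {q w})" if v: "v \<in> V" for v
  proof -
    have "f v \<in> U" using f v by (auto simp: smooth_eucl_def)
    then obtain W q where W: "openin (Euclidean_space n) W" "f v \<in> W" "W \<subseteq> U" "plots A n W q"
      "\<forall>w\<in>W. p w = r `` {q w}"
      using p by (auto simp: quotient_diff_def)
    have UU: "openin (Euclidean_space n) U" using p by (simp add: quotient_diff_def)
    have "smooth_map (eucl_diff m V) (eucl_diff n U) f"
      using f V smooth_map_eucl_iff[OF diffeological_eucl[OF UU] V] by (simp add: eucl_diff_def)
    moreover have "lplot (eucl_diff m V) m v (\<lambda>v. v)"
      using smooth_eucl_inclusion[OF V] V v by (auto simp: lplot_def eucl_diff_def)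
    \<comment> \<open>The local lift \<open>q\<close> lives on \<open>W\<close>, so \<open>f\<close>
      must be seen to stay in \<open>W\<close> near \<open>v\<close>. As a smooth map into
      \<open>eucl_diff n U\<close> it is continuous for the D-topology; it remains to show that the
      Euclidean open set \<open>W\<close> is D-open.\<close>
    moreover have "openin (D_topology (eucl_diff n U)) W"
    proof (rule openin_D_topologyI[OF diffeological_eucl[OF UU]])
      fix k u b assume b: "lplot (eucl_diff n U) k u b" "b u \<in> W"
      have "filterlim b (eucl_nhds n (b u)) (eucl_nhds k u)"
      proof (rule filterlim_eucl_nhds)
        show "b u \<in> topspace (Euclidean_space n)" using b W openin_subset by blast
        show "eventually (\<lambda>z. b z \<in> topspace (Euclidean_space n)) (eucl_nhds k u)"
          using lplot_eventually_pts[OF diffeological_eucl[OF UU] b(1)]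
          by eventually_elim (use openin_subset[OF UU] in auto)
        fix i assume i: "i < n"
        obtain V' where "openin (Euclidean_space k) V'" "u \<in> V'" "smooth_real k V' (\<lambda>z. b z i)"
          using b(1) i by (auto simp: lplot_def eucl_diff_def smooth_eucl_def)
        then show "((\<lambda>z. b z i) \<longlongrightarrow> b u i) (eucl_nhds k u)"
          using lplot_real_tendsto[of k u "\<lambda>z. b z i"] unfolding lplot_real by blast
      qed
      then show "eventually (\<lambda>z. b z \<in> W) (eucl_nhds k u)"
        using eventually_in_openin[OF W(1) b(2)] unfolding filterlim_iff by blast
    qed (use W in auto)
    ultimately have "eventually (\<lambda>w. f w \<in> W) (eucl_nhds m v)"
      using W v by (intro eventually_plot_in_D_open[OF diffeological_eucl[OF UU]])
        (auto dest: smooth_map_lplot)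
    then obtain W' where W': "openin (Euclidean_space m) W'" "v \<in> W'" "\<forall>w\<in>W'. f w \<in> W"
      using V v openin_subset[OF V] by (auto simp: eventually_nhdsin)
    have o: "openin (Euclidean_space m) (W' \<inter> V)" using W' V by blast
    have "smooth_eucl m (W' \<inter> V) n W f"
      using f W' plots_subset[OF diffeological_real _ o, of V "\<lambda>x. f x j" for j] V o
      by (auto simp: smooth_eucl_def real_diff_def)
    then have "plots A m (W' \<inter> V) (\<lambda>w. q (f w))"
      by (rule plots_compose[OF A W(4) o])
    then show ?thesis
      using o W' v W by (intro exI[of _ "W' \<inter> V"] exI[of _ "\<lambda>w. q (f w)"]) auto
  qed
  then show "plots (quotient_diff A r) m V (\<lambda>v. p (f v))" using V by (simp add: quotient_diff_def)
next
  fix n U p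
  assume U: "openin (Euclidean_space n) U"
    and loc: "\<And>u. u \<in> U \<Longrightarrow> \<exists>V q. openin (Euclidean_space n) V \<and> u \<in> V \<and> V \<subseteq> U \<and>
      plots (quotient_diff A r) n V q \<and> (\<forall>v\<in>V. p v = q v)"
  have "\<exists>W s. openin (Euclidean_space n) W \<and> u \<in> W \<and> W \<subseteq> U \<and> plots A n W s \<and>
      (\<forall>w\<in>W. p w = r `` {s w})" if u: "u \<in> U" for u
  proof -
    obtain V q where V: "u \<in> V" "V \<subseteq> U" "plots (quotient_diff A r) n V q" "\<forall>v\<in>V. p v = q v"
      using loc[OF u] by blast
    then obtain W s where "openin (Euclidean_space n) W" "u \<in> W" "W \<subseteq> V" "plots A n W s"
      "\<forall>w\<in>W. q w = r `` {s w}"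
      by (auto simp: quotient_diff_def)
    with V show ?thesis by (intro exI[of _ W] exI[of _ s]) auto
  qed
  then show "plots (quotient_diff A r) n U p" using U by (simp add: quotient_diff_def)
qed (auto simp: quotient_diff_def)

section \<open>Germs of plots in subsets, products and quotients\<close>

lemma lplot_subset_diff:
  assumes A: "diffeological_space A"
  shows "lplot (subset_diff A S) n u p \<longleftrightarrow> lplot A n u p \<and> eventually (\<lambda>v. p v \<in> S) (eucl_nhds n u)"
proof
  assume "lplot (subset_diff A S) n u p"
  then obtain V where "openin (Euclidean_space n) V" "u \<in> V" "plots A n V p" "p \<in> V \<rightarrow> S"
    by (auto simp: lplot_def subset_diff_def)
  then show "lplot A n u p \<and> eventually (\<lambda>v. p v \<in> S) (eucl_nhds n u)"
    by (auto simp: lplot_def eventually_nhdsin)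
next
  assume *: "lplot A n u p \<and> eventually (\<lambda>v. p v \<in> S) (eucl_nhds n u)"
  then obtain V where V: "openin (Euclidean_space n) V" "u \<in> V" "plots A n V p"
    unfolding lplot_def by blast
  obtain W where W: "openin (Euclidean_space n) W" "u \<in> W" "\<forall>v\<in>W. p v \<in> S"
    using conjunct2[OF *] lplot_topspace[OF conjunct1[OF *]] by (auto simp: eventually_nhdsin)
  have o: "openin (Euclidean_space n) (V \<inter> W)" using V W by blast
  then have "plots (subset_diff A S) n (V \<inter> W) p"
    using plots_subset[OF A V(3) o] W by (auto simp: subset_diff_def)
  with o V W show "lplot (subset_diff A S) n u p" unfolding lplot_def by blast
qed

lemma lplot_prod_diff:
  assumes A: "diffeological_space A" and B: "diffeological_space B"
  shows "lplot (prod_diff A B) n u p \<longleftrightarrow>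
    lplot A n u (\<lambda>v. fst (p v)) \<and> lplot B n u (\<lambda>v. snd (p v))"
proof
  assume "lplot (prod_diff A B) n u p"
  then show "lplot A n u (\<lambda>v. fst (p v)) \<and> lplot B n u (\<lambda>v. snd (p v))"
    by (auto simp: lplot_def prod_diff_def comp_def)
next
  assume *: "lplot A n u (\<lambda>v. fst (p v)) \<and> lplot B n u (\<lambda>v. snd (p v))"
  obtain V where V: "openin (Euclidean_space n) V" "u \<in> V" "plots A n V (\<lambda>v. fst (p v))"
    using * unfolding lplot_def by blast
  obtain W where W: "openin (Euclidean_space n) W" "u \<in> W" "plots B n W (\<lambda>v. snd (p v))"
    using * unfolding lplot_def by blast
  have o: "openin (Euclidean_space n) (V \<inter> W)" using V W by blast
  then have "plots (prod_diff A B) n (V \<inter> W) p"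
    using plots_subset[OF A V(3) o] plots_subset[OF B W(3) o] by (auto simp: prod_diff_def comp_def)
  with o V W show "lplot (prod_diff A B) n u p" unfolding lplot_def by blast
qed

lemma lplot_quotient_diff:
  assumes A: "diffeological_space A"
  shows "lplot (quotient_diff A r) n u p \<longleftrightarrow>
    (\<exists>q. lplot A n u q \<and> eventually (\<lambda>v. p v = r `` {q v}) (eucl_nhds n u))"
proof
  assume "lplot (quotient_diff A r) n u p"
  then obtain V q where "openin (Euclidean_space n) V" "u \<in> V" "plots A n V q"
    "\<forall>v\<in>V. p v = r `` {q v}"
    by (auto simp: lplot_def quotient_diff_def)
  then have "lplot A n u q" "eventually (\<lambda>v. p v = r `` {q v}) (eucl_nhds n u)"
    by (auto simp: lplot_def eventually_nhdsin)
  then show "\<exists>q. lplot A n u q \<and> eventually (\<lambda>v. p v = r `` {q v}) (eucl_nhds n u)"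
    by blast
next
  assume "\<exists>q. lplot A n u q \<and> eventually (\<lambda>v. p v = r `` {q v}) (eucl_nhds n u)"
  then obtain q where q: "lplot A n u q" and ev: "eventually (\<lambda>v. p v = r `` {q v}) (eucl_nhds n u)"
    by blast
  obtain V where V: "openin (Euclidean_space n) V" "u \<in> V" "plots A n V q"
    using q unfolding lplot_def by blast
  then have "plots (quotient_diff A r) n V (\<lambda>v. r `` {q v})"
    by (auto simp: quotient_diff_def)
  then have "lplot (quotient_diff A r) n u (\<lambda>v. r `` {q v})" using V unfolding lplot_def by blast
  then show "lplot (quotient_diff A r) n u p"
    by (rule lplot_cong[OF diffeological_quotient[OF A] _ ev])
qed

section \<open>Bundles and their local triviality\<close>

text \<open>Any smooth two-sided inverse on points will do, since \<open>inv_into\<close> agrees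
  with it there.\<close>

lemma diffeomorphism_iff:
  assumes A: "diffeological_space A" and B: "diffeological_space B"
  shows "diffeomorphism A B f \<longleftrightarrow> smooth_map A B f \<and>
    (\<exists>g. smooth_map B A g \<and> (\<forall>x\<in>pts A. g (f x) = x) \<and> (\<forall>y\<in>pts B. f (g y) = y))"
proof
  assume f: "diffeomorphism A B f"
  then have bij: "bij_betw f (pts A) (pts B)" and sf: "smooth_map A B f"
    and sg: "smooth_map B A (inv_into (pts A) f)"
    by (auto simp: diffeomorphism_def)
  have "\<forall>x\<in>pts A. inv_into (pts A) f (f x) = x" "\<forall>y\<in>pts B. f (inv_into (pts A) f y) = y"
    using bij by (auto simp: bij_betw_inv_into_left bij_betw_inv_into_right)
  with sf sg show "smooth_map A B f \<and>
    (\<exists>g. smooth_map B A g \<and> (\<forall>x\<in>pts A. g (f x) = x) \<and> (\<forall>y\<in>pts B. f (g y) = y))"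
    by blast
next
  assume "smooth_map A B f \<and>
    (\<exists>g. smooth_map B A g \<and> (\<forall>x\<in>pts A. g (f x) = x) \<and> (\<forall>y\<in>pts B. f (g y) = y))"
  then obtain g where f: "smooth_map A B f" and g: "smooth_map B A g"
    and gf: "\<forall>x\<in>pts A. g (f x) = x" and fg: "\<forall>y\<in>pts B. f (g y) = y"
    by blast
  have bij: "bij_betw f (pts A) (pts B)"
    using gf fg smooth_map_pts[OF f] smooth_map_pts[OF g] by (intro bij_betw_byWitness[of _ g]) auto
  have "inv_into (pts A) f y = g y" if "y \<in> pts B" for y
    using fg smooth_map_pts[OF g that] that bij by (metis bij_betw_inv_into_left)
  then have "smooth_map B A (inv_into (pts A) f)"
    by (rule smooth_map_cong[OF B A g])
  with bij f show "diffeomorphism A B f" by (simp add: diffeomorphism_def)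
qed

text \<open>Lifts of constant germs on the one-point space \<open>Euclidean_space 0\<close> give
  surjectivity, and lifts of arbitrary germs are the germs of the inverse. Inverses on quotients
  thus never have to be written down.\<close>

lemma diffeomorphism_by_lifting:
  assumes A: "diffeological_space A" and B: "diffeological_space B"
    and f: "smooth_map A B f" and inj: "inj_on f (pts A)"
    and lift: "\<And>n u q. lplot B n u q \<Longrightarrow>
      \<exists>p. lplot A n u p \<and> eventually (\<lambda>v. f (p v) = q v) (eucl_nhds n u)"
  shows "diffeomorphism A B f"
proof -
  have surj: "y \<in> f ` pts A" if y: "y \<in> pts B" for y
  proof -
    obtain p where p: "lplot A 0 (\<lambda>_. 0) p" "eventually (\<lambda>v. f (p v) = y) (eucl_nhds 0 (\<lambda>_. 0))"
      using lift[OF lplot_const[OF B zero_in_Euclidean y]] by blast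
    then show ?thesis
      using lplot_pts[OF A p(1)] eventually_nhdsin_self[OF p(2) zero_in_Euclidean] by blast
  qed
  have "smooth_map B A (inv_into (pts A) f)"
  proof (rule smooth_mapI[OF B A])
    show "inv_into (pts A) f x \<in> pts A" if "x \<in> pts B" for x
      using surj[OF that] by (rule inv_into_into)
    fix n u q assume "lplot B n u q"
    then obtain p where p: "lplot A n u p" "eventually (\<lambda>v. f (p v) = q v) (eucl_nhds n u)"
      using lift by blast
    show "lplot A n u (\<lambda>v. inv_into (pts A) f (q v))"
    proof (rule lplot_cong[OF A p(1)])
      show "eventually (\<lambda>v. inv_into (pts A) f (q v) = p v) (eucl_nhds n u)"
        using p(2) lplot_eventually_pts[OF A p(1)]
        by eventually_elim (metis inj inv_into_f_f)
    qed
  qed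
  moreover have "bij_betw f (pts A) (pts B)"
    using inj surj smooth_map_pts[OF f] by (auto simp: bij_betw_def)
  ultimately show ?thesis using f by (simp add: diffeomorphism_def)
qed

lemma bundle_iso_iff:
  assumes E: "diffeological_space E" and E': "diffeological_space E'"
  shows "bundle_iso E \<pi> E' \<pi>' \<longleftrightarrow> (\<exists>\<Phi> \<Psi>. smooth_map E E' \<Phi> \<and> smooth_map E' E \<Psi> \<and>
    (\<forall>e\<in>pts E. \<Psi> (\<Phi> e) = e \<and> \<pi>' (\<Phi> e) = \<pi> e) \<and> (\<forall>e\<in>pts E'. \<Phi> (\<Psi> e) = e \<and> \<pi> (\<Psi> e) = \<pi>' e))"
    (is "?l \<longleftrightarrow> ?r")
proof
  assume ?l
  then obtain \<Phi> \<Psi> where "smooth_map E E' \<Phi>" "smooth_map E' E \<Psi>" "\<forall>e\<in>pts E. \<Psi> (\<Phi> e) = e"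
    "\<forall>e\<in>pts E'. \<Phi> (\<Psi> e) = e" "\<forall>e\<in>pts E. \<pi>' (\<Phi> e) = \<pi> e"
    unfolding bundle_iso_def diffeomorphism_iff[OF E E'] by blast
  moreover from this have "\<forall>e\<in>pts E'. \<pi> (\<Psi> e) = \<pi>' e" by (metis smooth_map_pts)
  ultimately show ?r by (intro exI[of _ \<Phi>] exI[of _ \<Psi>]) simp
next
  assume ?r
  then show ?l unfolding bundle_iso_def diffeomorphism_iff[OF E E'] by blast
qed

lemma bundle_iso_sym:
  assumes "diffeological_space E" "diffeological_space E'" "bundle_iso E \<pi> E' \<pi>'"
  shows "bundle_iso E' \<pi>' E \<pi>"
  using assms(3) unfolding bundle_iso_iff[OF assms(1,2)] bundle_iso_iff[OF assms(2,1)] by blast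

lemma bundle_iso_trans:
  assumes E: "diffeological_space E" "diffeological_space E'" "diffeological_space E''"
    and 1: "bundle_iso E \<pi> E' \<pi>'" and 2: "bundle_iso E' \<pi>' E'' \<pi>''"
  shows "bundle_iso E \<pi> E'' \<pi>''"
proof -
  obtain \<Phi> \<Psi> where a: "smooth_map E E' \<Phi>" "smooth_map E' E \<Psi>"
    "\<And>e. e \<in> pts E \<Longrightarrow> \<Psi> (\<Phi> e) = e \<and> \<pi>' (\<Phi> e) = \<pi> e"
    "\<And>e. e \<in> pts E' \<Longrightarrow> \<Phi> (\<Psi> e) = e \<and> \<pi> (\<Psi> e) = \<pi>' e"
    using 1 unfolding bundle_iso_iff[OF E(1,2)] by metis
  obtain \<Phi>' \<Psi>' where b: "smooth_map E' E'' \<Phi>'" "smooth_map E'' E' \<Psi>'"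
    "\<And>e. e \<in> pts E' \<Longrightarrow> \<Psi>' (\<Phi>' e) = e \<and> \<pi>'' (\<Phi>' e) = \<pi>' e"
    "\<And>e. e \<in> pts E'' \<Longrightarrow> \<Phi>' (\<Psi>' e) = e \<and> \<pi>' (\<Psi>' e) = \<pi>'' e"
    using 2 unfolding bundle_iso_iff[OF E(2,3)] by metis
  show ?thesis
    unfolding bundle_iso_iff[OF E(1,3)]
    using smooth_map_comp[OF a(1) b(1)] smooth_map_comp[OF b(2) a(2)] a(3,4) b(3,4)
      smooth_map_pts[OF a(1)] smooth_map_pts[OF b(2)]
    by (intro exI[of _ "\<lambda>x. \<Phi>' (\<Phi> x)"] exI[of _ "\<lambda>x. \<Psi> (\<Psi>' x)"]) simp
qed

section \<open>Pullback of bundles\<close>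

lemma pts_pullback_space:
  "pts (pullback_space Y f E \<pi>) = {z. fst z \<in> pts Y \<and> snd z \<in> pts E \<and> f (fst z) = \<pi> (snd z)}"
  by (auto simp: pullback_space_def)

lemma diffeological_pullback:
  "diffeological_space Y \<Longrightarrow> diffeological_space E \<Longrightarrow> diffeological_space (pullback_space Y f E \<pi>)"
  unfolding pullback_space_def by (intro diffeological_subset diffeological_prod)

lemma lplot_pullback:
  assumes "diffeological_space Y" "diffeological_space E"
  shows "lplot (pullback_space Y f E \<pi>) n u p \<longleftrightarrow> lplot Y n u (\<lambda>v. fst (p v)) \<and>
    lplot E n u (\<lambda>v. snd (p v)) \<and> eventually (\<lambda>v. f (fst (p v)) = \<pi> (snd (p v))) (eucl_nhds n u)"
  unfolding pullback_space_def lplot_subset_diff[OF diffeological_prod[OF assms]] lplot_prod_diff[OF assms]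
  by (simp add: case_prod_unfold)

lemma bundle_iso_pullback:
  assumes Y: "diffeological_space Y" and E: "diffeological_space E" and E': "diffeological_space E'"
    and iso: "bundle_iso E \<pi> E' \<pi>'"
  shows "bundle_iso (pullback_space Y f E \<pi>) fst (pullback_space Y f E' \<pi>') fst"
proof -
  obtain \<Phi> \<Psi> where a: "smooth_map E E' \<Phi>" "smooth_map E' E \<Psi>"
    "\<And>e. e \<in> pts E \<Longrightarrow> \<Psi> (\<Phi> e) = e \<and> \<pi>' (\<Phi> e) = \<pi> e"
    "\<And>e. e \<in> pts E' \<Longrightarrow> \<Phi> (\<Psi> e) = e \<and> \<pi> (\<Psi> e) = \<pi>' e"
    using iso unfolding bundle_iso_iff[OF E E'] by metis
  \<comment> \<open>Stated for arbitrary bundles \<open>A\<close> and \<open>B\<close>, so that it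
    serves both the isomorphism and its inverse.\<close>
  have sm: "smooth_map (pullback_space Y f A \<alpha>) (pullback_space Y f B \<beta>) (\<lambda>z. (fst z, h (snd z)))"
    if A: "diffeological_space A" and B: "diffeological_space B" and h: "smooth_map A B h"
      and \<beta>: "\<And>e. e \<in> pts A \<Longrightarrow> \<beta> (h e) = \<alpha> e"
    for A :: "'t diffspace" and \<alpha> and B :: "'s diffspace" and \<beta> h
  proof (rule smooth_mapI[OF diffeological_pullback[OF Y A] diffeological_pullback[OF Y B]])
    fix n u p assume p: "lplot (pullback_space Y f A \<alpha>) n u p"
    note p' = p[unfolded lplot_pullback[OF Y A]]
    have "eventually (\<lambda>v. f (fst (p v)) = \<beta> (h (snd (p v)))) (eucl_nhds n u)"
      using lplot_eventually_pts[OF diffeological_pullback[OF Y A] p]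
      by eventually_elim (use \<beta> in \<open>auto simp: pts_pullback_space\<close>)
    then show "lplot (pullback_space Y f B \<beta>) n u (\<lambda>v. (fst (p v), h (snd (p v))))"
      unfolding lplot_pullback[OF Y B] using p' smooth_map_lplot[OF h] by simp
  qed (use \<beta> smooth_map_pts[OF h] in \<open>auto simp: pts_pullback_space\<close>)
  show ?thesis
    unfolding bundle_iso_iff[OF diffeological_pullback[OF Y E] diffeological_pullback[OF Y E']]
    using sm[OF E E' a(1), of \<pi>' \<pi>] sm[OF E' E a(2), of \<pi> \<pi>'] a(3,4)
    by (intro exI[of _ "\<lambda>z. (fst z, \<Phi> (snd z))"] exI[of _ "\<lambda>z. (fst z, \<Psi> (snd z))"])
      (auto simp: pts_pullback_space)
qed

text \<open>The middle component of the nested pair is determined by the first one, as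
  \<open>f (fst z)\<close>. Naturality of the classification rests on this.\<close>

lemma bundle_iso_pullback_comp:
  assumes X: "diffeological_space X" and Y: "diffeological_space Y" and E: "diffeological_space E"
    and f: "smooth_map X Y f"
  shows "bundle_iso (pullback_space X f (pullback_space Y g E \<pi>) fst) fst
    (pullback_space X (\<lambda>x. g (f x)) E \<pi>) fst" (is "bundle_iso ?A _ ?B _")
proof -
  note P = diffeological_pullback[OF Y E]
  note A = diffeological_pullback[OF X P] and B = diffeological_pullback[OF X E]
  have "smooth_map ?A ?B (\<lambda>z. (fst z, snd (snd z)))"
  proof (rule smooth_mapI[OF A B])
    fix n u p assume p: "lplot ?A n u p"
    note p' = p[unfolded lplot_pullback[OF X P] lplot_pullback[OF Y E]]
    have "eventually (\<lambda>v. g (f (fst (p v))) = \<pi> (snd (snd (p v)))) (eucl_nhds n u)"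
      using lplot_eventually_pts[OF A p]
      by eventually_elim (auto simp: pts_pullback_space)
    with p' show "lplot ?B n u (\<lambda>v. (fst (p v), snd (snd (p v))))"
      by (simp add: lplot_pullback[OF X E])
  qed (auto simp: pts_pullback_space)
  moreover have "smooth_map ?B ?A (\<lambda>z. (fst z, (f (fst z), snd z)))"
  proof (rule smooth_mapI[OF B A])
    fix n u p assume p: "lplot ?B n u p"
    note p' = p[unfolded lplot_pullback[OF X E]]
    then show "lplot ?A n u (\<lambda>v. (fst (p v), (f (fst (p v)), snd (p v))))"
      using smooth_map_lplot[OF f, of n u "\<lambda>v. fst (p v)"]
      by (simp add: lplot_pullback[OF X P] lplot_pullback[OF Y E])
  qed (auto simp: pts_pullback_space smooth_map_pts[OF f])
  ultimately show ?thesis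
    unfolding bundle_iso_iff[OF A B]
    by (intro exI[of _ "\<lambda>z. (fst z, snd (snd z))"] exI[of _ "\<lambda>z. (fst z, (f (fst z), snd z))"])
      (auto simp: pts_pullback_space)
qed

text \<open>
  A trivialisation over \<open>U\<close> in the direction \<open>U \<times> F \<rightarrow> E\<close>, expressed through germs of plots.
\<close>

definition trivialises ::
  "'e diffspace \<Rightarrow> ('e \<Rightarrow> 'x) \<Rightarrow> 'x diffspace \<Rightarrow> 'f diffspace \<Rightarrow> 'x set \<Rightarrow> ('x \<Rightarrow> 'f \<Rightarrow> 'e) \<Rightarrow> bool" where
  "trivialises E \<pi> X F U \<Psi> \<longleftrightarrow>
     (\<forall>y\<in>U. \<forall>z\<in>pts F. \<Psi> y z \<in> pts E \<and> \<pi> (\<Psi> y z) = y) \<and>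
     (\<forall>y\<in>U. inj_on (\<Psi> y) (pts F)) \<and>
     (\<forall>n u a b. lplot X n u a \<longrightarrow> a u \<in> U \<longrightarrow> lplot F n u b \<longrightarrow> lplot E n u (\<lambda>v. \<Psi> (a v) (b v))) \<and>
     (\<forall>n u c. lplot E n u c \<longrightarrow> \<pi> (c u) \<in> U \<longrightarrow>
        (\<exists>b. lplot F n u b \<and> eventually (\<lambda>v. c v = \<Psi> (\<pi> (c v)) (b v)) (eucl_nhds n u)))"

lemma trivialisesD:
  assumes "trivialises E \<pi> X F U \<Psi>"
  shows "y \<in> U \<Longrightarrow> z \<in> pts F \<Longrightarrow> \<Psi> y z \<in> pts E"
    and "y \<in> U \<Longrightarrow> z \<in> pts F \<Longrightarrow> \<pi> (\<Psi> y z) = y"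
    and "y \<in> U \<Longrightarrow> inj_on (\<Psi> y) (pts F)"
    and "lplot X n u a \<Longrightarrow> a u \<in> U \<Longrightarrow> lplot F n u b \<Longrightarrow> lplot E n u (\<lambda>v. \<Psi> (a v) (b v))"
    and "lplot E n u c \<Longrightarrow> \<pi> (c u) \<in> U \<Longrightarrow>
      \<exists>b. lplot F n u b \<and> eventually (\<lambda>v. c v = \<Psi> (\<pi> (c v)) (b v)) (eucl_nhds n u)"
  using assms unfolding trivialises_def by simp_all

text \<open>The map \<open>\<Psi>\<close> is inverted by lifting: the last clause of
  \<open>trivialises\<close> provides, for a germ in the total space, a germ of its fibre
  coordinate.\<close>

lemma trivial_bundle_iff:
  assumes E: "diffeological_space E" and X: "diffeological_space X" and F: "diffeological_space F"
    and \<pi>: "smooth_map E X \<pi>" and U: "openin (D_topology X) U"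
  shows "trivial_bundle (subset_diff E {e. \<pi> e \<in> U}) \<pi> (subset_diff X U) F \<longleftrightarrow>
    (\<exists>\<Psi>. trivialises E \<pi> X F U \<Psi>)" (is "trivial_bundle ?E _ ?X _ \<longleftrightarrow> _")
proof -
  note sE = diffeological_subset[OF E, of "{e. \<pi> e \<in> U}"] and sX = diffeological_subset[OF X, of U]
  note pr = diffeological_prod[OF sX F]
  \<comment> \<open>A germ starting in the D-open set \<open>U\<close> stays there, hence is a germ
    of the subset diffeology.\<close>
  have evX: "lplot ?X n u a" if "lplot X n u a" "a u \<in> U" for n u a
    using that eventually_plot_in_D_open[OF X U] by (simp add: lplot_subset_diff[OF X])
  have evE: "lplot ?E n u c" if "lplot E n u c" "\<pi> (c u) \<in> U" for n u c
    using that eventually_plot_in_D_open[OF X U smooth_map_lplot[OF \<pi> that(1)]]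
    by (simp add: lplot_subset_diff[OF E])
  have UX: "U \<subseteq> pts X" using openin_D_subset[OF U] .
  show ?thesis
  proof
    assume "trivial_bundle ?E \<pi> ?X F"
    then obtain \<Phi> \<Psi> where a: "smooth_map ?E (prod_diff ?X F) \<Phi>" "smooth_map (prod_diff ?X F) ?E \<Psi>"
      "\<And>e. e \<in> pts ?E \<Longrightarrow> \<Psi> (\<Phi> e) = e \<and> fst (\<Phi> e) = \<pi> e"
      "\<And>e. e \<in> pts (prod_diff ?X F) \<Longrightarrow> \<Phi> (\<Psi> e) = e \<and> \<pi> (\<Psi> e) = fst e"
      unfolding trivial_bundle_def bundle_iso_iff[OF sE pr] by metis
    have "trivialises E \<pi> X F U (\<lambda>y z. \<Psi> (y, z))"
      unfolding trivialises_def
    proof (intro conjI ballI allI impI)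
      fix y z assume "y \<in> U" "z \<in> pts F"
      then have "(y, z) \<in> pts (prod_diff ?X F)" using UX by auto
      from smooth_map_pts[OF a(2) this] a(4)[OF this]
      show "\<Psi> (y, z) \<in> pts E" "\<pi> (\<Psi> (y, z)) = y" by auto
    next
      fix y assume "y \<in> U"
      then have "\<Phi> (\<Psi> (y, z)) = (y, z)" if "z \<in> pts F" for z using a(4) UX that by auto
      then show "inj_on (\<lambda>z. \<Psi> (y, z)) (pts F)"
        by (intro inj_on_inverseI[of _ "\<lambda>e. snd (\<Phi> e)"]) simp
    next
      fix n u a b assume ab: "lplot X n u a" "a u \<in> U" "lplot F n u b"
      then have "lplot (prod_diff ?X F) n u (\<lambda>v. (a v, b v))"
        using evX by (simp add: lplot_prod_diff[OF sX F])
      from smooth_map_lplot[OF a(2) this] show "lplot E n u (\<lambda>v. \<Psi> (a v, b v))"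
        unfolding lplot_subset_diff[OF E] by (rule conjunct1)
    next
      fix n u c assume c: "lplot E n u c" "\<pi> (c u) \<in> U"
      have "lplot (prod_diff ?X F) n u (\<lambda>v. \<Phi> (c v))"
        using smooth_map_lplot[OF a(1) evE[OF c]] .
      then have "lplot F n u (\<lambda>v. snd (\<Phi> (c v)))" by (simp add: lplot_prod_diff[OF sX F])
      moreover have "eventually (\<lambda>v. c v = \<Psi> (\<pi> (c v), snd (\<Phi> (c v)))) (eucl_nhds n u)"
        using lplot_eventually_pts[OF sE evE[OF c]]
        by eventually_elim (metis a(3) prod.collapse)
      ultimately show "\<exists>b. lplot F n u b \<and> eventually (\<lambda>v. c v = \<Psi> (\<pi> (c v), b v)) (eucl_nhds n u)"
        by (intro exI[of _ "\<lambda>v. snd (\<Phi> (c v))"] conjI)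
    qed
    then show "\<exists>\<Psi>. trivialises E \<pi> X F U \<Psi>" by blast
  next
    assume "\<exists>\<Psi>. trivialises E \<pi> X F U \<Psi>"
    then obtain \<Psi> where \<Psi>: "trivialises E \<pi> X F U \<Psi>" by blast
    note \<Psi>' = trivialisesD[OF \<Psi>]
    let ?\<Psi> = "\<lambda>z. \<Psi> (fst z) (snd z)"
    have sm: "smooth_map (prod_diff ?X F) ?E ?\<Psi>"
    proof (rule smooth_mapI[OF pr sE])
      fix n u p assume p: "lplot (prod_diff ?X F) n u p"
      then have *: "lplot X n u (\<lambda>v. fst (p v))" "fst (p u) \<in> U" "lplot F n u (\<lambda>v. snd (p v))"
        using lplot_pts[OF pr p] by (auto simp: lplot_prod_diff[OF sX F] lplot_subset_diff[OF X])
      have "\<pi> (\<Psi> (fst (p u)) (snd (p u))) \<in> U"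
        using \<Psi>'(2)[OF *(2) lplot_pts[OF F *(3)]] *(2) by simp
      then show "lplot ?E n u (\<lambda>v. ?\<Psi> (p v))"
        using \<Psi>'(4)[OF *] by (intro evE)
    qed (use \<Psi>'(1,2) in auto)
    have "diffeomorphism (prod_diff ?X F) ?E ?\<Psi>"
    proof (rule diffeomorphism_by_lifting[OF pr sE sm])
      show "inj_on ?\<Psi> (pts (prod_diff ?X F))"
      proof (rule inj_onI)
        fix x y assume x: "x \<in> pts (prod_diff ?X F)" and y: "y \<in> pts (prod_diff ?X F)"
          and eq: "?\<Psi> x = ?\<Psi> y"
        have "fst x = fst y"
          using x y \<Psi>'(2)[of "fst x" "snd x"] \<Psi>'(2)[of "fst y" "snd y"] eq by auto
        moreover from this have "snd x = snd y"
          using x y \<Psi>'(3)[of "fst x"] eq by (auto dest: inj_onD)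
        ultimately show "x = y" by (rule prod_eqI)
      qed
      fix n u c assume c: "lplot ?E n u c"
      then have cE: "lplot E n u c" by (simp add: lplot_subset_diff[OF E])
      have cU: "\<pi> (c u) \<in> U" using lplot_pts[OF sE c] by auto
      obtain b where b: "lplot F n u b" "eventually (\<lambda>v. c v = \<Psi> (\<pi> (c v)) (b v)) (eucl_nhds n u)"
        using \<Psi>'(5)[OF cE cU] by blast
      have "lplot (prod_diff ?X F) n u (\<lambda>v. (\<pi> (c v), b v))"
        using evX[OF smooth_map_lplot[OF \<pi> cE] cU] b(1) by (simp add: lplot_prod_diff[OF sX F])
      moreover have "eventually (\<lambda>v. ?\<Psi> (\<pi> (c v), b v) = c v) (eucl_nhds n u)"
        using b(2) by eventually_elim simp
      ultimately show "\<exists>p. lplot (prod_diff ?X F) n u p \<and> eventually (\<lambda>v. ?\<Psi> (p v) = c v) (eucl_nhds n u)"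
        by (intro exI[of _ "\<lambda>v. (\<pi> (c v), b v)"] conjI)
    qed
    moreover have "\<forall>e\<in>pts (prod_diff ?X F). \<pi> (?\<Psi> e) = fst e" using \<Psi>'(2) by auto
    ultimately have "bundle_iso (prod_diff ?X F) fst ?E \<pi>"
      unfolding bundle_iso_def by blast
    then have "bundle_iso ?E \<pi> (prod_diff ?X F) fst" by (rule bundle_iso_sym[OF pr sE])
    moreover have "smooth_map ?E ?X \<pi>"
    proof (rule smooth_mapI[OF sE sX])
      fix n u c assume c: "lplot ?E n u c"
      show "lplot ?X n u (\<lambda>v. \<pi> (c v))"
        using c lplot_pts[OF sE c] smooth_map_lplot[OF \<pi>] by (intro evX) (auto simp: lplot_subset_diff[OF E])
    qed (use smooth_map_pts[OF \<pi>] in auto)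
    ultimately show "trivial_bundle ?E \<pi> ?X F" by (simp add: trivial_bundle_def)
  qed
qed

text \<open>Once each point has a trivialising neighbourhood, the family of all trivialising open
  sets is a cover as the definition demands.\<close>

lemma locally_trivial_iff:
  assumes E: "diffeological_space E" and X: "diffeological_space X" and F: "diffeological_space F"
  shows "locally_trivial E \<pi> X F \<longleftrightarrow> smooth_map E X \<pi> \<and>
    (\<forall>x\<in>pts X. \<exists>U \<Psi>. openin (D_topology X) U \<and> x \<in> U \<and> trivialises E \<pi> X F U \<Psi>)"
proof
  assume *: "locally_trivial E \<pi> X F"
  then have \<pi>: "smooth_map E X \<pi>" by (simp add: locally_trivial_def)
  from * obtain \<U> where \<U>: "\<forall>U\<in>\<U>. openin (D_topology X) U" "\<Union>\<U> = pts X"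
    "\<forall>U\<in>\<U>. trivial_bundle (subset_diff E {e. \<pi> e \<in> U}) \<pi> (subset_diff X U) F"
    by (auto simp: locally_trivial_def)
  have "\<exists>U \<Psi>. openin (D_topology X) U \<and> x \<in> U \<and> trivialises E \<pi> X F U \<Psi>" if x: "x \<in> pts X" for x
  proof -
    obtain U where U: "U \<in> \<U>" "x \<in> U" using x \<U>(2) by blast
    then obtain \<Psi> where "trivialises E \<pi> X F U \<Psi>"
      using \<U>(1,3) trivial_bundle_iff[OF E X F \<pi>, of U] by auto
    then show ?thesis using U \<U>(1) by (intro exI[of _ U] exI[of _ \<Psi>]) simp
  qed
  with \<pi> show "smooth_map E X \<pi> \<and>
    (\<forall>x\<in>pts X. \<exists>U \<Psi>. openin (D_topology X) U \<and> x \<in> U \<and> trivialises E \<pi> X F U \<Psi>)" by simp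
next
  assume *: "smooth_map E X \<pi> \<and>
    (\<forall>x\<in>pts X. \<exists>U \<Psi>. openin (D_topology X) U \<and> x \<in> U \<and> trivialises E \<pi> X F U \<Psi>)"
  let ?\<U> = "{U. openin (D_topology X) U \<and> (\<exists>\<Psi>. trivialises E \<pi> X F U \<Psi>)}"
  have "\<Union>?\<U> = pts X"
  proof
    show "\<Union>?\<U> \<subseteq> pts X" using openin_D_subset[of X] by (intro Union_least) simp
    show "pts X \<subseteq> \<Union>?\<U>"
    proof
      fix x assume "x \<in> pts X"
      then obtain U \<Psi> where "openin (D_topology X) U" "x \<in> U" "trivialises E \<pi> X F U \<Psi>"
        using * by blast
      then show "x \<in> \<Union>?\<U>" by blast
    qed
  qed
  moreover have "\<forall>U\<in>?\<U>. trivial_bundle (subset_diff E {e. \<pi> e \<in> U}) \<pi> (subset_diff X U) F"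
    using trivial_bundle_iff[OF E X F conjunct1[OF *]] by simp
  ultimately show "locally_trivial E \<pi> X F"
    unfolding locally_trivial_def using * by (intro conjI exI[of _ ?\<U>]) simp_all
qed

lemma trivialises_iso:
  assumes E: "diffeological_space E" and E': "diffeological_space E'"
    and \<Phi>: "smooth_map E E' \<Phi>" "smooth_map E' E \<Theta>"
    and a: "\<And>e. e \<in> pts E \<Longrightarrow> \<Theta> (\<Phi> e) = e \<and> \<pi>' (\<Phi> e) = \<pi> e"
    and b: "\<And>e. e \<in> pts E' \<Longrightarrow> \<Phi> (\<Theta> e) = e \<and> \<pi> (\<Theta> e) = \<pi>' e"
    and t: "trivialises E' \<pi>' X F U \<Psi>"
  shows "trivialises E \<pi> X F U (\<lambda>y z. \<Theta> (\<Psi> y z))"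
  unfolding trivialises_def
proof (intro conjI ballI allI impI)
  fix y z assume "y \<in> U" "z \<in> pts F"
  with trivialisesD(1,2)[OF t] b smooth_map_pts[OF \<Phi>(2)]
  show "\<Theta> (\<Psi> y z) \<in> pts E" "\<pi> (\<Theta> (\<Psi> y z)) = y" by auto
next
  fix y assume y: "y \<in> U"
  show "inj_on (\<lambda>z. \<Theta> (\<Psi> y z)) (pts F)"
  proof (rule inj_onI)
    fix z z' assume z: "z \<in> pts F" "z' \<in> pts F" and "\<Theta> (\<Psi> y z) = \<Theta> (\<Psi> y z')"
    then have "\<Psi> y z = \<Psi> y z'" using b trivialisesD(1)[OF t y] by metis
    then show "z = z'" using trivialisesD(3)[OF t y] z by (auto dest: inj_onD)
  qed
next
  fix n u a b assume "lplot X n u a" "a u \<in> U" "lplot F n u b"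
  then show "lplot E n u (\<lambda>v. \<Theta> (\<Psi> (a v) (b v)))"
    by (intro smooth_map_lplot[OF \<Phi>(2)] trivialisesD(4)[OF t])
next
  fix n u c assume c: "lplot E n u c" "\<pi> (c u) \<in> U"
  have "\<pi>' (\<Phi> (c u)) \<in> U" using c a lplot_pts[OF E c(1)] by simp
  then obtain b' where b': "lplot F n u b'"
    "eventually (\<lambda>v. \<Phi> (c v) = \<Psi> (\<pi>' (\<Phi> (c v))) (b' v)) (eucl_nhds n u)"
    using trivialisesD(5)[OF t smooth_map_lplot[OF \<Phi>(1) c(1)]] by blast
  have "eventually (\<lambda>v. c v = \<Theta> (\<Psi> (\<pi> (c v)) (b' v))) (eucl_nhds n u)"
    using b'(2) lplot_eventually_pts[OF E c(1)] by eventually_elim (metis a)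
  with b'(1) show "\<exists>b. lplot F n u b \<and> eventually (\<lambda>v. c v = \<Theta> (\<Psi> (\<pi> (c v)) (b v))) (eucl_nhds n u)"
    by blast
qed

lemma locally_trivial_iso:
  assumes E: "diffeological_space E" and E': "diffeological_space E'"
    and X: "diffeological_space X" and F: "diffeological_space F"
    and iso: "bundle_iso E \<pi> E' \<pi>'" and lt: "locally_trivial E' \<pi>' X F"
  shows "locally_trivial E \<pi> X F"
proof -
  obtain \<Phi> \<Theta> where a: "smooth_map E E' \<Phi>" "smooth_map E' E \<Theta>"
    "\<And>e. e \<in> pts E \<Longrightarrow> \<Theta> (\<Phi> e) = e \<and> \<pi>' (\<Phi> e) = \<pi> e"
    "\<And>e. e \<in> pts E' \<Longrightarrow> \<Phi> (\<Theta> e) = e \<and> \<pi> (\<Theta> e) = \<pi>' e"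
    using iso unfolding bundle_iso_iff[OF E E'] by metis
  note lt' = lt[unfolded locally_trivial_iff[OF E' X F]]
  have "smooth_map E X (\<lambda>e. \<pi>' (\<Phi> e))"
    by (rule smooth_map_comp[OF a(1) conjunct1[OF lt']])
  then have "smooth_map E X \<pi>" by (rule smooth_map_cong[OF E X]) (use a(3) in simp)
  moreover have "\<exists>U \<Psi>. openin (D_topology X) U \<and> x \<in> U \<and> trivialises E \<pi> X F U \<Psi>"
    if x: "x \<in> pts X" for x
  proof -
    obtain U \<Psi> where "openin (D_topology X) U" "x \<in> U" "trivialises E' \<pi>' X F U \<Psi>"
      using lt' x by blast
    then show ?thesis
      using trivialises_iso[OF E E' a] by (intro exI[of _ U] exI[of _ "\<lambda>y z. \<Theta> (\<Psi> y z)"]) simp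
  qed
  ultimately show ?thesis by (simp add: locally_trivial_iff[OF E X F])
qed

text \<open>Over the preimage of \<open>U\<close> the trivialisation keeps the base point
  \<open>y\<close> and evaluates the old one at \<open>f y\<close>.\<close>

lemma locally_trivial_pullback:
  assumes E: "diffeological_space E" and X: "diffeological_space X" and F: "diffeological_space F"
    and Y: "diffeological_space Y" and f: "smooth_map Y X f" and lt: "locally_trivial E \<pi> X F"
  shows "locally_trivial (pullback_space Y f E \<pi>) fst Y F"
proof -
  note P = diffeological_pullback[OF Y E, of f \<pi>]
  note lt' = lt[unfolded locally_trivial_iff[OF E X F]]
  have "smooth_map (pullback_space Y f E \<pi>) Y fst"
    by (rule smooth_mapI[OF P Y]) (auto simp: pts_pullback_space lplot_pullback[OF Y E])
  moreover have "\<exists>V \<Psi>. openin (D_topology Y) V \<and> y \<in> V \<and> trivialises (pullback_space Y f E \<pi>) fst Y F V \<Psi>"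
    if y: "y \<in> pts Y" for y
  proof -
    obtain U \<Psi> where U: "openin (D_topology X) U" "f y \<in> U" and t: "trivialises E \<pi> X F U \<Psi>"
      using lt' smooth_map_pts[OF f y] by blast
    let ?V = "{y \<in> pts Y. f y \<in> U}"
    have V: "openin (D_topology Y) ?V" by (rule openin_D_preimage[OF Y X f U(1)])
    have "trivialises (pullback_space Y f E \<pi>) fst Y F ?V (\<lambda>y z. (y, \<Psi> (f y) z))"
      unfolding trivialises_def
    proof (intro conjI ballI allI impI)
      fix y z assume "y \<in> ?V" "z \<in> pts F"
      then show "(y, \<Psi> (f y) z) \<in> pts (pullback_space Y f E \<pi>)"
        using trivialisesD(1,2)[OF t] by (simp add: pts_pullback_space)
    next
      fix y assume "y \<in> ?V"
      then show "inj_on (\<lambda>z. (y, \<Psi> (f y) z)) (pts F)"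
        using trivialisesD(3)[OF t, of "f y"] by (auto simp: inj_on_def)
    next
      fix n u a b assume a: "lplot Y n u a" "a u \<in> ?V" and b: "lplot F n u b"
      have fU: "f (a u) \<in> U" using a by simp
      have 1: "lplot E n u (\<lambda>v. \<Psi> (f (a v)) (b v))"
        using trivialisesD(4)[OF t smooth_map_lplot[OF f a(1)] fU b] .
      have "eventually (\<lambda>v. f (a v) = \<pi> (\<Psi> (f (a v)) (b v))) (eucl_nhds n u)"
        using eventually_plot_in_D_open[OF Y V a] lplot_eventually_pts[OF F b]
        by eventually_elim (use trivialisesD(2)[OF t] in simp)
      with 1 a(1) show "lplot (pullback_space Y f E \<pi>) n u (\<lambda>v. (a v, \<Psi> (f (a v)) (b v)))"
        by (simp add: lplot_pullback[OF Y E])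
    next
      fix n u c assume c: "lplot (pullback_space Y f E \<pi>) n u c" "fst (c u) \<in> ?V"
      note c' = c(1)[unfolded lplot_pullback[OF Y E]]
      have "\<pi> (snd (c u)) \<in> U" using lplot_pts[OF P c(1)] c(2) by (simp add: pts_pullback_space)
      then obtain b where b: "lplot F n u b"
        "eventually (\<lambda>v. snd (c v) = \<Psi> (\<pi> (snd (c v))) (b v)) (eucl_nhds n u)"
        using trivialisesD(5)[OF t, of n u "\<lambda>v. snd (c v)"] c' by blast
      have "eventually (\<lambda>v. c v = (fst (c v), \<Psi> (f (fst (c v))) (b v))) (eucl_nhds n u)"
        using b(2) c'[THEN conjunct2, THEN conjunct2] by eventually_elim (simp add: prod_eq_iff)
      with b(1) show "\<exists>b. lplot F n u b \<and>
          eventually (\<lambda>v. c v = (fst (c v), \<Psi> (f (fst (c v))) (b v))) (eucl_nhds n u)"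
        by blast
    qed auto
    with V y U(2) show ?thesis by (intro exI[of _ ?V] exI[of _ "\<lambda>y z. (y, \<Psi> (f y) z)"]) simp
  qed
  ultimately show ?thesis by (simp add: locally_trivial_iff[OF P Y F])
qed

text \<open>Plots are smooth maps, and trivialisations over D-open sets pull back along them;
  surjectivity for a nonempty fibre is read off the trivialisations.\<close>

lemma locally_trivial_imp_fibre_bundle:
  assumes E: "diffeological_space E" and X: "diffeological_space X" and F: "diffeological_space F"
    and lt: "locally_trivial E \<pi> X F"
  shows "diffeological_fibre_bundle E \<pi> X F"
  unfolding diffeological_fibre_bundle_def
proof (intro conjI allI impI)
  note lt' = lt[unfolded locally_trivial_iff[OF E X F]]
  show \<pi>: "smooth_map E X \<pi>" using lt' by simp
  show "\<pi> ` pts E = pts X" if ne: "pts F \<noteq> {}"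
  proof
    show "\<pi> ` pts E \<subseteq> pts X" using smooth_map_pts[OF \<pi>] by auto
    show "pts X \<subseteq> \<pi> ` pts E"
    proof
      fix x assume x: "x \<in> pts X"
      obtain z where z: "z \<in> pts F" using ne by blast
      obtain U \<Psi> where "x \<in> U" and t: "trivialises E \<pi> X F U \<Psi>" using lt' x by blast
      then show "x \<in> \<pi> ` pts E" using trivialisesD(1,2)[OF t _ z] by (metis imageI)
    qed
  qed
  fix n U p assume p: "plots X n U p"
  note U = plots_open[OF X p]
  show "locally_trivial (pullback_space (eucl_diff n U) p E \<pi>) fst (eucl_diff n U) F"
    by (rule locally_trivial_pullback[OF E X F diffeological_eucl[OF U] _ lt])
      (use p smooth_map_eucl_iff[OF X U] in simp)
qed fact

section \<open>Principal bundles as smooth torsors\<close>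

locale smooth_group =
  fixes G (structure) and DG :: "'g diffspace"
  assumes dgroup: "diffeological_group G DG"
begin

sublocale group G
  using dgroup by (simp add: diffeological_group_def)

lemma DG: "diffeological_space DG" and pts_DG: "pts DG = carrier G"
  using dgroup by (auto simp: diffeological_group_def)

lemma lplot_mult:
  assumes "lplot DG n u a" "lplot DG n u b" shows "lplot DG n u (\<lambda>v. a v \<otimes> b v)"
proof -
  have "smooth_map (prod_diff DG DG) DG (\<lambda>(g, h). g \<otimes> h)"
    using dgroup by (simp add: diffeological_group_def)
  from smooth_map_lplot[OF this, of n u "\<lambda>v. (a v, b v)"] assms show ?thesis
    by (simp add: lplot_prod_diff[OF DG DG])
qed

lemma lplot_inv: "lplot DG n u a \<Longrightarrow> lplot DG n u (\<lambda>v. inv (a v))"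
  using dgroup smooth_map_lplot[of DG DG "\<lambda>g. inv g"] by (simp add: diffeological_group_def)

lemma lplot_DG_carrier: "lplot DG n u a \<Longrightarrow> a u \<in> carrier G"
  using lplot_pts[OF DG] pts_DG by auto

lemma lplot_DG_eventually: "lplot DG n u a \<Longrightarrow> eventually (\<lambda>v. a v \<in> carrier G) (eucl_nhds n u)"
  using lplot_eventually_pts[OF DG] pts_DG by auto

end

text \<open>
  The action laws are only required on points, because the action on Milnor's space is not extensional
  and hence not a \<^const>\<open>group_action\<close>.
\<close>

locale smooth_gspace = smooth_group G DG
  for G (structure) and DG :: "'g diffspace" +
  fixes E :: "'e diffspace" and \<phi> :: "'g \<Rightarrow> 'e \<Rightarrow> 'e"
  assumes E: "diffeological_space E"
    and act_closed: "g \<in> carrier G \<Longrightarrow> e \<in> pts E \<Longrightarrow> \<phi> g e \<in> pts E"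
    and act_one: "e \<in> pts E \<Longrightarrow> \<phi> \<one> e = e"
    and act_mult: "g \<in> carrier G \<Longrightarrow> h \<in> carrier G \<Longrightarrow> e \<in> pts E \<Longrightarrow> \<phi> (g \<otimes> h) e = \<phi> g (\<phi> h e)"
    and act_lplot: "lplot DG n u a \<Longrightarrow> lplot E n u p \<Longrightarrow> lplot E n u (\<lambda>v. \<phi> (a v) (p v))"
begin

lemma act_inv_act: "g \<in> carrier G \<Longrightarrow> e \<in> pts E \<Longrightarrow> \<phi> (inv g) (\<phi> g e) = e"
  using act_mult[of "inv g" g e] act_one by simp

lemma act_act_inv: "g \<in> carrier G \<Longrightarrow> e \<in> pts E \<Longrightarrow> \<phi> g (\<phi> (inv g) e) = e"
  using act_mult[of g "inv g" e] act_one by simp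

end

lemma smooth_action_imp_gspace:
  assumes G: "diffeological_group G DG" and E: "diffeological_space E" and a: "smooth_action G DG E \<phi>"
  shows "smooth_gspace G DG E \<phi>"
proof -
  interpret smooth_group G DG by unfold_locales (rule G)
  interpret group_action G "pts E" \<phi> using a by (simp add: smooth_action_def)
  show ?thesis
  proof
    show "diffeological_space E" by fact
    show "\<phi> g e \<in> pts E" if "g \<in> carrier G" "e \<in> pts E" for g e
      using that element_image by blast
    show "\<phi> \<one>\<^bsub>G\<^esub> e = e" if "e \<in> pts E" for e using that id_eq_one by (metis restrict_apply')
    show "\<phi> (g \<otimes>\<^bsub>G\<^esub> h) e = \<phi> g (\<phi> h e)" if "g \<in> carrier G" "h \<in> carrier G" "e \<in> pts E" for g h e
      using that composition_rule by blast
    show "lplot E n u (\<lambda>v. \<phi> (a v) (p v))" if "lplot DG n u a" "lplot E n u p" for n u a p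
    proof -
      have "smooth_map (prod_diff DG E) E (\<lambda>(g, e). \<phi> g e)"
        using a by (simp add: smooth_action_def)
      from smooth_map_lplot[OF this, of n u "\<lambda>v. (a v, p v)"] that show ?thesis
        by (simp add: lplot_prod_diff[OF DG E])
    qed
  qed
qed

text \<open>\<open>group_action\<close> maps into \<open>BijGroup\<close>, whose elements are
  extensional bijections; restricting to the points meets this requirement and changes no value on
  them.\<close>

lemma (in smooth_gspace) smooth_action_restrict:
  "smooth_action G DG E (\<lambda>g. restrict (\<phi> g) (pts E))" (is "smooth_action G DG E ?\<phi>")
proof -
  have "?\<phi> g \<in> carrier (BijGroup (pts E))" if g: "g \<in> carrier G" for g
  proof -
    have "bij_betw (\<phi> g) (pts E) (pts E)"
      by (rule bij_betw_byWitness[of _ "\<phi> (inv g)"]) (use g act_closed act_inv_act act_act_inv in auto)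
    then have "bij_betw (?\<phi> g) (pts E) (pts E)"
      by (rule bij_betw_cong[THEN iffD1, rotated]) simp
    then show ?thesis by (simp add: BijGroup_def Bij_def)
  qed
  moreover have "?\<phi> (g \<otimes> h) = ?\<phi> g \<otimes>\<^bsub>BijGroup (pts E)\<^esub> ?\<phi> h"
    if g: "g \<in> carrier G" and h: "h \<in> carrier G" for g h
    using calculation[OF g] calculation[OF h]
    by (auto simp: BijGroup_def compose_def act_closed act_mult g h)
  ultimately have "?\<phi> \<in> hom G (BijGroup (pts E))" by (intro homI) auto
  then have "group_hom G (BijGroup (pts E)) ?\<phi>"
    by (intro group_hom.intro group_BijGroup) (simp_all add: group_hom_axioms_def is_group)
  then have "group_action G (pts E) ?\<phi>" by (rule group_action.intro)
  moreover have "smooth_map (prod_diff DG E) E (\<lambda>(g, e). ?\<phi> g e)"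
  proof (rule smooth_mapI[OF diffeological_prod[OF DG E] E])
    show "(\<lambda>(g, e). ?\<phi> g e) x \<in> pts E" if "x \<in> pts (prod_diff DG E)" for x
      using that by (auto simp: pts_DG act_closed)
    fix n u p assume p: "lplot (prod_diff DG E) n u p"
    then have "lplot E n u (\<lambda>v. \<phi> (fst (p v)) (snd (p v)))"
      by (auto simp: lplot_prod_diff[OF DG E] act_lplot)
    moreover have "eventually (\<lambda>v. (\<lambda>(g, e). ?\<phi> g e) (p v) = \<phi> (fst (p v)) (snd (p v))) (eucl_nhds n u)"
      using lplot_eventually_pts[OF diffeological_prod[OF DG E] p]
      by eventually_elim (auto simp: case_prod_unfold)
    ultimately show "lplot E n u (\<lambda>v. (\<lambda>(g, e). ?\<phi> g e) (p v))" by (rule lplot_cong[OF E])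
  qed
  ultimately show ?thesis by (simp add: smooth_action_def)
qed

text \<open>Working form of a principal bundle: the local diffeomorphisms are replaced by lifts of
  base germs and by a difference element that varies smoothly. It applies to Milnor's space as well.
  The difference is spelled out with \<open>THE\<close> because \<open>quot\<close> is only
  introduced afterwards.\<close>

locale torsor = smooth_gspace G DG P \<phi>
  for G (structure) and DG :: "'g diffspace" and P :: "'e diffspace" and \<phi> :: "'g \<Rightarrow> 'e \<Rightarrow> 'e" +
  fixes \<kappa> :: "'e \<Rightarrow> 'x" and X :: "'x diffspace"
  assumes X: "diffeological_space X"
    and proj_smooth: "smooth_map P X \<kappa>"
    and proj_act: "g \<in> carrier G \<Longrightarrow> e \<in> pts P \<Longrightarrow> \<kappa> (\<phi> g e) = \<kappa> e"
    and translation: "e \<in> pts P \<Longrightarrow> e' \<in> pts P \<Longrightarrow> \<kappa> e = \<kappa> e' \<Longrightarrow> \<exists>!g. g \<in> carrier G \<and> \<phi> g e = e'"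
    and lift: "lplot X n u a \<Longrightarrow> \<exists>q. lplot P n u q \<and> eventually (\<lambda>v. \<kappa> (q v) = a v) (eucl_nhds n u)"
    and translation_lplot: "lplot P n u p \<Longrightarrow> lplot P n u q \<Longrightarrow>
      eventually (\<lambda>v. \<kappa> (p v) = \<kappa> (q v)) (eucl_nhds n u) \<Longrightarrow>
      lplot DG n u (\<lambda>v. THE g. g \<in> carrier G \<and> \<phi> g (p v) = q v)"
begin

definition quot :: "'e \<Rightarrow> 'e \<Rightarrow> 'g" where
  "quot e e' = (THE g. g \<in> carrier G \<and> \<phi> g e = e')"

lemma quot:
  assumes "e \<in> pts P" "e' \<in> pts P" "\<kappa> e = \<kappa> e'"
  shows "quot e e' \<in> carrier G" "\<phi> (quot e e') e = e'"
  using theI'[OF translation[OF assms]] by (simp_all add: quot_def)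

lemma quot_eqI:
  assumes "e \<in> pts P" "g \<in> carrier G" "\<phi> g e = e'" shows "quot e e' = g"
proof -
  have "e' \<in> pts P" "\<kappa> e = \<kappa> e'" using act_closed proj_act assms by auto
  with translation[OF assms(1) this] show ?thesis
    unfolding quot_def using assms by (intro the1_equality) auto
qed

lemma act_free:
  assumes "e \<in> pts P" "g \<in> carrier G" "h \<in> carrier G" "\<phi> g e = \<phi> h e" shows "g = h"
  using quot_eqI[OF assms(1,2,4)] quot_eqI[OF assms(1,3) refl] by simp

lemma lplot_quot:
  assumes "lplot P n u p" "lplot P n u q" "eventually (\<lambda>v. \<kappa> (p v) = \<kappa> (q v)) (eucl_nhds n u)"
  shows "lplot DG n u (\<lambda>v. quot (p v) (q v))"
  using translation_lplot[OF assms] by (simp add: quot_def)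

lemma proj_surj: assumes "x \<in> pts X" obtains e where "e \<in> pts P" "\<kappa> e = x"
proof -
  obtain q where q: "lplot P 0 (\<lambda>_. 0) q" "eventually (\<lambda>v. \<kappa> (q v) = x) (eucl_nhds 0 (\<lambda>_. 0))"
    using lift[OF lplot_const[OF X zero_in_Euclidean assms]] by blast
  then show ?thesis
    using that lplot_pts[OF E q(1)] eventually_nhdsin_self[OF q(2) zero_in_Euclidean] by blast
qed

text \<open>The factor \<open>inv h\<close> appears on the right, exactly as in the action on
  Milnor's space; this makes the coordinates of the classifying map equivariant.\<close>

lemma quot_act_left:
  assumes "e \<in> pts P" "e' \<in> pts P" "\<kappa> e = \<kappa> e'" "h \<in> carrier G"
  shows "quot (\<phi> h e) e' = quot e e' \<otimes> inv h"
  using assms quot[OF assms(1-3)]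
  by (intro quot_eqI) (auto simp: act_closed act_mult act_inv_act)

lemma quot_act_right:
  assumes "e \<in> pts P" "e' \<in> pts P" "\<kappa> e = \<kappa> e'" "h \<in> carrier G"
  shows "quot e (\<phi> h e') = h \<otimes> quot e e'"
  using assms quot[OF assms(1-3)]
  by (intro quot_eqI) (auto simp: act_mult)

end

section \<open>Sections and local triviality of torsors\<close>

definition smooth_section :: "'e diffspace \<Rightarrow> ('e \<Rightarrow> 'x) \<Rightarrow> 'x diffspace \<Rightarrow> 'x set \<Rightarrow> ('x \<Rightarrow> 'e) \<Rightarrow> bool" where
  "smooth_section P \<kappa> X U \<sigma> \<longleftrightarrow> openin (D_topology X) U \<and> (\<forall>x\<in>U. \<sigma> x \<in> pts P \<and> \<kappa> (\<sigma> x) = x) \<and>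
     (\<forall>n u a. lplot X n u a \<longrightarrow> a u \<in> U \<longrightarrow> lplot P n u (\<lambda>v. \<sigma> (a v)))"

lemma smooth_sectionD:
  assumes "smooth_section P \<kappa> X U \<sigma>"
  shows "openin (D_topology X) U" "x \<in> U \<Longrightarrow> \<sigma> x \<in> pts P" "x \<in> U \<Longrightarrow> \<kappa> (\<sigma> x) = x"
    "lplot X n u a \<Longrightarrow> a u \<in> U \<Longrightarrow> lplot P n u (\<lambda>v. \<sigma> (a v))"
  using assms by (auto simp: smooth_section_def)

definition locally_sectioned :: "'e diffspace \<Rightarrow> ('e \<Rightarrow> 'x) \<Rightarrow> 'x diffspace \<Rightarrow> bool" where
  "locally_sectioned P \<kappa> X \<longleftrightarrow> (\<forall>x\<in>pts X. \<exists>U \<sigma>. x \<in> U \<and> smooth_section P \<kappa> X U \<sigma>)"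

context torsor
begin

text \<open>The fibre coordinate of a germ \<open>c\<close> is the element carrying the section to
  \<open>c\<close>, which is smooth by \<open>lplot_quot\<close>.\<close>

lemma trivialises_section:
  assumes \<sigma>: "smooth_section P \<kappa> X U \<sigma>"
  shows "trivialises P \<kappa> X DG U (\<lambda>x g. \<phi> g (\<sigma> x))"
  unfolding trivialises_def
proof (intro conjI ballI allI impI)
  note s = smooth_sectionD[OF \<sigma>]
  show "\<phi> g (\<sigma> x) \<in> pts P" "\<kappa> (\<phi> g (\<sigma> x)) = x" if "x \<in> U" "g \<in> pts DG" for x g
    using that s(2,3) by (auto simp: pts_DG act_closed proj_act)
  show "inj_on (\<lambda>g. \<phi> g (\<sigma> x)) (pts DG)" if "x \<in> U" for x
    using act_free[OF s(2)[OF that]] by (auto simp: inj_on_def pts_DG)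
  show "lplot P n u (\<lambda>v. \<phi> (b v) (\<sigma> (a v)))" if "lplot X n u a" "a u \<in> U" "lplot DG n u b" for n u a b
    using that s(4) act_lplot by simp
  fix n u c assume c: "lplot P n u c" "\<kappa> (c u) \<in> U"
  have \<kappa>c: "lplot X n u (\<lambda>v. \<kappa> (c v))" by (rule smooth_map_lplot[OF proj_smooth c(1)])
  have ev: "eventually (\<lambda>v. \<kappa> (c v) \<in> U) (eucl_nhds n u)"
    by (rule eventually_plot_in_D_open[OF X s(1) \<kappa>c c(2)])
  have "lplot DG n u (\<lambda>v. quot (\<sigma> (\<kappa> (c v))) (c v))"
    by (rule lplot_quot[OF s(4)[OF \<kappa>c c(2)] c(1)])
      (use ev in \<open>eventually_elim, simp add: s(3)\<close>)
  moreover have "eventually (\<lambda>v. c v = \<phi> (quot (\<sigma> (\<kappa> (c v))) (c v)) (\<sigma> (\<kappa> (c v)))) (eucl_nhds n u)"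
    using ev lplot_eventually_pts[OF E c(1)] by eventually_elim (simp add: quot(2) s(2,3))
  ultimately show "\<exists>b. lplot DG n u b \<and>
      eventually (\<lambda>v. c v = \<phi> (b v) (\<sigma> (\<kappa> (c v)))) (eucl_nhds n u)" by blast
qed

text \<open>A trivialisation evaluated at the unit is a section, and a section trivialises. Local
  triviality of principal bundles is handled through sections below.\<close>

lemma locally_trivial_iff_sectioned: "locally_trivial P \<kappa> X DG \<longleftrightarrow> locally_sectioned P \<kappa> X"
proof
  assume lt: "locally_trivial P \<kappa> X DG"
  show "locally_sectioned P \<kappa> X"
    unfolding locally_sectioned_def
  proof
    fix x assume "x \<in> pts X"
    then obtain U \<Psi> where U: "openin (D_topology X) U" "x \<in> U" and t: "trivialises P \<kappa> X DG U \<Psi>"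
      using lt unfolding locally_trivial_iff[OF E X DG] by blast
    have "lplot P n u (\<lambda>v. \<Psi> (a v) \<one>)" if "lplot X n u a" "a u \<in> U" for n u a
      by (rule trivialisesD(4)[OF t that lplot_const[OF DG lplot_topspace[OF that(1)]]])
        (simp add: pts_DG)
    then have "smooth_section P \<kappa> X U (\<lambda>y. \<Psi> y \<one>)"
      using U trivialisesD(1,2)[OF t] by (simp add: smooth_section_def pts_DG)
    with U show "\<exists>U \<sigma>. x \<in> U \<and> smooth_section P \<kappa> X U \<sigma>" by blast
  qed
next
  assume ls: "locally_sectioned P \<kappa> X"
  show "locally_trivial P \<kappa> X DG"
    unfolding locally_trivial_iff[OF E X DG]
  proof (intro conjI ballI proj_smooth)
    fix x assume "x \<in> pts X"
    then obtain U \<sigma> where U: "x \<in> U" and \<sigma>: "smooth_section P \<kappa> X U \<sigma>"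
      using ls unfolding locally_sectioned_def by blast
    from trivialises_section[OF \<sigma>] smooth_sectionD(1)[OF \<sigma>] U
    show "\<exists>U \<Psi>. openin (D_topology X) U \<and> x \<in> U \<and> trivialises P \<kappa> X DG U \<Psi>" by blast
  qed
qed

lemma lift_plot:
  assumes p: "plots X n U p" and u: "u \<in> U"
  obtains V q where "openin (Euclidean_space n) V" "u \<in> V" "V \<subseteq> U" "plots P n V q" "\<forall>v\<in>V. \<kappa> (q v) = p v"
proof -
  note U = plots_open[OF X p]
  obtain q where q: "lplot P n u q" "eventually (\<lambda>v. \<kappa> (q v) = p v) (eucl_nhds n u)"
    using lift[OF lplotI[OF X p u]] by blast
  obtain W where W: "openin (Euclidean_space n) W" "u \<in> W" "plots P n W q"
    using q(1) unfolding lplot_def by blast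
  obtain W' where W': "openin (Euclidean_space n) W'" "u \<in> W'" "\<forall>v\<in>W'. \<kappa> (q v) = p v"
    using q(2) lplot_topspace[OF q(1)] by (auto simp: eventually_nhdsin)
  have o: "openin (Euclidean_space n) (W \<inter> W' \<inter> U)" using W W' U by blast
  show ?thesis
    by (rule that[OF o]) (use W W' u plots_subset[OF E W(3) o] in auto)
qed

text \<open>The inverse of \<open>(v, g) \<mapsto> (v, \<phi> g (q v))\<close> sends
  \<open>(v, e)\<close> to \<open>(v, quot (q v) e)\<close>, so the local diffeomorphisms come from
  smooth division. The sections provide the clause that \<open>P\<close> is a fibre bundle with
  fibre \<open>DG\<close>.\<close>

lemma imp_principal_bundle:
  assumes ls: "locally_sectioned P \<kappa> X" and act: "smooth_action G DG P \<phi>"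
  shows "principal_bundle G DG P \<kappa> X \<phi>"
  unfolding principal_bundle_def
proof (intro conjI allI impI)
  show "diffeological_fibre_bundle P \<kappa> X DG"
    using ls locally_trivial_iff_sectioned by (intro locally_trivial_imp_fibre_bundle[OF E X DG]) simp
  fix n U p u assume pu: "plots X n U p \<and> u \<in> U"
  obtain V q where V: "openin (Euclidean_space n) V" "u \<in> V" "V \<subseteq> U" and q: "plots P n V q"
    and \<kappa>q: "\<forall>v\<in>V. \<kappa> (q v) = p v"
    using lift_plot[OF conjunct1[OF pu] conjunct2[OF pu]] by blast
  note EV = diffeological_eucl[OF V(1)]
  note D1 = diffeological_prod[OF EV DG] and D2 = diffeological_pullback[OF EV E, of p \<kappa>]
  have qs: "smooth_map (eucl_diff n V) P q" using q smooth_map_eucl_iff[OF E V(1)] by simp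
  let ?f = "\<lambda>(v, g). (v, \<phi> g (q v))"
  have "diffeomorphism (prod_diff (eucl_diff n V) DG) (pullback_space (eucl_diff n V) p P \<kappa>) ?f"
  proof (rule diffeomorphism_by_lifting[OF D1 D2])
    have pt: "?f z \<in> pts (pullback_space (eucl_diff n V) p P \<kappa>)"
      if z: "z \<in> pts (prod_diff (eucl_diff n V) DG)" for z
      using z \<kappa>q smooth_map_pts[OF qs]
      by (auto simp: pts_pullback_space pts_DG act_closed proj_act)
    show "smooth_map (prod_diff (eucl_diff n V) DG) (pullback_space (eucl_diff n V) p P \<kappa>) ?f"
    proof (rule smooth_mapI[OF D1 D2 pt])
      fix m w c assume c: "lplot (prod_diff (eucl_diff n V) DG) m w c"
      note c' = c[unfolded lplot_prod_diff[OF EV DG]]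
      have "lplot P m w (\<lambda>v. \<phi> (snd (c v)) (q (fst (c v))))"
        using c' smooth_map_lplot[OF qs] act_lplot by simp
      moreover have "eventually (\<lambda>v. p (fst (c v)) = \<kappa> (\<phi> (snd (c v)) (q (fst (c v))))) (eucl_nhds m w)"
        using lplot_eventually_pts[OF D1 c]
        by eventually_elim (use pt in \<open>auto simp: pts_pullback_space case_prod_unfold\<close>)
      ultimately show "lplot (pullback_space (eucl_diff n V) p P \<kappa>) m w (\<lambda>v. ?f (c v))"
        using c' by (simp add: lplot_pullback[OF EV E] case_prod_unfold)
    qed
    show "inj_on ?f (pts (prod_diff (eucl_diff n V) DG))"
      using smooth_map_pts[OF qs] by (auto simp: inj_on_def pts_DG intro: act_free)
    fix m w c assume c: "lplot (pullback_space (eucl_diff n V) p P \<kappa>) m w c"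
    note c' = c[unfolded lplot_pullback[OF EV E]]
    have ev: "eventually (\<lambda>v. fst (c v) \<in> V \<and> snd (c v) \<in> pts P \<and> \<kappa> (q (fst (c v))) = \<kappa> (snd (c v)))
        (eucl_nhds m w)"
      using lplot_eventually_pts[OF D2 c] by eventually_elim (use \<kappa>q in \<open>auto simp: pts_pullback_space\<close>)
    have "lplot DG m w (\<lambda>v. quot (q (fst (c v))) (snd (c v)))"
      by (rule lplot_quot)
        (use c' smooth_map_lplot[OF qs] ev in \<open>auto elim: eventually_mono\<close>)
    then have "lplot (prod_diff (eucl_diff n V) DG) m w (\<lambda>v. (fst (c v), quot (q (fst (c v))) (snd (c v))))"
      using c' by (simp add: lplot_prod_diff[OF EV DG])
    moreover have "eventually (\<lambda>v. ?f (fst (c v), quot (q (fst (c v))) (snd (c v))) = c v) (eucl_nhds m w)"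
      using ev by eventually_elim (use smooth_map_pts[OF qs] in \<open>simp add: quot prod_eq_iff\<close>)
    ultimately show "\<exists>r. lplot (prod_diff (eucl_diff n V) DG) m w r \<and>
        eventually (\<lambda>v. ?f (r v) = c v) (eucl_nhds m w)"
      by (intro exI[of _ "\<lambda>v. (fst (c v), quot (q (fst (c v))) (snd (c v)))"] conjI)
  qed
  then show "\<exists>V q. openin (Euclidean_space n) V \<and> u \<in> V \<and> V \<subseteq> U \<and> plots P n V q \<and>
      (\<forall>v\<in>V. \<kappa> (q v) = p v) \<and>
      diffeomorphism (prod_diff (eucl_diff n V) DG) (pullback_space (eucl_diff n V) p P \<kappa>)
        (\<lambda>(v, g). (v, \<phi> g (q v)))"
    using V q \<kappa>q by (intro exI[of _ V] exI[of _ q] conjI)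
qed (rule act)

end

lemma principal_bundle_imp_torsor:
  assumes G: "diffeological_group G DG" and X: "diffeological_space X"
    and pb: "principal_bundle G DG P \<kappa> X \<phi>"
  shows "torsor G DG P \<phi> \<kappa> X"
proof -
  have P: "diffeological_space P" and \<kappa>: "smooth_map P X \<kappa>" and act: "smooth_action G DG P \<phi>"
    using pb by (auto simp: principal_bundle_def diffeological_fibre_bundle_def)
  interpret smooth_gspace G DG P \<phi> by (rule smooth_action_imp_gspace[OF G P act])
  let ?f = "\<lambda>q (v, g). (v, \<phi> g (q v))"
  have loc: "\<exists>V q. openin (Euclidean_space n) V \<and> u \<in> V \<and> V \<subseteq> U \<and> plots P n V q \<and>
      (\<forall>v\<in>V. \<kappa> (q v) = p v) \<and>
      diffeomorphism (prod_diff (eucl_diff n V) DG) (pullback_space (eucl_diff n V) p P \<kappa>) (?f q)"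
    if "plots X n U p" "u \<in> U" for n U p u
    using conjunct2[OF conjunct2[OF pb[unfolded principal_bundle_def]], rule_format, OF conjI[OF that]] .
  \<comment> \<open>The pullback along a constant plot on the one-point space is a single fibre, so
    the local diffeomorphism shows each fibre to be a free orbit.\<close>
  have fibre: "\<exists>q0\<in>pts P. inj_on (\<lambda>g. \<phi> g q0) (carrier G) \<and>
      {e \<in> pts P. \<kappa> e = x} = (\<lambda>g. \<phi> g q0) ` carrier G" if x: "x \<in> pts X" for x
  proof -
    obtain V q where V: "openin (Euclidean_space 0) V" "(\<lambda>_. 0) \<in> V" "plots P 0 V q"
      and "diffeomorphism (prod_diff (eucl_diff 0 V) DG) (pullback_space (eucl_diff 0 V) (\<lambda>_. x) P \<kappa>) (?f q)"
      using loc[OF plots_const[OF X openin_topspace x] zero_in_Euclidean] by blast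
    then have bij: "bij_betw (?f q) (V \<times> carrier G) {z. fst z \<in> V \<and> snd z \<in> pts P \<and> x = \<kappa> (snd z)}"
      by (simp add: diffeomorphism_def pts_pullback_space pts_DG)
    have "inj_on (\<lambda>g. \<phi> g (q (\<lambda>_. 0))) (carrier G)"
    proof (rule inj_onI)
      fix g h assume gh: "g \<in> carrier G" "h \<in> carrier G" "\<phi> g (q (\<lambda>_. 0)) = \<phi> h (q (\<lambda>_. 0))"
      have "(\<lambda>_. 0, g) = ((\<lambda>_. 0, h) :: (nat \<Rightarrow> real) \<times> _)"
        by (rule inj_onD[OF bij_betw_imp_inj_on[OF bij]]) (use gh V in auto)
      then show "g = h" by simp
    qed
    moreover have "e \<in> (\<lambda>g. \<phi> g (q (\<lambda>_. 0))) ` carrier G" if e: "e \<in> pts P" "\<kappa> e = x" for e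
    proof -
      have "((\<lambda>_. 0), e) \<in> ?f q ` (V \<times> carrier G)"
        unfolding bij_betw_imp_surj_on[OF bij] using e V by simp
      then show ?thesis by auto
    qed
    moreover have "\<phi> g (q (\<lambda>_. 0)) \<in> pts P \<and> \<kappa> (\<phi> g (q (\<lambda>_. 0))) = x" if g: "g \<in> carrier G" for g
      using bij_betw_apply[OF bij, of "(\<lambda>_. 0, g)"] g V by simp
    ultimately show ?thesis
      using plots_into[OF P V(3,2)] by (intro bexI[of _ "q (\<lambda>_. 0)"] conjI) auto
  qed
  \<comment> \<open>\<open>principal_bundle\<close> does not state that the action preserves fibres;
    it follows because the fibre of \<open>e\<close> is an orbit.\<close>
  have proj_act: "\<kappa> (\<phi> g e) = \<kappa> e" if g: "g \<in> carrier G" and e: "e \<in> pts P" for g e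
  proof -
    obtain q0 where q0: "q0 \<in> pts P" "{e' \<in> pts P. \<kappa> e' = \<kappa> e} = (\<lambda>g. \<phi> g q0) ` carrier G"
      using fibre[OF smooth_map_pts[OF \<kappa> e]] by blast
    obtain h where h: "h \<in> carrier G" "e = \<phi> h q0" using q0(2) e by blast
    have "\<phi> g e = \<phi> (g \<otimes>\<^bsub>G\<^esub> h) q0" using act_mult g h q0 by simp
    then have "\<phi> g e \<in> {e' \<in> pts P. \<kappa> e' = \<kappa> e}" unfolding q0(2) using g h by blast
    then show ?thesis by simp
  qed
  have tr: "\<exists>!g. g \<in> carrier G \<and> \<phi> g e = e'" if e: "e \<in> pts P" "e' \<in> pts P" "\<kappa> e = \<kappa> e'" for e e'
  proof -
    obtain q0 where q0: "q0 \<in> pts P" "inj_on (\<lambda>g. \<phi> g q0) (carrier G)"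
      "{a \<in> pts P. \<kappa> a = \<kappa> e} = (\<lambda>g. \<phi> g q0) ` carrier G"
      using fibre[OF smooth_map_pts[OF \<kappa> e(1)]] by blast
    obtain h where h: "h \<in> carrier G" "e = \<phi> h q0" using q0(3) e by blast
    obtain h' where h': "h' \<in> carrier G" "e' = \<phi> h' q0"
    proof -
      have "e' \<in> {a \<in> pts P. \<kappa> a = \<kappa> e}" using e by simp
      then show ?thesis unfolding q0(3) using that by blast
    qed
    have eq: "\<phi> g e = \<phi> (g \<otimes>\<^bsub>G\<^esub> h) q0" if "g \<in> carrier G" for g
      using act_mult that h q0 by simp
    show ?thesis
    proof (rule ex1I[of _ "h' \<otimes>\<^bsub>G\<^esub> inv\<^bsub>G\<^esub> h"])
      have "h' \<otimes>\<^bsub>G\<^esub> inv\<^bsub>G\<^esub> h \<otimes>\<^bsub>G\<^esub> h = h'" using h h' by (simp add: m_assoc)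
      then show "h' \<otimes>\<^bsub>G\<^esub> inv\<^bsub>G\<^esub> h \<in> carrier G \<and> \<phi> (h' \<otimes>\<^bsub>G\<^esub> inv\<^bsub>G\<^esub> h) e = e'"
        using eq h h' by simp
      fix g assume g: "g \<in> carrier G \<and> \<phi> g e = e'"
      then have "\<phi> (g \<otimes>\<^bsub>G\<^esub> h) q0 = \<phi> h' q0" using eq[of g] h' by simp
      then have "g \<otimes>\<^bsub>G\<^esub> h = h'" using q0(2) g h h' by (auto dest: inj_onD)
      then show "g = h' \<otimes>\<^bsub>G\<^esub> inv\<^bsub>G\<^esub> h" using g h h' inv_solve_right by blast
    qed
  qed
  show ?thesis
  proof
    fix n u p assume p: "lplot X n u p"
    then obtain U where U: "u \<in> U" "plots X n U p" unfolding lplot_def by blast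
    obtain V q where "openin (Euclidean_space n) V" "u \<in> V" "plots P n V q" "\<forall>v\<in>V. \<kappa> (q v) = p v"
      using loc[OF U(2,1)] by blast
    then have "lplot P n u q" "eventually (\<lambda>v. \<kappa> (q v) = p v) (eucl_nhds n u)"
      by (auto simp: lplot_def eventually_nhdsin)
    then show "\<exists>q. lplot P n u q \<and> eventually (\<lambda>v. \<kappa> (q v) = p v) (eucl_nhds n u)" by blast
  next
    fix n u p q assume p: "lplot P n u p" and q: "lplot P n u q"
      and eq: "eventually (\<lambda>v. \<kappa> (p v) = \<kappa> (q v)) (eucl_nhds n u)"
    obtain U where U: "u \<in> U" "plots X n U (\<lambda>v. \<kappa> (p v))"
      using smooth_map_lplot[OF \<kappa> p] unfolding lplot_def by blast
    obtain V s where V: "openin (Euclidean_space n) V" "u \<in> V" and s: "plots P n V s"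
      and d: "diffeomorphism (prod_diff (eucl_diff n V) DG)
        (pullback_space (eucl_diff n V) (\<lambda>v. \<kappa> (p v)) P \<kappa>) (?f s)"
      using loc[OF U(2,1)] by blast
    note EV = diffeological_eucl[OF V(1)]
    note D1 = diffeological_prod[OF EV DG] and D2 = diffeological_pullback[OF EV P, of "\<lambda>v. \<kappa> (p v)" \<kappa>]
    obtain h where h: "smooth_map (pullback_space (eucl_diff n V) (\<lambda>v. \<kappa> (p v)) P \<kappa>)
        (prod_diff (eucl_diff n V) DG) h"
      and hf: "\<forall>z\<in>pts (pullback_space (eucl_diff n V) (\<lambda>v. \<kappa> (p v)) P \<kappa>). ?f s (h z) = z"
      using d unfolding diffeomorphism_iff[OF D1 D2] by blast
    have idV: "lplot (eucl_diff n V) n u (\<lambda>v. v)"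
      using V smooth_eucl_inclusion[OF V(1)] by (auto simp: lplot_def eucl_diff_def)
    \<comment> \<open>Every germ over the given base germ has a smooth group coordinate relative to
      the local lift \<open>s\<close>, read off the inverse diffeomorphism.\<close>
    have coord: "\<exists>c. lplot DG n u c \<and> eventually (\<lambda>v. \<phi> (c v) (s v) = a v) (eucl_nhds n u)"
      if a: "lplot P n u a" "eventually (\<lambda>v. \<kappa> (p v) = \<kappa> (a v)) (eucl_nhds n u)" for a
    proof -
      have l: "lplot (pullback_space (eucl_diff n V) (\<lambda>v. \<kappa> (p v)) P \<kappa>) n u (\<lambda>v. (v, a v))"
        using a idV by (simp add: lplot_pullback[OF EV P])
      have "lplot DG n u (\<lambda>v. snd (h (v, a v)))"
        using smooth_map_lplot[OF h l] by (simp add: lplot_prod_diff[OF EV DG])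
      moreover have "eventually (\<lambda>v. \<phi> (snd (h (v, a v))) (s v) = a v) (eucl_nhds n u)"
        using lplot_eventually_pts[OF D2 l]
      proof eventually_elim
        case (elim v)
        have "?f s (h (v, a v)) = (v, a v)" using hf elim by blast
        then show ?case by (auto simp: case_prod_unfold)
      qed
      ultimately show ?thesis by (intro exI[of _ "\<lambda>v. snd (h (v, a v))"] conjI)
    qed
    obtain c where c: "lplot DG n u c" "eventually (\<lambda>v. \<phi> (c v) (s v) = p v) (eucl_nhds n u)"
      using coord[OF p] by auto
    obtain c' where c': "lplot DG n u c'" "eventually (\<lambda>v. \<phi> (c' v) (s v) = q v) (eucl_nhds n u)"
      using coord[OF q eq] by auto
    \<comment> \<open>If \<open>c\<close> carries \<open>s\<close> to \<open>p\<close> and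
      \<open>c'\<close> carries \<open>s\<close> to \<open>q\<close>, then this element carries
      \<open>p\<close> to \<open>q\<close>.\<close>
    have "lplot DG n u (\<lambda>v. c' v \<otimes>\<^bsub>G\<^esub> inv\<^bsub>G\<^esub> (c v))"
      by (intro lplot_mult lplot_inv c c')
    moreover have "eventually (\<lambda>v. (THE g. g \<in> carrier G \<and> \<phi> g (p v) = q v) =
        c' v \<otimes>\<^bsub>G\<^esub> inv\<^bsub>G\<^esub> (c v)) (eucl_nhds n u)"
      using c(2) c'(2) lplot_DG_eventually[OF c(1)] lplot_DG_eventually[OF c'(1)] eq
        eventually_in_openin[OF V] lplot_eventually_pts[OF P p] lplot_eventually_pts[OF P q]
    proof eventually_elim
      case (elim v)
      have s: "s v \<in> pts P" using plots_into[OF P s] elim by simp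
      show ?case
      proof (rule the1_equality[OF tr])
        have "\<phi> (c' v \<otimes>\<^bsub>G\<^esub> inv\<^bsub>G\<^esub> c v) (p v) = \<phi> (c' v) (\<phi> (inv\<^bsub>G\<^esub> c v) (\<phi> (c v) (s v)))"
          using elim act_mult by simp
        also have "\<dots> = q v" using act_inv_act[OF _ s, of "c v"] elim by simp
        finally show "c' v \<otimes>\<^bsub>G\<^esub> inv\<^bsub>G\<^esub> c v \<in> carrier G \<and> \<phi> (c' v \<otimes>\<^bsub>G\<^esub> inv\<^bsub>G\<^esub> c v) (p v) = q v"
          using elim by simp
      qed (use elim in auto)
    qed
    ultimately show "lplot DG n u (\<lambda>v. THE g. g \<in> carrier G \<and> \<phi> g (p v) = q v)"
      by (rule lplot_cong[OF DG])
  qed (fact X \<kappa> proj_act tr)+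
qed

section \<open>Associated bundles and pullbacks of torsors\<close>

locale associated = torsor G DG P \<phi> \<kappa> X + F: smooth_gspace G DG F \<psi>
  for G (structure) and DG :: "'g diffspace" and P :: "'e diffspace" and \<phi> :: "'g \<Rightarrow> 'e \<Rightarrow> 'e"
    and \<kappa> :: "'e \<Rightarrow> 'x" and X :: "'x diffspace" and F :: "'f diffspace" and \<psi> :: "'g \<Rightarrow> 'f \<Rightarrow> 'f"
begin

text \<open>The point usually written [e, y]; a closed form of the quotient class that spares
  unfolding \<open>orbit_rel\<close>.\<close>

definition cls :: "'e \<Rightarrow> 'f \<Rightarrow> ('e \<times> 'f) set" where
  "cls e y = {(\<phi> g e, \<psi> g y) | g. g \<in> carrier G}"

abbreviation A :: "('e \<times> 'f) set diffspace" where
  "A \<equiv> associated_space G P \<phi> F \<psi>"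

abbreviation A_proj :: "('e \<times> 'f) set \<Rightarrow> 'x" where
  "A_proj \<equiv> associated_proj \<kappa>"

lemma diffeological_A: "diffeological_space A"
  unfolding associated_space_def orbit_space_def
  by (intro diffeological_quotient diffeological_prod E F.E)

lemma orbit_rel_cls:
  "z \<in> pts P \<times> pts F \<Longrightarrow>
    orbit_rel G (\<lambda>g (e, y). (\<phi> g e, \<psi> g y)) (pts (prod_diff P F)) `` {z} = cls (fst z) (snd z)"
  by (auto simp: orbit_rel_def orbit_def cls_def case_prod_unfold)

lemma A_E:
  assumes "c \<in> pts A" obtains e y where "e \<in> pts P" "y \<in> pts F" "c = cls e y"
proof -
  obtain z where "z \<in> pts P \<times> pts F"
    "c = orbit_rel G (\<lambda>g (e, y). (\<phi> g e, \<psi> g y)) (pts (prod_diff P F)) `` {z}"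
    using assms
    by (auto simp: associated_space_def orbit_space_def quotient_diff_def elim!: quotientE)
  then show ?thesis using that[of "fst z" "snd z"] orbit_rel_cls[of z] by auto
qed

lemma cls_in_A: assumes "e \<in> pts P" "y \<in> pts F" shows "cls e y \<in> pts A"
proof -
  have z: "(e, y) \<in> pts (prod_diff P F)" using assms by simp
  show ?thesis
    using quotientI[OF z, of "orbit_rel G (\<lambda>g (e, y). (\<phi> g e, \<psi> g y)) (pts (prod_diff P F))"]
      orbit_rel_cls[of "(e, y)"] assms
    by (simp add: associated_space_def orbit_space_def quotient_diff_def)
qed

lemma lplot_A:
  "lplot A n u c \<longleftrightarrow> (\<exists>a b. lplot P n u a \<and> lplot F n u b \<and>
    eventually (\<lambda>v. c v = cls (a v) (b v)) (eucl_nhds n u))" (is "_ \<longleftrightarrow> ?r")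
proof -
  note pr = diffeological_prod[OF E F.E]
  let ?R = "orbit_rel G (\<lambda>g (e, y). (\<phi> g e, \<psi> g y)) (pts (prod_diff P F))"
  have *: "lplot A n u c \<longleftrightarrow>
      (\<exists>q. lplot (prod_diff P F) n u q \<and> eventually (\<lambda>v. c v = ?R `` {q v}) (eucl_nhds n u))"
    by (simp add: associated_space_def orbit_space_def lplot_quotient_diff[OF pr])
  have **: "eventually (\<lambda>v. ?R `` {q v} = cls (fst (q v)) (snd (q v))) (eucl_nhds n u)"
    if "lplot (prod_diff P F) n u q" for q
    using lplot_eventually_pts[OF pr that] by eventually_elim (rule orbit_rel_cls, simp)
  show ?thesis
  proof
    assume "lplot A n u c"
    then obtain q where q: "lplot (prod_diff P F) n u q" "eventually (\<lambda>v. c v = ?R `` {q v}) (eucl_nhds n u)"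
      using * by blast
    have "eventually (\<lambda>v. c v = cls (fst (q v)) (snd (q v))) (eucl_nhds n u)"
      using q(2) **[OF q(1)] by eventually_elim simp
    then show ?r
      using q(1) by (intro exI[of _ "\<lambda>v. fst (q v)"] exI[of _ "\<lambda>v. snd (q v)"])
        (simp add: lplot_prod_diff[OF E F.E])
  next
    assume ?r
    then obtain a b where ab: "lplot P n u a" "lplot F n u b"
      "eventually (\<lambda>v. c v = cls (a v) (b v)) (eucl_nhds n u)" by blast
    have q: "lplot (prod_diff P F) n u (\<lambda>v. (a v, b v))"
      using ab by (simp add: lplot_prod_diff[OF E F.E])
    have "eventually (\<lambda>v. c v = ?R `` {(a v, b v)}) (eucl_nhds n u)"
      using ab(3) **[OF q] by eventually_elim simp
    with q show "lplot A n u c" using * by blast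
  qed
qed

lemma lplot_cls: "lplot P n u a \<Longrightarrow> lplot F n u b \<Longrightarrow> lplot A n u (\<lambda>v. cls (a v) (b v))"
  unfolding lplot_A by (intro exI[of _ a] exI[of _ b]) simp

lemma cls_act:
  assumes "e \<in> pts P" "y \<in> pts F" "g \<in> carrier G" shows "cls (\<phi> g e) (\<psi> g y) = cls e y"
proof
  show "cls (\<phi> g e) (\<psi> g y) \<subseteq> cls e y"
    using assms by (auto simp: cls_def act_mult[symmetric] F.act_mult[symmetric])
  show "cls e y \<subseteq> cls (\<phi> g e) (\<psi> g y)"
  proof
    fix z assume "z \<in> cls e y"
    then obtain h where h: "h \<in> carrier G" "z = (\<phi> h e, \<psi> h y)" by (auto simp: cls_def)
    have "h \<otimes> inv g \<otimes> g = h" using h assms by (simp add: m_assoc)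
    then have "z = (\<phi> (h \<otimes> inv g) (\<phi> g e), \<psi> (h \<otimes> inv g) (\<psi> g y))"
      using act_mult[of "h \<otimes> inv g" g e] F.act_mult[of "h \<otimes> inv g" g y] h assms by simp
    then show "z \<in> cls (\<phi> g e) (\<psi> g y)" using h assms by (auto simp: cls_def)
  qed
qed

text \<open>Moves a group element across the balanced product; fibre coordinates and lifts below are
  obtained by this change of representative.\<close>

lemma cls_act_inv:
  assumes "e \<in> pts P" "y \<in> pts F" "g \<in> carrier G" shows "cls (\<phi> g e) y = cls e (\<psi> (inv g) y)"
  using cls_act[OF assms(1) F.act_closed[OF inv_closed[OF assms(3)] assms(2)] assms(3)] assms
  by (simp add: F.act_act_inv)

lemma cls_eqE:
  assumes "cls e y = cls e' y'" "e \<in> pts P" "y \<in> pts F" "e' \<in> pts P" "y' \<in> pts F"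
  obtains g where "g \<in> carrier G" "e' = \<phi> g e" "y' = \<psi> g y"
proof -
  have "(e', y') \<in> cls e' y'"
    using assms act_one F.act_one by (auto simp: cls_def intro!: exI[of _ \<one>])
  then show ?thesis using assms(1) that by (auto simp: cls_def)
qed

lemma A_proj_cls: assumes "e \<in> pts P" shows "A_proj (cls e y) = \<kappa> e"
proof -
  have "(\<lambda>(e, y). \<kappa> e) ` cls e y = (\<lambda>g. \<kappa> (\<phi> g e)) ` carrier G"
    by (auto simp: cls_def image_def)
  also have "\<dots> = {\<kappa> e}" using proj_act[OF _ assms] by (auto intro: image_eqI[of _ _ \<one>])
  finally have "(\<lambda>(e, y). \<kappa> e) ` cls e y = {\<kappa> e}" .
  then show ?thesis by (simp add: associated_proj_def)
qed

lemma A_proj_smooth: "smooth_map A X A_proj"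
proof (rule smooth_mapI[OF diffeological_A X])
  show "A_proj c \<in> pts X" if "c \<in> pts A" for c
    using that smooth_map_pts[OF proj_smooth] by (auto elim!: A_E simp: A_proj_cls)
  fix n u c assume "lplot A n u c"
  then obtain a b where a: "lplot P n u a" and c: "eventually (\<lambda>v. c v = cls (a v) (b v)) (eucl_nhds n u)"
    unfolding lplot_A by blast
  show "lplot X n u (\<lambda>v. A_proj (c v))"
    by (rule lplot_cong[OF X smooth_map_lplot[OF proj_smooth a]])
      (use c lplot_eventually_pts[OF E a] in \<open>eventually_elim, simp add: A_proj_cls\<close>)
qed

text \<open>The two representatives are related by a group element fixing \<open>e\<close>, which is
  the unit by freeness.\<close>

lemma cls_eq_fibreD:
  assumes "cls e y = cls e y'" "e \<in> pts P" "y \<in> pts F" "y' \<in> pts F" shows "y = y'"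
proof -
  obtain g where g: "g \<in> carrier G" "e = \<phi> g e" "y' = \<psi> g y"
    using cls_eqE[OF assms(1,2,3,2,4)] by blast
  have "g = \<one>" using act_free[of e g \<one>] g assms act_one by simp
  then show ?thesis using g F.act_one assms by simp
qed

text \<open>If \<open>g\<close> carries the section to \<open>a\<close>, then the class of
  \<open>(a, b)\<close> is also represented by the section and \<open>\<psi> (inv g) b\<close>; this
  second component is the smooth fibre coordinate.\<close>

lemma trivialises_A:
  assumes \<sigma>: "smooth_section P \<kappa> X U \<sigma>"
  shows "trivialises A A_proj X F U (\<lambda>x y. cls (\<sigma> x) y)"
  unfolding trivialises_def
proof (intro conjI ballI allI impI)
  note s = smooth_sectionD[OF \<sigma>]
  show "cls (\<sigma> x) y \<in> pts A" "A_proj (cls (\<sigma> x) y) = x" if "x \<in> U" "y \<in> pts F" for x y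
    using that s(2,3) cls_in_A A_proj_cls by auto
  show "inj_on (cls (\<sigma> x)) (pts F)" if "x \<in> U" for x
    using cls_eq_fibreD s(2)[OF that] by (auto simp: inj_on_def)
  show "lplot A n u (\<lambda>v. cls (\<sigma> (a v)) (b v))" if "lplot X n u a" "a u \<in> U" "lplot F n u b" for n u a b
    using that s(4) lplot_cls by simp
  fix n u c assume c: "lplot A n u c" "A_proj (c u) \<in> U"
  then obtain a b where a: "lplot P n u a" and b: "lplot F n u b"
    and ab: "eventually (\<lambda>v. c v = cls (a v) (b v)) (eucl_nhds n u)"
    unfolding lplot_A by blast
  have \<kappa>a: "lplot X n u (\<lambda>v. \<kappa> (a v))" by (rule smooth_map_lplot[OF proj_smooth a])
  have au: "\<kappa> (a u) \<in> U"
    using c(2) eventually_nhdsin_self[OF ab lplot_topspace[OF a]] lplot_pts[OF E a] by (simp add: A_proj_cls)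
  have ev: "eventually (\<lambda>v. \<kappa> (a v) \<in> U) (eucl_nhds n u)"
    by (rule eventually_plot_in_D_open[OF X s(1) \<kappa>a au])
  let ?g = "\<lambda>v. quot (\<sigma> (\<kappa> (a v))) (a v)"
  have g: "lplot DG n u ?g"
    by (rule lplot_quot[OF s(4)[OF \<kappa>a au] a]) (use ev in \<open>eventually_elim, simp add: s(3)\<close>)
  have "lplot F n u (\<lambda>v. \<psi> (inv (?g v)) (b v))" by (intro F.act_lplot lplot_inv g b)
  moreover have "eventually (\<lambda>v. c v = cls (\<sigma> (A_proj (c v))) (\<psi> (inv (?g v)) (b v))) (eucl_nhds n u)"
    using ev ab lplot_eventually_pts[OF E a] lplot_eventually_pts[OF F.E b]
  proof eventually_elim
    case (elim v)
    have "cls (a v) (b v) = cls (\<phi> (?g v) (\<sigma> (\<kappa> (a v)))) (b v)"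
      using elim s by (simp add: quot)
    also have "\<dots> = cls (\<sigma> (\<kappa> (a v))) (\<psi> (inv (?g v)) (b v))"
      using elim s by (intro cls_act_inv) (auto simp: quot)
    finally show ?case using elim s(2,3) by (simp add: A_proj_cls)
  qed
  ultimately show "\<exists>b. lplot F n u b \<and>
      eventually (\<lambda>v. c v = cls (\<sigma> (A_proj (c v))) (b v)) (eucl_nhds n u)" by blast
qed

lemma locally_trivial_A: assumes "locally_sectioned P \<kappa> X" shows "locally_trivial A A_proj X F"
  unfolding locally_trivial_iff[OF diffeological_A X F.E]
proof (intro conjI ballI A_proj_smooth)
  fix x assume "x \<in> pts X"
  then obtain U \<sigma> where U: "x \<in> U" and \<sigma>: "smooth_section P \<kappa> X U \<sigma>"
    using assms unfolding locally_sectioned_def by blast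
  from trivialises_A[OF \<sigma>] smooth_sectionD(1)[OF \<sigma>] U
  show "\<exists>U \<Psi>. openin (D_topology X) U \<and> x \<in> U \<and> trivialises A A_proj X F U \<Psi>" by blast
qed

end

text \<open>The class of \<open>(e, y)\<close> goes to \<open>\<mu> e\<close> together with the
  class of \<open>(\<Theta> e, y)\<close>. Injectivity comes from freeness on \<open>P\<close>,
  lifting of germs from smooth division in \<open>P\<close>. Applied to models over the same base,
  to pullbacks, to homotopies and to classifying maps.\<close>

lemma associated_pullback_iso:
  assumes aP: "associated G DG P \<phi> \<kappa> X F \<psi>" and tQ: "torsor G DG Q \<omega> \<mu> Y"
    and \<Theta>: "smooth_map Q P \<Theta>" and cover: "\<And>e. e \<in> pts Q \<Longrightarrow> \<kappa> (\<Theta> e) = f (\<mu> e)"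
    and equiv: "\<And>g e. g \<in> carrier G \<Longrightarrow> e \<in> pts Q \<Longrightarrow> \<Theta> (\<omega> g e) = \<phi> g (\<Theta> e)"
  shows "bundle_iso (associated_space G Q \<omega> F \<psi>) (associated_proj \<mu>)
    (pullback_space Y f (associated_space G P \<phi> F \<psi>) (associated_proj \<kappa>)) fst"
proof -
  interpret P: associated G DG P \<phi> \<kappa> X F \<psi> by (rule aP)
  interpret Q: torsor G DG Q \<omega> \<mu> Y by (rule tQ)
  interpret Q: associated G DG Q \<omega> \<mu> Y F \<psi> by unfold_locales
  note pb = diffeological_pullback[OF Q.X P.diffeological_A, of f P.A_proj]
  \<comment> \<open>The image of the whole orbit is taken, so no representative is chosen;
    equivariance makes it the orbit of \<open>(\<Theta> e, y)\<close>.\<close>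
  let ?h = "\<lambda>c. (Q.A_proj c, map_prod \<Theta> id ` c)"
  have h: "?h (Q.cls e y) = (\<mu> e, P.cls (\<Theta> e) y)" if "e \<in> pts Q" for e y
  proof -
    have "map_prod \<Theta> id ` Q.cls e y = {(\<Theta> (\<omega> g e), \<psi> g y) |g. g \<in> carrier G}"
      by (auto simp: Q.cls_def image_def)
    also have "\<dots> = P.cls (\<Theta> e) y" using equiv[OF _ that] by (auto simp: P.cls_def) metis
    finally show ?thesis using that by (simp add: Q.A_proj_cls)
  qed
  note \<Theta>p = smooth_map_pts[OF \<Theta>]
  have "diffeomorphism Q.A (pullback_space Y f P.A P.A_proj) ?h"
  proof (rule diffeomorphism_by_lifting[OF Q.diffeological_A pb])
    show "smooth_map Q.A (pullback_space Y f P.A P.A_proj) ?h"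
    proof (rule smooth_mapI[OF Q.diffeological_A pb])
      show "?h c \<in> pts (pullback_space Y f P.A P.A_proj)" if "c \<in> pts Q.A" for c
        using that
        by (rule Q.A_E) (use \<Theta>p cover P.cls_in_A P.A_proj_cls smooth_map_pts[OF Q.proj_smooth] h in
          \<open>auto simp: pts_pullback_space\<close>)
      fix n u c assume "lplot Q.A n u c"
      then obtain a b where a: "lplot Q n u a" and b: "lplot F n u b"
        and c: "eventually (\<lambda>v. c v = Q.cls (a v) (b v)) (eucl_nhds n u)"
        unfolding Q.lplot_A by blast
      have eva: "eventually (\<lambda>v. a v \<in> pts Q) (eucl_nhds n u)" by (rule lplot_eventually_pts[OF Q.E a])
      have "eventually (\<lambda>v. f (\<mu> (a v)) = P.A_proj (P.cls (\<Theta> (a v)) (b v))) (eucl_nhds n u)"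
        using eva by eventually_elim (simp add: P.A_proj_cls \<Theta>p cover)
      then have l: "lplot (pullback_space Y f P.A P.A_proj) n u (\<lambda>v. (\<mu> (a v), P.cls (\<Theta> (a v)) (b v)))"
        using smooth_map_lplot[OF Q.proj_smooth a] P.lplot_cls[OF smooth_map_lplot[OF \<Theta> a] b]
        by (simp add: lplot_pullback[OF Q.X P.diffeological_A])
      show "lplot (pullback_space Y f P.A P.A_proj) n u (\<lambda>v. ?h (c v))"
        by (rule lplot_cong[OF pb l]) (use eva c in \<open>eventually_elim, use h in simp\<close>)
    qed
    show "inj_on ?h (pts Q.A)"
    proof (rule inj_onI)
      fix c c' assume c: "c \<in> pts Q.A" and c': "c' \<in> pts Q.A" and eq: "?h c = ?h c'"
      obtain e y where e: "e \<in> pts Q" "y \<in> pts F" "c = Q.cls e y" using c by (rule Q.A_E)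
      obtain e' y' where e': "e' \<in> pts Q" "y' \<in> pts F" "c' = Q.cls e' y'" using c' by (rule Q.A_E)
      have "(\<mu> e, P.cls (\<Theta> e) y) = (\<mu> e', P.cls (\<Theta> e') y')" using eq h e e' by simp
      then have \<mu>: "\<mu> e = \<mu> e'" and cl: "P.cls (\<Theta> e) y = P.cls (\<Theta> e') y'" by auto
      obtain g where g: "g \<in> carrier G" "\<Theta> e' = \<phi> g (\<Theta> e)" "y' = \<psi> g y"
        using P.cls_eqE[OF cl \<Theta>p[OF e(1)] e(2) \<Theta>p[OF e'(1)] e'(2)] by blast
      note k = Q.quot[OF e(1) e'(1) \<mu>]
      \<comment> \<open>\<open>quot e e'\<close> and \<open>g\<close> move \<open>\<Theta> e\<close>
        to the same point, so freeness on \<open>P\<close> identifies them and \<open>g\<close>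
        already relates \<open>e\<close> to \<open>e'\<close>.\<close>
      have "\<phi> (Q.quot e e') (\<Theta> e) = \<phi> g (\<Theta> e)" using equiv[OF k(1) e(1)] k(2) g(2) by simp
      then have "Q.quot e e' = g" using P.act_free[OF \<Theta>p[OF e(1)] k(1) g(1)] by simp
      then have "e' = \<omega> g e" using k(2) by simp
      then show "c = c'" using Q.cls_act[OF e(1,2) g(1)] g(3) e(3) e'(3) by simp
    qed
    fix n u c assume c: "lplot (pullback_space Y f P.A P.A_proj) n u c"
    note c' = c[unfolded lplot_pullback[OF Q.X P.diffeological_A]]
    obtain a b where a: "lplot P n u a" and b: "lplot F n u b"
      and ab: "eventually (\<lambda>v. snd (c v) = P.cls (a v) (b v)) (eucl_nhds n u)"
      using c' unfolding P.lplot_A by blast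
    obtain q where q: "lplot Q n u q" and \<mu>q: "eventually (\<lambda>v. \<mu> (q v) = fst (c v)) (eucl_nhds n u)"
      using Q.lift c' by blast
    have ev: "eventually (\<lambda>v. \<kappa> (\<Theta> (q v)) = \<kappa> (a v)) (eucl_nhds n u)"
      using ab \<mu>q c'[THEN conjunct2, THEN conjunct2] lplot_eventually_pts[OF Q.E q] lplot_eventually_pts[OF P.E a]
      by eventually_elim (simp add: cover P.A_proj_cls)
    \<comment> \<open>The lift \<open>q\<close> of the base germ puts \<open>\<Theta> q\<close> into
      the fibre of \<open>a\<close>; the smooth difference of the two is then shifted to the
      \<open>F\<close> component.\<close>
    let ?g = "\<lambda>v. P.quot (\<Theta> (q v)) (a v)"
    have g: "lplot DG n u ?g" by (rule P.lplot_quot[OF smooth_map_lplot[OF \<Theta> q] a ev])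
    have "lplot Q.A n u (\<lambda>v. Q.cls (q v) (\<psi> (inv\<^bsub>G\<^esub> ?g v) (b v)))"
      by (intro Q.lplot_cls P.F.act_lplot P.lplot_inv g b q)
    moreover have "eventually (\<lambda>v. ?h (Q.cls (q v) (\<psi> (inv\<^bsub>G\<^esub> ?g v) (b v))) = c v) (eucl_nhds n u)"
      using ev ab \<mu>q lplot_eventually_pts[OF Q.E q] lplot_eventually_pts[OF P.E a]
        lplot_eventually_pts[OF P.F.E b]
    proof eventually_elim
      case (elim v)
      note k = P.quot[OF \<Theta>p[OF elim(4)] elim(5) elim(1)]
      have "P.cls (\<Theta> (q v)) (\<psi> (inv\<^bsub>G\<^esub> ?g v) (b v)) = P.cls (a v) (b v)"
        using P.cls_act_inv[OF \<Theta>p[OF elim(4)] elim(6) k(1)] k(2) by simp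
      then show ?case using h[OF elim(4)] elim(2,3) by (simp add: prod_eq_iff)
    qed
    ultimately show "\<exists>p. lplot Q.A n u p \<and> eventually (\<lambda>v. ?h (p v) = c v) (eucl_nhds n u)"
      by (intro exI[of _ "\<lambda>v. Q.cls (q v) (\<psi> (inv\<^bsub>G\<^esub> ?g v) (b v))"] conjI)
  qed
  moreover have "\<forall>e\<in>pts Q.A. fst (?h e) = Q.A_proj e" by simp
  ultimately show ?thesis unfolding bundle_iso_def by blast
qed

lemma bundle_iso_pullback_id:
  assumes E: "diffeological_space E" and X: "diffeological_space X" and \<pi>: "smooth_map E X \<pi>"
    and f: "\<And>x. x \<in> pts X \<Longrightarrow> f x = x"
  shows "bundle_iso (pullback_space X f E \<pi>) fst E \<pi>"
proof -
  note P = diffeological_pullback[OF X E, of f \<pi>]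
  have "smooth_map (pullback_space X f E \<pi>) E snd"
    by (rule smooth_mapI[OF P E]) (auto simp: pts_pullback_space lplot_pullback[OF X E])
  moreover have "smooth_map E (pullback_space X f E \<pi>) (\<lambda>e. (\<pi> e, e))"
  proof (rule smooth_mapI[OF E P])
    fix n u p assume p: "lplot E n u p"
    have "eventually (\<lambda>v. f (\<pi> (p v)) = \<pi> (p v)) (eucl_nhds n u)"
      using lplot_eventually_pts[OF E p] by eventually_elim (simp add: f smooth_map_pts[OF \<pi>])
    then show "lplot (pullback_space X f E \<pi>) n u (\<lambda>v. (\<pi> (p v), p v))"
      using p smooth_map_lplot[OF \<pi> p] by (simp add: lplot_pullback[OF X E])
  qed (use smooth_map_pts[OF \<pi>] f in \<open>auto simp: pts_pullback_space\<close>)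
  ultimately show ?thesis
    unfolding bundle_iso_iff[OF P E]
    by (intro exI[of _ snd] exI[of _ "\<lambda>e. (\<pi> e, e)"]) (auto simp: pts_pullback_space f)
qed

text \<open>The diffeology induced along \<open>\<beta>\<close>. With a bijection
  \<open>\<beta>\<close> it moves total spaces into the types \<open>'x \<times> 'g\<close> and
  \<open>'x \<times> 'f\<close> in which the statement looks for them.\<close>

definition transported :: "'a diffspace \<Rightarrow> 'b set \<Rightarrow> ('b \<Rightarrow> 'a) \<Rightarrow> 'b diffspace" where
  "transported D S \<beta> = \<lparr>pts = S, plots = \<lambda>n U p. plots D n U (\<lambda>v. \<beta> (p v)) \<and> p \<in> U \<rightarrow> S\<rparr>"

lemma pts_transported [simp]: "pts (transported D S \<beta>) = S"
  by (simp add: transported_def)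

lemma diffeological_transported:
  assumes D: "diffeological_space D" and \<beta>: "\<And>s. s \<in> S \<Longrightarrow> \<beta> s \<in> pts D"
  shows "diffeological_space (transported D S \<beta>)"
proof (rule diffeological_spaceI)
  fix n U p
  assume U: "openin (Euclidean_space n) U"
    and loc: "\<And>u. u \<in> U \<Longrightarrow> \<exists>V q. openin (Euclidean_space n) V \<and> u \<in> V \<and> V \<subseteq> U \<and>
      plots (transported D S \<beta>) n V q \<and> (\<forall>v\<in>V. p v = q v)"
  have "plots D n U (\<lambda>v. \<beta> (p v))"
  proof (rule plots_local[OF D U])
    fix u assume "u \<in> U"
    then obtain V q where "openin (Euclidean_space n) V" "u \<in> V" "V \<subseteq> U" "plots D n V (\<lambda>v. \<beta> (q v))"
      "\<forall>v\<in>V. p v = q v"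
      using loc[of u] by (auto simp: transported_def)
    then show "\<exists>V q. openin (Euclidean_space n) V \<and> u \<in> V \<and> V \<subseteq> U \<and> plots D n V q \<and> (\<forall>v\<in>V. \<beta> (p v) = q v)"
      by (intro exI[of _ V] exI[of _ "\<lambda>v. \<beta> (q v)"]) auto
  qed
  moreover have "p \<in> U \<rightarrow> S"
  proof
    fix u assume "u \<in> U"
    then obtain V q where "u \<in> V" "q \<in> V \<rightarrow> S" "\<forall>v\<in>V. p v = q v"
      using loc[of u] by (auto simp: transported_def)
    then show "p u \<in> S" by auto
  qed
  ultimately show "plots (transported D S \<beta>) n U p" by (simp add: transported_def)
next
  fix n U p m V f
  assume "plots (transported D S \<beta>) n U p" "openin (Euclidean_space m) V" "smooth_eucl m V n U f"
  then show "plots (transported D S \<beta>) m V (\<lambda>v. p (f v))"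
    using plots_compose[OF D, of n U "\<lambda>v. \<beta> (p v)" m V f] by (auto simp: transported_def smooth_eucl_def)
qed (use plots_open[OF D] plots_const[OF D] \<beta> in \<open>auto simp: transported_def\<close>)

lemma lplot_transported:
  assumes D: "diffeological_space D"
  shows "lplot (transported D S \<beta>) n u p \<longleftrightarrow>
    lplot D n u (\<lambda>v. \<beta> (p v)) \<and> eventually (\<lambda>v. p v \<in> S) (eucl_nhds n u)"
proof
  assume "lplot (transported D S \<beta>) n u p"
  then obtain V where "openin (Euclidean_space n) V" "u \<in> V" "plots D n V (\<lambda>v. \<beta> (p v))" "p \<in> V \<rightarrow> S"
    by (auto simp: lplot_def transported_def)
  then show "lplot D n u (\<lambda>v. \<beta> (p v)) \<and> eventually (\<lambda>v. p v \<in> S) (eucl_nhds n u)"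
    by (auto simp: lplot_def eventually_nhdsin)
next
  assume *: "lplot D n u (\<lambda>v. \<beta> (p v)) \<and> eventually (\<lambda>v. p v \<in> S) (eucl_nhds n u)"
  then obtain V where V: "openin (Euclidean_space n) V" "u \<in> V" "plots D n V (\<lambda>v. \<beta> (p v))"
    unfolding lplot_def by blast
  obtain W where W: "openin (Euclidean_space n) W" "u \<in> W" "\<forall>v\<in>W. p v \<in> S"
    using conjunct2[OF *] lplot_topspace[OF conjunct1[OF *]] by (auto simp: eventually_nhdsin)
  have o: "openin (Euclidean_space n) (V \<inter> W)" using V W by blast
  then have "plots (transported D S \<beta>) n (V \<inter> W) p"
    using plots_subset[OF D V(3) o] W by (auto simp: transported_def)
  with o V W show "lplot (transported D S \<beta>) n u p" unfolding lplot_def by blast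
qed

lemma transported_smooth:
  assumes D: "diffeological_space D" and \<beta>: "bij_betw \<beta> S (pts D)"
  shows "smooth_map (transported D S \<beta>) D \<beta>" "smooth_map D (transported D S \<beta>) (inv_into S \<beta>)"
proof -
  have \<beta>p: "\<beta> s \<in> pts D" if "s \<in> S" for s using \<beta> that by (auto simp: bij_betw_def)
  have \<beta>i: "inv_into S \<beta> x \<in> S" "\<beta> (inv_into S \<beta> x) = x" if "x \<in> pts D" for x
    using \<beta> that by (auto simp: bij_betw_def inv_into_into f_inv_into_f)
  have T: "diffeological_space (transported D S \<beta>)" by (rule diffeological_transported[OF D \<beta>p])
  show "smooth_map (transported D S \<beta>) D \<beta>"
    by (rule smooth_mapI[OF T D]) (auto simp: \<beta>p lplot_transported[OF D])
  show "smooth_map D (transported D S \<beta>) (inv_into S \<beta>)"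
  proof (rule smooth_mapI[OF D T])
    fix n u p assume p: "lplot D n u p"
    have ev: "eventually (\<lambda>v. \<beta> (inv_into S \<beta> (p v)) = p v \<and> inv_into S \<beta> (p v) \<in> S) (eucl_nhds n u)"
      using lplot_eventually_pts[OF D p] by eventually_elim (simp add: \<beta>i)
    have "lplot D n u (\<lambda>v. \<beta> (inv_into S \<beta> (p v)))"
      by (rule lplot_cong[OF D p]) (use ev in \<open>eventually_elim, simp\<close>)
    then show "lplot (transported D S \<beta>) n u (\<lambda>v. inv_into S \<beta> (p v))"
      using ev by (auto simp: lplot_transported[OF D] elim: eventually_mono)
  qed (auto simp: \<beta>i)
qed

lemma bundle_iso_transported:
  assumes D: "diffeological_space D" and \<beta>: "bij_betw \<beta> S (pts D)"
  shows "bundle_iso (transported D S \<beta>) (\<lambda>s. \<pi> (\<beta> s)) D \<pi>"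
proof -
  have \<beta>p: "\<beta> s \<in> pts D" if "s \<in> S" for s using \<beta> that by (auto simp: bij_betw_def)
  have T: "diffeological_space (transported D S \<beta>)" by (rule diffeological_transported[OF D \<beta>p])
  show ?thesis
    unfolding bundle_iso_iff[OF T D]
    using transported_smooth[OF D \<beta>] \<beta>
    by (intro exI[of _ \<beta>] exI[of _ "inv_into S \<beta>"])
      (auto simp: bij_betw_inv_into_left bij_betw_inv_into_right)
qed

context torsor
begin

text \<open>Division of two points over the same \<open>y\<close> is division of their second
  components in \<open>P\<close>, and base germs lift after composition with
  \<open>f\<close>.\<close>

lemma torsor_pullback:
  assumes Y: "diffeological_space Y" and f: "smooth_map Y X f"
  shows "torsor G DG (pullback_space Y f P \<kappa>) (\<lambda>g z. (fst z, \<phi> g (snd z))) fst Y"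
proof -
  note P' = diffeological_pullback[OF Y E, of f \<kappa>]
  note lp = lplot_pullback[OF Y E, of f \<kappa>]
  show ?thesis
  proof
    fix n u a p assume a: "lplot DG n u a" and p: "lplot (pullback_space Y f P \<kappa>) n u p"
    have "eventually (\<lambda>v. f (fst (p v)) = \<kappa> (\<phi> (a v) (snd (p v)))) (eucl_nhds n u)"
      using lplot_eventually_pts[OF P' p] lplot_DG_eventually[OF a]
      by eventually_elim (simp add: proj_act pts_pullback_space)
    then show "lplot (pullback_space Y f P \<kappa>) n u (\<lambda>v. (fst (p v), \<phi> (a v) (snd (p v))))"
      using p a act_lplot by (simp add: lp)
  next
    show "smooth_map (pullback_space Y f P \<kappa>) Y fst"
      by (rule smooth_mapI[OF P' Y]) (auto simp: pts_pullback_space lp)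
  next
    fix e e' assume "e \<in> pts (pullback_space Y f P \<kappa>)" "e' \<in> pts (pullback_space Y f P \<kappa>)" "fst e = fst e'"
    then show "\<exists>!g. g \<in> carrier G \<and> (fst e, \<phi> g (snd e)) = e'"
      using translation[of "snd e" "snd e'"] by (auto simp: pts_pullback_space prod_eq_iff)
  next
    fix n u a assume a: "lplot Y n u a"
    obtain q where q: "lplot P n u q" "eventually (\<lambda>v. \<kappa> (q v) = f (a v)) (eucl_nhds n u)"
      using lift[OF smooth_map_lplot[OF f a]] by blast
    have "eventually (\<lambda>v. f (a v) = \<kappa> (q v)) (eucl_nhds n u)" using q(2) by eventually_elim simp
    then show "\<exists>q. lplot (pullback_space Y f P \<kappa>) n u q \<and> eventually (\<lambda>v. fst (q v) = a v) (eucl_nhds n u)"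
      using q a by (intro exI[of _ "\<lambda>v. (a v, q v)"]) (simp add: lp)
  next
    fix n u p q assume p: "lplot (pullback_space Y f P \<kappa>) n u p" and q: "lplot (pullback_space Y f P \<kappa>) n u q"
      and eq: "eventually (\<lambda>v. fst (p v) = fst (q v)) (eucl_nhds n u)"
    have "eventually (\<lambda>v. \<kappa> (snd (p v)) = \<kappa> (snd (q v))) (eucl_nhds n u)"
      using lplot_eventually_pts[OF P' p] lplot_eventually_pts[OF P' q] eq
      by eventually_elim (auto simp: pts_pullback_space)
    then have l: "lplot DG n u (\<lambda>v. quot (snd (p v)) (snd (q v)))"
      using p q by (intro lplot_quot) (auto simp: lp)
    show "lplot DG n u (\<lambda>v. THE g. g \<in> carrier G \<and> (fst (p v), \<phi> g (snd (p v))) = q v)"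
      by (rule lplot_cong[OF DG l])
        (use eq in \<open>eventually_elim, simp add: quot_def prod_eq_iff\<close>)
  qed (use P' Y in \<open>auto simp: pts_pullback_space act_closed act_one act_mult proj_act\<close>)
qed

lemma locally_sectioned_pullback:
  assumes Y: "diffeological_space Y" and f: "smooth_map Y X f" and ls: "locally_sectioned P \<kappa> X"
  shows "locally_sectioned (pullback_space Y f P \<kappa>) fst Y"
  unfolding locally_sectioned_def
proof
  fix y assume y: "y \<in> pts Y"
  obtain U \<sigma> where U: "f y \<in> U" and \<sigma>: "smooth_section P \<kappa> X U \<sigma>"
    using ls smooth_map_pts[OF f y] unfolding locally_sectioned_def by blast
  note s = smooth_sectionD[OF \<sigma>]
  have V: "openin (D_topology Y) {y \<in> pts Y. f y \<in> U}" by (rule openin_D_preimage[OF Y X f s(1)])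
  have "lplot (pullback_space Y f P \<kappa>) n u (\<lambda>v. (a v, \<sigma> (f (a v))))"
    if a: "lplot Y n u a" "a u \<in> {y \<in> pts Y. f y \<in> U}" for n u a
  proof -
    have "eventually (\<lambda>v. f (a v) = \<kappa> (\<sigma> (f (a v)))) (eucl_nhds n u)"
      using eventually_plot_in_D_open[OF Y V a] by eventually_elim (simp add: s(3))
    then show ?thesis
      using a s(4)[OF smooth_map_lplot[OF f a(1)]] by (simp add: lplot_pullback[OF Y E])
  qed
  then have "smooth_section (pullback_space Y f P \<kappa>) fst Y {y \<in> pts Y. f y \<in> U} (\<lambda>y. (y, \<sigma> (f y)))"
    using V s by (auto simp: smooth_section_def pts_pullback_space)
  then show "\<exists>U \<sigma>. y \<in> U \<and> smooth_section (pullback_space Y f P \<kappa>) fst Y U \<sigma>"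
    using y U by (intro exI[of _ "{y \<in> pts Y. f y \<in> U}"] exI[of _ "\<lambda>y. (y, \<sigma> (f y))"]) simp
qed

text \<open>The transported action is restricted to \<open>S\<close> so that it is extensional and
  can serve as the \<open>smooth_action\<close> of a \<open>principal_bundle\<close>.\<close>

lemma torsor_transported:
  assumes \<beta>: "bij_betw \<beta> S (pts P)"
  defines "\<omega> \<equiv> \<lambda>g. restrict (\<lambda>s. inv_into S \<beta> (\<phi> g (\<beta> s))) S"
  shows "torsor G DG (transported P S \<beta>) \<omega> (\<lambda>s. \<kappa> (\<beta> s)) X"
    and "locally_sectioned P \<kappa> X \<Longrightarrow> locally_sectioned (transported P S \<beta>) (\<lambda>s. \<kappa> (\<beta> s)) X"
    and "s \<in> S \<Longrightarrow> g \<in> carrier G \<Longrightarrow> \<beta> (\<omega> g s) = \<phi> g (\<beta> s)"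
proof -
  have \<beta>p: "\<beta> s \<in> pts P" if "s \<in> S" for s using \<beta> that by (auto simp: bij_betw_def)
  have \<beta>i: "inv_into S \<beta> x \<in> S" "\<beta> (inv_into S \<beta> x) = x" if "x \<in> pts P" for x
    using \<beta> that by (auto simp: bij_betw_def inv_into_into f_inv_into_f)
  have \<beta>eq: "s = s' \<longleftrightarrow> \<beta> s = \<beta> s'" if "s \<in> S" "s' \<in> S" for s s'
    using \<beta> that by (auto simp: bij_betw_def dest: inj_onD)
  have T: "diffeological_space (transported P S \<beta>)" by (rule diffeological_transported[OF E \<beta>p])
  note lp = lplot_transported[OF E, of S \<beta>]
  note sm = transported_smooth[OF E \<beta>]
  have \<omega>: "\<omega> g s \<in> S" "\<beta> (\<omega> g s) = \<phi> g (\<beta> s)" if "s \<in> S" "g \<in> carrier G" for s g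
    using \<beta>i[OF act_closed[OF that(2) \<beta>p[OF that(1)]]] that by (simp_all add: \<omega>_def)
  show "\<beta> (\<omega> g s) = \<phi> g (\<beta> s)" if "s \<in> S" "g \<in> carrier G" for s g using \<omega>(2)[OF that] .
  show "torsor G DG (transported P S \<beta>) \<omega> (\<lambda>s. \<kappa> (\<beta> s)) X"
  proof
    show "\<omega> (g \<otimes> h) e = \<omega> g (\<omega> h e)"
      if "g \<in> carrier G" "h \<in> carrier G" "e \<in> pts (transported P S \<beta>)" for g h e
      using that \<beta>eq \<omega> act_mult \<beta>p by simp
    show "\<omega> \<one> e = e" if "e \<in> pts (transported P S \<beta>)" for e
      using that \<beta>eq \<omega> act_one \<beta>p by simp
    fix n u a p assume a: "lplot DG n u a" and p: "lplot (transported P S \<beta>) n u p"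
    have ev: "eventually (\<lambda>v. \<omega> (a v) (p v) \<in> S \<and> \<beta> (\<omega> (a v) (p v)) = \<phi> (a v) (\<beta> (p v))) (eucl_nhds n u)"
      using lplot_eventually_pts[OF T p] lplot_DG_eventually[OF a] by eventually_elim (simp add: \<omega>)
    have "lplot P n u (\<lambda>v. \<phi> (a v) (\<beta> (p v)))" using a p act_lplot by (simp add: lp)
    then have "lplot P n u (\<lambda>v. \<beta> (\<omega> (a v) (p v)))"
      by (rule lplot_cong[OF E]) (use ev in \<open>eventually_elim, simp\<close>)
    then show "lplot (transported P S \<beta>) n u (\<lambda>v. \<omega> (a v) (p v))"
      using ev by (auto simp: lp elim: eventually_mono)
  next
    show "smooth_map (transported P S \<beta>) X (\<lambda>s. \<kappa> (\<beta> s))"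
      by (rule smooth_map_comp[OF sm(1) proj_smooth])
  next
    fix e e' assume e: "e \<in> pts (transported P S \<beta>)" "e' \<in> pts (transported P S \<beta>)" "\<kappa> (\<beta> e) = \<kappa> (\<beta> e')"
    have "(g \<in> carrier G \<and> \<omega> g e = e') \<longleftrightarrow> (g \<in> carrier G \<and> \<phi> g (\<beta> e) = \<beta> e')" for g
      using e \<omega>[of e g] \<beta>eq[of "\<omega> g e" e'] by auto
    then show "\<exists>!g. g \<in> carrier G \<and> \<omega> g e = e'"
      using translation[of "\<beta> e" "\<beta> e'"] e \<beta>p by simp
  next
    fix n u a assume "lplot X n u a"
    then obtain q where q: "lplot P n u q" "eventually (\<lambda>v. \<kappa> (q v) = a v) (eucl_nhds n u)"
      using lift by blast
    have "eventually (\<lambda>v. \<kappa> (\<beta> (inv_into S \<beta> (q v))) = a v) (eucl_nhds n u)"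
      using q(2) lplot_eventually_pts[OF E q(1)] by eventually_elim (simp add: \<beta>i)
    then show "\<exists>q. lplot (transported P S \<beta>) n u q \<and> eventually (\<lambda>v. \<kappa> (\<beta> (q v)) = a v) (eucl_nhds n u)"
      using smooth_map_lplot[OF sm(2) q(1)] by (intro exI[of _ "\<lambda>v. inv_into S \<beta> (q v)"] conjI)
  next
    fix n u p q assume p: "lplot (transported P S \<beta>) n u p" and q: "lplot (transported P S \<beta>) n u q"
      and eq: "eventually (\<lambda>v. \<kappa> (\<beta> (p v)) = \<kappa> (\<beta> (q v))) (eucl_nhds n u)"
    have l: "lplot DG n u (\<lambda>v. quot (\<beta> (p v)) (\<beta> (q v)))"
      using p q eq by (intro lplot_quot) (auto simp: lp)
    show "lplot DG n u (\<lambda>v. THE g. g \<in> carrier G \<and> \<omega> g (p v) = q v)"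
    proof (rule lplot_cong[OF DG l])
      show "eventually (\<lambda>v. (THE g. g \<in> carrier G \<and> \<omega> g (p v) = q v) = quot (\<beta> (p v)) (\<beta> (q v)))
          (eucl_nhds n u)"
        using lplot_eventually_pts[OF T p] lplot_eventually_pts[OF T q]
      proof eventually_elim
        case (elim v)
        have "(g \<in> carrier G \<and> \<omega> g (p v) = q v) \<longleftrightarrow> (g \<in> carrier G \<and> \<phi> g (\<beta> (p v)) = \<beta> (q v))" for g
          using elim \<omega>[of "p v" g] \<beta>eq[of "\<omega> g (p v)" "q v"] by auto
        then show ?case by (simp add: quot_def)
      qed
    qed
  qed (use T X \<omega> \<beta>p proj_act in auto)
  assume ls: "locally_sectioned P \<kappa> X"
  show "locally_sectioned (transported P S \<beta>) (\<lambda>s. \<kappa> (\<beta> s)) X"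
    unfolding locally_sectioned_def
  proof
    fix x assume "x \<in> pts X"
    then obtain U \<sigma> where U: "x \<in> U" and \<sigma>: "smooth_section P \<kappa> X U \<sigma>"
      using ls unfolding locally_sectioned_def by blast
    note s = smooth_sectionD[OF \<sigma>]
    have "smooth_section (transported P S \<beta>) (\<lambda>s. \<kappa> (\<beta> s)) X U (\<lambda>x. inv_into S \<beta> (\<sigma> x))"
      using s smooth_map_lplot[OF sm(2)] by (auto simp: smooth_section_def \<beta>i)
    with U show "\<exists>U \<sigma>. x \<in> U \<and> smooth_section (transported P S \<beta>) (\<lambda>s. \<kappa> (\<beta> s)) X U \<sigma>" by blast
  qed
qed

text \<open>A point \<open>s x\<close> is chosen in every fibre, without any continuity;
  \<open>(x, g) \<mapsto> \<phi> g (s x)\<close> is then a bijection from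
  \<open>pts X \<times> carrier G\<close>, along which everything is transported.\<close>

lemma principal_model:
  assumes ls: "locally_sectioned P \<kappa> X"
  obtains Q :: "('x \<times> 'g) diffspace" and \<omega> \<mu> \<Theta>
  where "torsor G DG Q \<omega> \<mu> X" "principal_bundle G DG Q \<mu> X \<omega>" "locally_trivial Q \<mu> X DG"
    "smooth_map Q P \<Theta>" "\<forall>e\<in>pts Q. \<kappa> (\<Theta> e) = \<mu> e"
    "\<forall>g\<in>carrier G. \<forall>e\<in>pts Q. \<Theta> (\<omega> g e) = \<phi> g (\<Theta> e)"
proof -
  have "\<exists>e. e \<in> pts P \<and> \<kappa> e = x" if "x \<in> pts X" for x
    using proj_surj[OF that] by blast
  then obtain s where s: "\<And>x. x \<in> pts X \<Longrightarrow> s x \<in> pts P \<and> \<kappa> (s x) = x" by metis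
  let ?S = "pts X \<times> carrier G" and ?\<beta> = "\<lambda>z. \<phi> (snd z) (s (fst z))"
  have \<beta>: "bij_betw ?\<beta> ?S (pts P)"
    unfolding bij_betw_def
  proof
    show "inj_on ?\<beta> ?S"
    proof (rule inj_onI)
      fix z z' assume z: "z \<in> ?S" "z' \<in> ?S" and eq: "?\<beta> z = ?\<beta> z'"
      have "\<kappa> (?\<beta> z) = fst z" "\<kappa> (?\<beta> z') = fst z'" using z s by (auto simp: proj_act)
      then have "fst z = fst z'" using eq by simp
      moreover from this have "snd z = snd z'"
        using eq z s act_free[of "s (fst z)" "snd z" "snd z'"] by auto
      ultimately show "z = z'" by (rule prod_eqI)
    qed
    show "?\<beta> ` ?S = pts P"
    proof
      show "?\<beta> ` ?S \<subseteq> pts P" using s act_closed by auto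
      show "pts P \<subseteq> ?\<beta> ` ?S"
      proof
        fix e assume e: "e \<in> pts P"
        have \<kappa>: "\<kappa> e \<in> pts X" using smooth_map_pts[OF proj_smooth e] .
        have "e = ?\<beta> (\<kappa> e, quot (s (\<kappa> e)) e)" "(\<kappa> e, quot (s (\<kappa> e)) e) \<in> ?S"
          using e s[OF \<kappa>] \<kappa> by (auto simp: quot)
        then show "e \<in> ?\<beta> ` ?S" by (rule image_eqI)
      qed
    qed
  qed
  let ?Q = "transported P ?S ?\<beta>" and ?\<mu> = "\<lambda>z. \<kappa> (?\<beta> z)"
  let ?\<omega> = "\<lambda>g. restrict (\<lambda>z. inv_into ?S ?\<beta> (\<phi> g (?\<beta> z))) ?S"
  interpret Q: torsor G DG ?Q ?\<omega> ?\<mu> X by (rule torsor_transported(1)[OF \<beta>])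
  have lsQ: "locally_sectioned ?Q ?\<mu> X" by (rule torsor_transported(2)[OF \<beta> ls])
  have "smooth_action G DG ?Q ?\<omega>"
    using Q.smooth_action_restrict by (simp only: pts_transported restrict_restrict Int_absorb)
  then have pb: "principal_bundle G DG ?Q ?\<mu> X ?\<omega>" by (rule Q.imp_principal_bundle[OF lsQ])
  have lt: "locally_trivial ?Q ?\<mu> X DG" using lsQ Q.locally_trivial_iff_sectioned by simp
  have eq: "\<forall>g\<in>carrier G. \<forall>e\<in>pts ?Q. ?\<beta> (?\<omega> g e) = \<phi> g (?\<beta> e)"
    by (intro ballI torsor_transported(3)[OF \<beta>]) simp_all
  show thesis
    by (rule that[OF Q.torsor_axioms pb lt transported_smooth(1)[OF E \<beta>] _ eq]) simp
qed

end

text \<open>Both universes are served: the total space by the bijection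
  \<open>(x, y) \<mapsto> cls (s x) y\<close>, the principal bundle by
  \<open>principal_model\<close>. Their compatibility is \<open>associated_pullback_iso\<close> over
  the identity of \<open>X\<close>.\<close>

lemma (in associated) structured_model:
  assumes ls: "locally_sectioned P \<kappa> X"
  shows "\<exists>(B :: ('x \<times> 'f) diffspace) \<pi>. structured_bundle G DG F \<psi> X B \<pi> \<and> bundle_iso B \<pi> A A_proj"
proof -
  have "\<exists>e. e \<in> pts P \<and> \<kappa> e = x" if "x \<in> pts X" for x
    using proj_surj[OF that] by blast
  then obtain s where s: "\<And>x. x \<in> pts X \<Longrightarrow> s x \<in> pts P \<and> \<kappa> (s x) = x" by metis
  let ?S = "pts X \<times> pts F" and ?\<beta> = "\<lambda>z. cls (s (fst z)) (snd z)"
  have \<beta>: "bij_betw ?\<beta> ?S (pts A)"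
    unfolding bij_betw_def
  proof
    show "inj_on ?\<beta> ?S"
    proof (rule inj_onI)
      fix z z' assume z: "z \<in> ?S" "z' \<in> ?S" and eq: "?\<beta> z = ?\<beta> z'"
      have "A_proj (?\<beta> z) = fst z" "A_proj (?\<beta> z') = fst z'" using z s by (auto simp: A_proj_cls)
      then have "fst z = fst z'" using eq by simp
      moreover from this have "snd z = snd z'"
        using eq z s cls_eq_fibreD[of "s (fst z)" "snd z" "snd z'"] by auto
      ultimately show "z = z'" by (rule prod_eqI)
    qed
    show "?\<beta> ` ?S = pts A"
    proof
      show "?\<beta> ` ?S \<subseteq> pts A" using s cls_in_A by auto
      show "pts A \<subseteq> ?\<beta> ` ?S"
      proof
        fix c assume "c \<in> pts A"
        then obtain e y where e: "e \<in> pts P" "y \<in> pts F" "c = cls e y" by (rule A_E)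
        have \<kappa>: "\<kappa> e \<in> pts X" using smooth_map_pts[OF proj_smooth e(1)] .
        let ?g = "quot (s (\<kappa> e)) e"
        have g: "?g \<in> carrier G" "\<phi> ?g (s (\<kappa> e)) = e" using s[OF \<kappa>] e by (simp_all add: quot)
        have "c = ?\<beta> (\<kappa> e, \<psi> (inv ?g) y)"
          using cls_act_inv[OF _ e(2) g(1), of "s (\<kappa> e)"] g e s[OF \<kappa>] by simp
        moreover have "(\<kappa> e, \<psi> (inv ?g) y) \<in> ?S" using \<kappa> g e F.act_closed by simp
        ultimately show "c \<in> ?\<beta> ` ?S" by (rule image_eqI)
      qed
    qed
  qed
  have \<beta>p: "?\<beta> z \<in> pts A" if "z \<in> ?S" for z using that \<beta> by (auto simp: bij_betw_def)
  let ?B = "transported A ?S ?\<beta>" and ?\<pi> = "\<lambda>z. A_proj (?\<beta> z)"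
  have B: "diffeological_space ?B" by (rule diffeological_transported[OF diffeological_A \<beta>p])
  have iso: "bundle_iso ?B ?\<pi> A A_proj" by (rule bundle_iso_transported[OF diffeological_A \<beta>])
  have lt: "locally_trivial ?B ?\<pi> X F"
    by (rule locally_trivial_iso[OF B diffeological_A X F.E iso locally_trivial_A[OF ls]])
  obtain Q :: "('x \<times> 'g) diffspace" and \<omega> \<mu> \<Theta> where Q: "torsor G DG Q \<omega> \<mu> X"
      "principal_bundle G DG Q \<mu> X \<omega>" "locally_trivial Q \<mu> X DG"
    and \<Theta>: "smooth_map Q P \<Theta>" "\<forall>e\<in>pts Q. \<kappa> (\<Theta> e) = \<mu> e"
      "\<forall>g\<in>carrier G. \<forall>e\<in>pts Q. \<Theta> (\<omega> g e) = \<phi> g (\<Theta> e)"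
    by (rule principal_model[OF ls])
  interpret Q: torsor G DG Q \<omega> \<mu> X by (rule Q)
  interpret Q: associated G DG Q \<omega> \<mu> X F \<psi> by unfold_locales
  note pb = diffeological_pullback[OF X diffeological_A, of "\<lambda>x. x" A_proj]
  have 1: "bundle_iso Q.A Q.A_proj (pullback_space X (\<lambda>x. x) A A_proj) fst"
    by (rule associated_pullback_iso[OF associated_axioms Q(1) \<Theta>(1)]) (use \<Theta>(2,3) in auto)
  have 2: "bundle_iso (pullback_space X (\<lambda>x. x) A A_proj) fst A A_proj"
    by (rule bundle_iso_pullback_id[OF diffeological_A X A_proj_smooth]) simp
  have "bundle_iso A A_proj Q.A Q.A_proj"
    by (rule bundle_iso_sym[OF Q.diffeological_A diffeological_A
          bundle_iso_trans[OF Q.diffeological_A pb diffeological_A 1 2]])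
  then have "bundle_iso ?B ?\<pi> Q.A Q.A_proj"
    by (rule bundle_iso_trans[OF B diffeological_A Q.diffeological_A iso])
  then have "structured_bundle G DG F \<psi> X ?B ?\<pi>"
    unfolding structured_bundle_def
    using locally_trivial_imp_fibre_bundle[OF B X F.E lt] lt Q(2,3)
    by (intro conjI exI[of _ Q] exI[of _ \<mu>] exI[of _ \<omega>])
  with iso show ?thesis by blast
qed

section \<open>The Milnor bundle\<close>

context smooth_gspace
begin

lemma orbit_rel_eq_orbit: "e \<in> pts E \<Longrightarrow> orbit_rel G \<phi> (pts E) `` {e} = orbit G \<phi> e"
  by (auto simp: orbit_rel_def)

lemma orbit_act: assumes "e \<in> pts E" "g \<in> carrier G" shows "orbit G \<phi> (\<phi> g e) = orbit G \<phi> e"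
proof
  show "orbit G \<phi> (\<phi> g e) \<subseteq> orbit G \<phi> e"
    using assms by (auto simp: orbit_def act_mult[symmetric])
  show "orbit G \<phi> e \<subseteq> orbit G \<phi> (\<phi> g e)"
  proof
    fix z assume "z \<in> orbit G \<phi> e"
    then obtain h where h: "h \<in> carrier G" "z = \<phi> h e" by (auto simp: orbit_def)
    then have "z = \<phi> (h \<otimes> inv g) (\<phi> g e)"
      using assms act_mult[of "h \<otimes> inv g" g e] by (simp add: m_assoc)
    then show "z \<in> orbit G \<phi> (\<phi> g e)" using h assms by (auto simp: orbit_def)
  qed
qed

lemma orbit_eqE:
  assumes "orbit G \<phi> e = orbit G \<phi> e'" "e' \<in> pts E"
  obtains g where "g \<in> carrier G" "e' = \<phi> g e"
proof -
  have "e' \<in> orbit G \<phi> e'" using assms act_one by (auto simp: orbit_def intro!: exI[of _ \<one>])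
  then show ?thesis using assms(1) that by (auto simp: orbit_def)
qed

lemma diffeological_orbit_space: "diffeological_space (orbit_space G E \<phi>)"
  unfolding orbit_space_def by (rule diffeological_quotient[OF E])

lemma lplot_orbit_space:
  "lplot (orbit_space G E \<phi>) n u c \<longleftrightarrow>
    (\<exists>q. lplot E n u q \<and> eventually (\<lambda>v. c v = orbit G \<phi> (q v)) (eucl_nhds n u))"
proof -
  have "eventually (\<lambda>v. c v = orbit_rel G \<phi> (pts E) `` {q v}) (eucl_nhds n u) \<longleftrightarrow>
      eventually (\<lambda>v. c v = orbit G \<phi> (q v)) (eucl_nhds n u)" if "lplot E n u q" for q
    by (rule eventually_subst)
      (use lplot_eventually_pts[OF E that] in \<open>eventually_elim, simp add: orbit_rel_eq_orbit\<close>)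
  then show ?thesis
    unfolding orbit_space_def lplot_quotient_diff[OF E] by blast
qed

lemma pts_orbit_space: "pts (orbit_space G E \<phi>) = orbit G \<phi> ` pts E"
  by (auto simp: orbit_space_def quotient_diff_def quotient_def orbit_rel_eq_orbit)

text \<open>The quotient diffeology provides the lifts of germs. What has to be supplied is freeness
  and, for two germs in the same orbits, a smooth element relating them, which freeness identifies
  with the \<open>THE\<close> term.\<close>

lemma torsor_orbit_space:
  assumes free: "\<And>e g h. e \<in> pts E \<Longrightarrow> g \<in> carrier G \<Longrightarrow> h \<in> carrier G \<Longrightarrow> \<phi> g e = \<phi> h e \<Longrightarrow> g = h"
    and tr: "\<And>n u p q. lplot E n u p \<Longrightarrow> lplot E n u q \<Longrightarrow>
      eventually (\<lambda>v. \<exists>g\<in>carrier G. q v = \<phi> g (p v)) (eucl_nhds n u) \<Longrightarrow>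
      \<exists>d. lplot DG n u d \<and> eventually (\<lambda>v. q v = \<phi> (d v) (p v)) (eucl_nhds n u)"
  shows "torsor G DG E \<phi> (orbit G \<phi>) (orbit_space G E \<phi>)"
proof
  show "smooth_map E (orbit_space G E \<phi>) (orbit G \<phi>)"
    by (rule smooth_mapI[OF E diffeological_orbit_space])
      (auto simp: pts_orbit_space lplot_orbit_space intro!: exI)
  show "\<exists>q. lplot E n u q \<and> eventually (\<lambda>v. orbit G \<phi> (q v) = a v) (eucl_nhds n u)"
    if "lplot (orbit_space G E \<phi>) n u a" for n u a
    using that unfolding lplot_orbit_space by (auto simp: eq_commute)
  have ex1: "\<exists>!g. g \<in> carrier G \<and> \<phi> g e = e'"
    if "e \<in> pts E" "e' \<in> pts E" "orbit G \<phi> e = orbit G \<phi> e'" for e e'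
    using orbit_eqE[OF that(3,2)] free[OF that(1)] by metis
  then show "\<exists>!g. g \<in> carrier G \<and> \<phi> g e = e'"
    if "e \<in> pts E" "e' \<in> pts E" "orbit G \<phi> e = orbit G \<phi> e'" for e e'
    using that by blast
  fix n u p q assume p: "lplot E n u p" and q: "lplot E n u q"
    and eq: "eventually (\<lambda>v. orbit G \<phi> (p v) = orbit G \<phi> (q v)) (eucl_nhds n u)"
  have "eventually (\<lambda>v. \<exists>g\<in>carrier G. q v = \<phi> g (p v)) (eucl_nhds n u)"
    using eq lplot_eventually_pts[OF E q] by eventually_elim (metis orbit_eqE)
  then obtain d where d: "lplot DG n u d" "eventually (\<lambda>v. q v = \<phi> (d v) (p v)) (eucl_nhds n u)"
    using tr[OF p q] by blast
  have "eventually (\<lambda>v. (THE g. g \<in> carrier G \<and> \<phi> g (p v) = q v) = d v) (eucl_nhds n u)"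
    using d(2) lplot_DG_eventually[OF d(1)] lplot_eventually_pts[OF E p]
    by eventually_elim (auto intro: the_equality free)
  then show "lplot DG n u (\<lambda>v. THE g. g \<in> carrier G \<and> \<phi> g (p v) = q v)"
    by (rule lplot_cong[OF DG d(1)])
qed (auto simp: diffeological_orbit_space orbit_act)

end

section \<open>Points, germs and group action of Milnor's total space\<close>

context smooth_group
begin

abbreviation "SG \<equiv> milnor_S G DG"
abbreviation "EG \<equiv> milnor_E G DG"
abbreviation "BG \<equiv> milnor_B G DG"

text \<open>The point (t_i g_i) of \<open>EG\<close> as its set of representatives; for points of
  \<open>SG\<close> it is the class under \<open>milnor_rel\<close> (see
  \<open>wjoin_rel\<close>).\<close>

definition wjoin :: "(nat \<Rightarrow> real) \<Rightarrow> (nat \<Rightarrow> 'g) \<Rightarrow> ((nat \<Rightarrow> real) \<times> (nat \<Rightarrow> 'g)) set" where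
  "wjoin t g = {(t', g'). t' = t \<and> (\<forall>i. g' i \<in> carrier G) \<and> (\<forall>i. t i \<noteq> 0 \<longrightarrow> g' i = g i)}"

lemma diffeological_SG: "diffeological_space SG"
  unfolding milnor_S_def
  by (intro diffeological_subset diffeological_prod diffeological_seq diffeological_real DG)

lemma pts_SG:
  "(t, g) \<in> pts SG \<longleftrightarrow> (\<forall>i. 0 \<le> t i \<and> t i \<le> 1) \<and> (\<forall>i. g i \<in> carrier G) \<and>
    finite {i. t i \<noteq> 0} \<and> (\<Sum>i | t i \<noteq> 0. t i) = 1"
  by (auto simp: milnor_S_def seq_diff_def pts_DG)

lemma SG_nonzero: assumes "(t, g) \<in> pts SG" obtains j where "t j \<noteq> 0"
proof -
  have "(\<Sum>i | t i \<noteq> 0. t i) \<noteq> 0" using assms by (simp add: pts_SG)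
  then have "{i. t i \<noteq> 0} \<noteq> {}" by (metis sum.empty)
  then show ?thesis using that by blast
qed

lemma wjoin_rel: "(t, g) \<in> pts SG \<Longrightarrow> milnor_rel G DG `` {(t, g)} = wjoin t g"
  by (auto simp: milnor_rel_def wjoin_def pts_SG fun_eq_iff[symmetric])

lemma wjoin_mem: "(t, g) \<in> pts SG \<Longrightarrow> (t, g) \<in> wjoin t g"
  by (auto simp: wjoin_def pts_SG)

lemma wjoin_eq_iff:
  assumes "(t, g) \<in> pts SG" "(t', g') \<in> pts SG"
  shows "wjoin t g = wjoin t' g' \<longleftrightarrow> t = t' \<and> (\<forall>i. t i \<noteq> 0 \<longrightarrow> g i = g' i)"
proof
  assume "wjoin t g = wjoin t' g'"
  then have "(t, g) \<in> wjoin t' g'" using wjoin_mem[OF assms(1)] by simp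
  then show "t = t' \<and> (\<forall>i. t i \<noteq> 0 \<longrightarrow> g i = g' i)" by (auto simp: wjoin_def)
qed (auto simp: wjoin_def)

lemma EG_E:
  assumes "e \<in> pts EG" obtains t g where "(t, g) \<in> pts SG" "e = wjoin t g"
  using assms wjoin_rel
  by (auto simp: milnor_E_def quotient_diff_def elim!: quotientE)

lemma wjoin_in_EG: "(t, g) \<in> pts SG \<Longrightarrow> wjoin t g \<in> pts EG"
  using quotientI[of "(t, g)" "pts SG" "milnor_rel G DG"] wjoin_rel
  by (simp add: milnor_E_def quotient_diff_def)

lemma diffeological_EG: "diffeological_space EG"
  unfolding milnor_E_def by (rule diffeological_quotient[OF diffeological_SG])

lemma lplot_EG:
  "lplot EG n u e \<longleftrightarrow> (\<exists>t g. lplot SG n u (\<lambda>v. (t v, g v)) \<and>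
    eventually (\<lambda>v. e v = wjoin (t v) (g v)) (eucl_nhds n u))" (is "_ \<longleftrightarrow> ?r")
proof -
  have *: "eventually (\<lambda>v. milnor_rel G DG `` {q v} = wjoin (fst (q v)) (snd (q v))) (eucl_nhds n u)"
    if "lplot SG n u q" for q
    using lplot_eventually_pts[OF diffeological_SG that] by eventually_elim (simp add: wjoin_rel[symmetric])
  show ?thesis
  proof
    assume "lplot EG n u e"
    then obtain q where q: "lplot SG n u q"
      "eventually (\<lambda>v. e v = milnor_rel G DG `` {q v}) (eucl_nhds n u)"
      unfolding milnor_E_def lplot_quotient_diff[OF diffeological_SG] by blast
    have "eventually (\<lambda>v. e v = wjoin (fst (q v)) (snd (q v))) (eucl_nhds n u)"
      using q(2) *[OF q(1)] by eventually_elim simp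
    then show ?r
      using q(1) by (intro exI[of _ "\<lambda>v. fst (q v)"] exI[of _ "\<lambda>v. snd (q v)"]) simp
  next
    assume ?r
    then obtain t g where q: "lplot SG n u (\<lambda>v. (t v, g v))"
      "eventually (\<lambda>v. e v = wjoin (t v) (g v)) (eucl_nhds n u)" by blast
    have "eventually (\<lambda>v. e v = milnor_rel G DG `` {(t v, g v)}) (eucl_nhds n u)"
      using q(2) *[OF q(1)] by eventually_elim simp
    with q(1) show "lplot EG n u e"
      unfolding milnor_E_def lplot_quotient_diff[OF diffeological_SG] by blast
  qed
qed

lemma plots_SG:
  "plots SG n U (\<lambda>v. (t v, g v)) \<longleftrightarrow> (\<forall>i. plots real_diff n U (\<lambda>v. t v i)) \<and>
    (\<forall>i. plots DG n U (\<lambda>v. g v i)) \<and> (\<forall>v\<in>U. (t v, g v) \<in> pts SG)"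
proof -
  have *: "(\<forall>v\<in>U. (t v, g v) \<in> pts SG) \<longleftrightarrow> (\<forall>v\<in>U. (\<forall>i. 0 \<le> t v i \<and> t v i \<le> 1) \<and>
      finite {i. t v i \<noteq> 0} \<and> (\<Sum>i | t v i \<noteq> 0. t v i) = 1)"
    if "\<forall>i. plots DG n U (\<lambda>v. g v i)"
  proof -
    have "g v i \<in> carrier G" if "v \<in> U" for v i
      using plots_into[OF DG spec[OF \<open>\<forall>i. plots DG n U (\<lambda>v. g v i)\<close>, of i] that] by (simp add: pts_DG)
    then show ?thesis by (auto simp: pts_SG)
  qed
  show ?thesis
    using * by (auto simp: milnor_S_def subset_diff_def prod_diff_def seq_diff_def comp_def Pi_iff)
qed

text \<open>Plots in \<open>seq_diff\<close> demand one domain for all coordinates, while germs of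
  infinitely many coordinates at one point could have shrinking domains. Hence the explicit open set
  \<open>V\<close>, with germs at all of its points.\<close>

lemma lplot_SG_I:
  assumes "openin (Euclidean_space n) V" "u \<in> V"
    and "\<And>v i. v \<in> V \<Longrightarrow> lplot real_diff n v (\<lambda>v. t v i)"
    and "\<And>v i. v \<in> V \<Longrightarrow> lplot DG n v (\<lambda>v. g v i)"
    and "\<And>v. v \<in> V \<Longrightarrow> (t v, g v) \<in> pts SG"
  shows "lplot SG n u (\<lambda>v. (t v, g v))"
proof -
  have "plots SG n V (\<lambda>v. (t v, g v))"
    unfolding plots_SG plots_iff_lplot[OF diffeological_real] plots_iff_lplot[OF DG]
    using assms by simp
  then show ?thesis using assms(1,2) unfolding lplot_def by blast
qed

lemma lplot_SG_D:
  assumes "lplot SG n u (\<lambda>v. (t v, g v))"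
  shows "lplot real_diff n u (\<lambda>v. t v i)" "lplot DG n u (\<lambda>v. g v i)"
proof -
  obtain V where "openin (Euclidean_space n) V" "u \<in> V" "plots SG n V (\<lambda>v. (t v, g v))"
    using assms unfolding lplot_def by blast
  then show "lplot real_diff n u (\<lambda>v. t v i)" "lplot DG n u (\<lambda>v. g v i)"
    unfolding plots_SG lplot_def by blast+
qed

lemma eventually_weight_nonzero:
  assumes "lplot SG n u (\<lambda>v. (t v, g v))" "t u i \<noteq> 0"
  shows "eventually (\<lambda>v. t v i \<noteq> 0) (eucl_nhds n u)"
  by (rule tendsto_imp_eventually_ne[OF lplot_real_tendsto[OF lplot_SG_D(1)[OF assms(1)]] assms(2)])

lemma SG_act: "(t, g) \<in> pts SG \<Longrightarrow> h \<in> carrier G \<Longrightarrow> (t, \<lambda>i. g i \<otimes> inv h) \<in> pts SG"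
  by (auto simp: pts_SG)

lemma milnor_action_wjoin:
  assumes "(t, g) \<in> pts SG" "h \<in> carrier G"
  shows "milnor_action G h (wjoin t g) = wjoin t (\<lambda>i. g i \<otimes> inv h)"
proof
  show "milnor_action G h (wjoin t g) \<subseteq> wjoin t (\<lambda>i. g i \<otimes> inv h)"
    using assms by (auto simp: milnor_action_def wjoin_def)
  show "wjoin t (\<lambda>i. g i \<otimes> inv h) \<subseteq> milnor_action G h (wjoin t g)"
  proof
    fix z assume "z \<in> wjoin t (\<lambda>i. g i \<otimes> inv h)"
    then obtain g' where z: "z = (t, g')" and g': "\<And>i. g' i \<in> carrier G"
      "\<And>i. t i \<noteq> 0 \<Longrightarrow> g' i = g i \<otimes> inv h"
      by (auto simp: wjoin_def)
    \<comment> \<open>The representative is shifted by \<open>h\<close> in every coordinate, also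
      where the weight vanishes, so that it is an exact preimage.\<close>
    have "(t, \<lambda>i. g' i \<otimes> h) \<in> wjoin t g"
      using g' assms by (auto simp: wjoin_def pts_SG m_assoc)
    moreover have "z = (\<lambda>(t, g). (t, \<lambda>i. g i \<otimes> inv h)) (t, \<lambda>i. g' i \<otimes> h)"
      using z g' assms by (simp add: m_assoc)
    ultimately show "z \<in> milnor_action G h (wjoin t g)"
      unfolding milnor_action_def by (rule image_eqI[rotated])
  qed
qed

lemma gspace_EG: "smooth_gspace G DG EG (milnor_action G)"
proof
  show "milnor_action G g e \<in> pts EG" if "g \<in> carrier G" "e \<in> pts EG" for g e
    using that(2) by (rule EG_E) (use that in \<open>simp add: milnor_action_wjoin SG_act wjoin_in_EG\<close>)
  show "milnor_action G \<one> e = e" if "e \<in> pts EG" for e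
    using that
  proof (rule EG_E)
    fix t g assume tg: "(t, g) \<in> pts SG" "e = wjoin t g"
    then have "(\<lambda>i. g i \<otimes> inv \<one>) = g" by (auto simp: pts_SG)
    then show ?thesis using tg by (simp add: milnor_action_wjoin)
  qed
  show "milnor_action G (g \<otimes> h) e = milnor_action G g (milnor_action G h e)"
    if gh: "g \<in> carrier G" "h \<in> carrier G" and "e \<in> pts EG" for g h e
    using that(3)
  proof (rule EG_E)
    fix t k assume tk: "(t, k) \<in> pts SG" "e = wjoin t k"
    then have "(\<lambda>i. k i \<otimes> inv (g \<otimes> h)) = (\<lambda>i. k i \<otimes> inv h \<otimes> inv g)"
      using gh by (auto simp: pts_SG inv_mult_group m_assoc)
    then show ?thesis using tk gh by (simp add: milnor_action_wjoin SG_act)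
  qed
  fix n u a p assume a: "lplot DG n u a" and "lplot EG n u p"
  then obtain t g where q: "lplot SG n u (\<lambda>v. (t v, g v))"
    and p: "eventually (\<lambda>v. p v = wjoin (t v) (g v)) (eucl_nhds n u)"
    unfolding lplot_EG by blast
  \<comment> \<open>\<open>lplot_SG_I\<close> wants one neighbourhood on which both germs
    persist.\<close>
  have "eventually (\<lambda>v. lplot SG n v (\<lambda>v. (t v, g v)) \<and> lplot DG n v a) (eucl_nhds n u)"
    using lplot_eventually[OF diffeological_SG q] lplot_eventually[OF DG a] by eventually_elim simp
  then obtain V where V: "openin (Euclidean_space n) V" "u \<in> V"
    "\<And>v. v \<in> V \<Longrightarrow> lplot SG n v (\<lambda>v. (t v, g v))" "\<And>v. v \<in> V \<Longrightarrow> lplot DG n v a"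
    using lplot_topspace[OF a] by (auto simp: eventually_nhdsin)
  have "lplot SG n u (\<lambda>v. (t v, \<lambda>i. g v i \<otimes> inv (a v)))"
  proof (rule lplot_SG_I[OF V(1,2)])
    fix v i assume v: "v \<in> V"
    show "lplot real_diff n v (\<lambda>v. t v i)" by (rule lplot_SG_D[OF V(3)[OF v]])
    show "lplot DG n v (\<lambda>v. g v i \<otimes> inv (a v))"
      by (intro lplot_mult lplot_inv V(4)[OF v] lplot_SG_D(2)[OF V(3)[OF v]])
  next
    fix v assume v: "v \<in> V"
    show "(t v, \<lambda>i. g v i \<otimes> inv (a v)) \<in> pts SG"
      using lplot_pts[OF diffeological_SG V(3)[OF v]] lplot_DG_carrier[OF V(4)[OF v]] by (rule SG_act)
  qed
  moreover have "eventually (\<lambda>v. milnor_action G (a v) (p v) = wjoin (t v) (\<lambda>i. g v i \<otimes> inv (a v)))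
      (eucl_nhds n u)"
    using p lplot_eventually_pts[OF diffeological_SG q] lplot_DG_eventually[OF a]
    by eventually_elim (simp add: milnor_action_wjoin)
  ultimately show "lplot EG n u (\<lambda>v. milnor_action G (a v) (p v))"
    unfolding lplot_EG by (intro exI[of _ t] exI[of _ "\<lambda>v i. g v i \<otimes> inv (a v)"]) simp
qed (rule diffeological_EG)

sublocale EG: smooth_gspace G DG EG "milnor_action G"
  by (rule gspace_EG)

abbreviation "M_proj \<equiv> orbit G (milnor_action G)"

text \<open>The translation function is read off any coordinate whose weight does not vanish.\<close>

lemma milnor_action_wjoin_eqD:
  assumes "(t, g) \<in> pts SG" "(t', g') \<in> pts SG" "h \<in> carrier G"
    and "wjoin t' g' = milnor_action G h (wjoin t g)"
  shows "t' = t" "t j \<noteq> 0 \<Longrightarrow> h = inv (g' j) \<otimes> g j"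
proof -
  have eq: "t' = t \<and> (\<forall>i. t' i \<noteq> 0 \<longrightarrow> g' i = g i \<otimes> inv h)"
    using assms by (simp add: milnor_action_wjoin wjoin_eq_iff SG_act)
  then show "t' = t" by simp
  assume "t j \<noteq> 0"
  moreover have "g j \<in> carrier G" using assms(1) by (simp add: pts_SG)
  ultimately show "h = inv (g' j) \<otimes> g j"
    using eq assms(3) by (simp add: inv_mult_group m_assoc)
qed

lemma torsor_EG: "torsor G DG EG (milnor_action G) M_proj BG"
  unfolding milnor_B_def
proof (rule EG.torsor_orbit_space)
  fix e g h
  assume e: "e \<in> pts EG" and gh: "g \<in> carrier G" "h \<in> carrier G" "milnor_action G g e = milnor_action G h e"
  obtain t k where tk: "(t, k) \<in> pts SG" "e = wjoin t k" using e by (rule EG_E)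
  obtain j where "t j \<noteq> 0" using SG_nonzero[OF tk(1)] .
  then have "k j \<otimes> inv g = k j \<otimes> inv h" "k j \<in> carrier G"
    using gh tk by (auto simp: milnor_action_wjoin wjoin_eq_iff SG_act pts_SG)
  then have "inv g = inv h" using gh by simp
  then show "g = h" using gh by (metis inv_inv)
next
  fix n u p q
  assume "lplot EG n u p" "lplot EG n u q"
    and eq: "eventually (\<lambda>v. \<exists>g\<in>carrier G. q v = milnor_action G g (p v)) (eucl_nhds n u)"
  then obtain t g t' g' where p: "lplot SG n u (\<lambda>v. (t v, g v))" "eventually (\<lambda>v. p v = wjoin (t v) (g v)) (eucl_nhds n u)"
    and q: "lplot SG n u (\<lambda>v. (t' v, g' v))" "eventually (\<lambda>v. q v = wjoin (t' v) (g' v)) (eucl_nhds n u)"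
    unfolding lplot_EG by blast
  \<comment> \<open>A weight that is nonzero at \<open>u\<close> stays nonzero nearby, so a single
    index \<open>j\<close> gives the translation element for the whole germ.\<close>
  obtain j where j: "t u j \<noteq> 0" using SG_nonzero[OF lplot_pts[OF diffeological_SG p(1)]] .
  have "lplot DG n u (\<lambda>v. inv (g' v j) \<otimes> g v j)"
    by (intro lplot_mult lplot_inv lplot_SG_D(2)[OF p(1)] lplot_SG_D(2)[OF q(1)])
  moreover have "eventually (\<lambda>v. q v = milnor_action G (inv (g' v j) \<otimes> g v j) (p v)) (eucl_nhds n u)"
    using eq p(2) q(2) eventually_weight_nonzero[OF p(1) j]
      lplot_eventually_pts[OF diffeological_SG p(1)] lplot_eventually_pts[OF diffeological_SG q(1)]
  proof eventually_elim
    case (elim v)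
    then obtain h where h: "h \<in> carrier G" "q v = milnor_action G h (p v)" by blast
    then have "h = inv (g' v j) \<otimes> g v j"
      using elim by (intro milnor_action_wjoin_eqD(2)[of "t v" "g v" "t' v" "g' v"]) auto
    with h show ?case by simp
  qed
  ultimately show "\<exists>d. lplot DG n u d \<and> eventually (\<lambda>v. q v = milnor_action G (d v) (p v)) (eucl_nhds n u)"
    by (intro exI[of _ "\<lambda>v. inv (g' v j) \<otimes> g v j"] conjI)
qed

sublocale EG: torsor G DG EG "milnor_action G" M_proj BG
  by (rule torsor_EG)

section \<open>Local sections over the sets of nonvanishing weight\<close>

definition nonzero_at :: "nat \<Rightarrow> ((nat \<Rightarrow> real) \<times> (nat \<Rightarrow> 'g)) set set" where
  "nonzero_at j = {wjoin t g | t g. (t, g) \<in> pts SG \<and> t j \<noteq> 0}"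

lemma wjoin_nonzero_at: "(t, g) \<in> pts SG \<Longrightarrow> wjoin t g \<in> nonzero_at j \<longleftrightarrow> t j \<noteq> 0"
  by (auto simp: nonzero_at_def wjoin_eq_iff)

lemma nonzero_at_subset: "nonzero_at j \<subseteq> pts EG"
  by (auto simp: nonzero_at_def wjoin_in_EG)

lemma nonzero_at_act:
  assumes "e \<in> pts EG" "h \<in> carrier G"
  shows "milnor_action G h e \<in> nonzero_at j \<longleftrightarrow> e \<in> nonzero_at j"
  using assms(1) by (rule EG_E) (use assms(2) in \<open>simp add: milnor_action_wjoin wjoin_nonzero_at SG_act\<close>)

text \<open>The representative is arbitrary, but where the \<open>j\<close>-th weight is nonzero all
  representatives share this entry (\<open>coord_wjoin\<close>).\<close>

definition coord :: "nat \<Rightarrow> ((nat \<Rightarrow> real) \<times> (nat \<Rightarrow> 'g)) set \<Rightarrow> 'g" where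
  "coord j e = snd (SOME z. z \<in> e) j"

lemma coord_wjoin: assumes "(t, g) \<in> pts SG" "t j \<noteq> 0" shows "coord j (wjoin t g) = g j"
  using someI[of "\<lambda>z. z \<in> wjoin t g", OF wjoin_mem[OF assms(1)]] assms(2)
  by (auto simp: coord_def wjoin_def)

text \<open>Over \<open>t\<^sub>j \<noteq> 0\<close> the section picks the point of the fibre whose \<open>j\<close>-th group coordinate is \<open>\<one>\<close>.\<close>

definition M_section :: "nat \<Rightarrow> ((nat \<Rightarrow> real) \<times> (nat \<Rightarrow> 'g)) set set \<Rightarrow> ((nat \<Rightarrow> real) \<times> (nat \<Rightarrow> 'g)) set" where
  "M_section j b = (let e = SOME e. e \<in> pts EG \<and> M_proj e = b in milnor_action G (coord j e) e)"

lemma coord_carrier: "e \<in> nonzero_at j \<Longrightarrow> coord j e \<in> carrier G"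
  by (auto simp: nonzero_at_def coord_wjoin pts_SG)

lemma coord_act:
  assumes "e \<in> nonzero_at j" "h \<in> carrier G"
  shows "coord j (milnor_action G h e) = coord j e \<otimes> inv h"
  using assms by (auto simp: nonzero_at_def coord_wjoin milnor_action_wjoin SG_act)

text \<open>Another point \<open>milnor_action G h e\<close> of the fibre has coordinate
  \<open>coord j e \<otimes> inv h\<close>, and the two occurrences of \<open>h\<close> cancel; the
  choice made in \<open>M_section\<close> therefore does not affect its value.\<close>

lemma M_section_proj:
  assumes e: "e \<in> nonzero_at j" shows "M_section j (M_proj e) = milnor_action G (coord j e) e"
proof -
  have eE: "e \<in> pts EG" using e nonzero_at_subset by blast
  define e' where "e' = (SOME e'. e' \<in> pts EG \<and> M_proj e' = M_proj e)"
  have e': "e' \<in> pts EG" "M_proj e' = M_proj e"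
    using someI[of "\<lambda>e'. e' \<in> pts EG \<and> M_proj e' = M_proj e" e] eE by (auto simp: e'_def)
  obtain h where h: "h \<in> carrier G" "e' = milnor_action G h e"
    using EG.orbit_eqE[OF e'(2)[symmetric] e'(1)] by blast
  have "milnor_action G (coord j e') e' = milnor_action G (coord j e \<otimes> inv h \<otimes> h) e"
    using h e eE coord_carrier[OF e] by (simp add: coord_act EG.act_mult)
  also have "\<dots> = milnor_action G (coord j e) e"
    using coord_carrier[OF e] h by (simp add: m_assoc)
  finally show ?thesis by (simp add: M_section_def e'_def Let_def)
qed

lemma smooth_section_M: "smooth_section EG M_proj BG (M_proj ` nonzero_at j) (M_section j)"
  unfolding smooth_section_def
proof (intro conjI ballI allI impI)
  \<comment> \<open>Any lift of the base germ meets \<open>nonzero_at j\<close>, because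
    nonvanishing of a weight is invariant under the action; near \<open>u\<close> its coordinate is
    the smooth entry \<open>g v j\<close>.\<close>
  have lift: "\<exists>q d. lplot EG n u q \<and> lplot DG n u d \<and>
      eventually (\<lambda>v. M_proj (q v) = a v \<and> q v \<in> nonzero_at j \<and> coord j (q v) = d v) (eucl_nhds n u)"
    if a: "lplot BG n u a" "a u \<in> M_proj ` nonzero_at j" for n u a
  proof -
    obtain q where q: "lplot EG n u q" "eventually (\<lambda>v. M_proj (q v) = a v) (eucl_nhds n u)"
      using EG.lift[OF a(1)] by blast
    obtain e where e: "e \<in> nonzero_at j" "a u = M_proj e" using a(2) by blast
    have "M_proj e = M_proj (q u)"
      using eventually_nhdsin_self[OF q(2) lplot_topspace[OF q(1)]] e by simp
    then obtain h where "h \<in> carrier G" "q u = milnor_action G h e"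
      by (rule EG.orbit_eqE[OF _ lplot_pts[OF diffeological_EG q(1)]])
    then have qu: "q u \<in> nonzero_at j"
      using e(1) nonzero_at_act[OF subsetD[OF nonzero_at_subset e(1)]] by simp
    obtain t g where tg: "lplot SG n u (\<lambda>v. (t v, g v))" "eventually (\<lambda>v. q v = wjoin (t v) (g v)) (eucl_nhds n u)"
      using q(1) unfolding lplot_EG by blast
    have "t u j \<noteq> 0"
      using qu eventually_nhdsin_self[OF tg(2) lplot_topspace[OF q(1)]]
        lplot_pts[OF diffeological_SG tg(1)] by (simp add: wjoin_nonzero_at)
    from eventually_weight_nonzero[OF tg(1) this]
    have "eventually (\<lambda>v. M_proj (q v) = a v \<and> q v \<in> nonzero_at j \<and> coord j (q v) = g v j) (eucl_nhds n u)"
      using q(2) tg(2) lplot_eventually_pts[OF diffeological_SG tg(1)]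
      by eventually_elim (simp add: coord_wjoin wjoin_nonzero_at)
    with q(1) lplot_SG_D(2)[OF tg(1), of j] show ?thesis
      by (intro exI[of _ q] exI[of _ "\<lambda>v. g v j"] conjI)
  qed
  show "openin (D_topology BG) (M_proj ` nonzero_at j)"
  proof (rule openin_D_topologyI[OF EG.X])
    show "M_proj ` nonzero_at j \<subseteq> pts BG"
      using nonzero_at_subset smooth_map_pts[OF EG.proj_smooth] by auto
    fix n u a assume a: "lplot BG n u a" "a u \<in> M_proj ` nonzero_at j"
    obtain q d where "eventually (\<lambda>v. M_proj (q v) = a v \<and> q v \<in> nonzero_at j \<and> coord j (q v) = d v)
        (eucl_nhds n u)"
      using lift[OF a] by blast
    then show "eventually (\<lambda>v. a v \<in> M_proj ` nonzero_at j) (eucl_nhds n u)"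
      by eventually_elim auto
  qed
  show "M_section j b \<in> pts EG" "M_proj (M_section j b) = b" if "b \<in> M_proj ` nonzero_at j" for b
    using that nonzero_at_subset[of j] coord_carrier EG.act_closed EG.orbit_act
    by (auto simp: M_section_proj subset_iff)
  fix n u a assume a: "lplot BG n u a" "a u \<in> M_proj ` nonzero_at j"
  obtain q d where q: "lplot EG n u q" and d: "lplot DG n u d"
    and ev: "eventually (\<lambda>v. M_proj (q v) = a v \<and> q v \<in> nonzero_at j \<and> coord j (q v) = d v) (eucl_nhds n u)"
    using lift[OF a] by blast
  show "lplot EG n u (\<lambda>v. M_section j (a v))"
    by (rule lplot_cong[OF diffeological_EG EG.act_lplot[OF d q]])
      (use ev in \<open>eventually_elim, use M_section_proj in metis\<close>)
qed

lemma M_section_cover: "b \<in> pts BG \<Longrightarrow> \<exists>j. b \<in> M_proj ` nonzero_at j"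
proof -
  assume "b \<in> pts BG"
  then obtain e where e: "e \<in> pts EG" "M_proj e = b" by (rule EG.proj_surj)
  obtain t g where tg: "(t, g) \<in> pts SG" "e = wjoin t g" using e(1) by (rule EG_E)
  obtain j where "t j \<noteq> 0" using SG_nonzero[OF tg(1)] .
  then have "e \<in> nonzero_at j" using tg by (simp add: wjoin_nonzero_at)
  with e(2) show ?thesis by blast
qed

lemma locally_sectioned_EG: "locally_sectioned EG M_proj BG"
  unfolding locally_sectioned_def using M_section_cover smooth_section_M by blast

end

section \<open>Classifying maps\<close>

text \<open>Indexed by naturals, since the weights of Milnor's space and the stages of a homotopy
  are numbered; the family \<open>V\<close> may repeat sets, which a partition indexed by
  \<open>range V\<close> does not see.\<close>

definition indexed_partition :: "'x diffspace \<Rightarrow> (nat \<Rightarrow> 'x set) \<Rightarrow> (nat \<Rightarrow> 'x \<Rightarrow> real) \<Rightarrow> bool" where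
  "indexed_partition X V \<rho> \<longleftrightarrow>
     (\<forall>n. smooth_map X real_diff (\<rho> n)) \<and> (\<forall>n. \<forall>x\<in>pts X. 0 \<le> \<rho> n x) \<and>
     (\<forall>n. D_topology X closure_of {x \<in> pts X. \<rho> n x \<noteq> 0} \<subseteq> V n) \<and>
     (\<forall>x\<in>pts X. \<exists>W. openin (D_topology X) W \<and> x \<in> W \<and> finite {n. \<exists>y\<in>W. \<rho> n y \<noteq> 0}) \<and>
     (\<forall>x\<in>pts X. (\<Sum>n | \<rho> n x \<noteq> 0. \<rho> n x) = 1)"

lemma indexed_partition_exists:
  assumes X: "diffeological_space X" and sp: "smoothly_paracompact X"
    and V: "\<And>n. openin (D_topology X) (V n)" and cover: "(\<Union>n. V n) = pts X"
  shows "\<exists>\<rho>. indexed_partition X V \<rho>"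
proof -
  have "(\<forall>U\<in>range V. openin (D_topology X) U) \<and> \<Union>(range V) = pts X" using V cover by auto
  then obtain \<rho> where \<rho>: "smooth_partition_of_unity X (range V) \<rho>"
    using sp unfolding smoothly_paracompact_def by blast
  have \<rho>1: "smooth_map X real_diff (\<rho> (V n))" "\<forall>x\<in>pts X. 0 \<le> \<rho> (V n) x"
    "D_topology X closure_of {x \<in> pts X. \<rho> (V n) x \<noteq> 0} \<subseteq> V n" for n
    using \<rho> by (auto simp: smooth_partition_of_unity_def)
  have \<rho>2: "\<exists>W. openin (D_topology X) W \<and> x \<in> W \<and> finite {U \<in> range V. \<exists>y\<in>W. \<rho> U y \<noteq> 0}"
    and \<rho>3: "(\<Sum>U | U \<in> range V \<and> \<rho> U x \<noteq> 0. \<rho> U x) = 1" if "x \<in> pts X" for x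
    using \<rho> that by (auto simp: smooth_partition_of_unity_def)
  text \<open>Each member of the family keeps its function only at its first index.\<close>
  define first where "first n \<longleftrightarrow> (\<forall>m<n. V m \<noteq> V n)" for n
  define r where "r n x = (if first n then \<rho> (V n) x else 0)" for n x
  have inj: "inj_on V {n. first n}"
  proof (rule inj_onI)
    fix m n assume "m \<in> {n. first n}" "n \<in> {n. first n}" "V m = V n"
    then show "m = n" by (cases m n rule: linorder_cases) (auto simp: first_def)
  qed
  have ex_first: "\<exists>n. first n \<and> V n = U" if U: "U \<in> range V" for U
  proof -
    obtain m where m: "V m = U" using U by blast
    define N where "N = (LEAST n. V n = U)"
    have N: "V N = U" unfolding N_def using m by (rule LeastI)
    have "V k \<noteq> V N" if "k < N" for k
      using not_less_Least[OF that[unfolded N_def]] N by simp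
    with N show ?thesis unfolding first_def by blast
  qed
  have const: "smooth_map X real_diff (\<lambda>_. 0)"
    by (rule smooth_mapI[OF X diffeological_real]) (auto intro: lplot_real_const lplot_topspace)
  have "smooth_map X real_diff (r n)" for n
    using \<rho>1(1)[of n] const by (cases "first n") (simp_all add: r_def[abs_def])
  moreover have "\<forall>x\<in>pts X. 0 \<le> r n x" for n using \<rho>1(2) by (simp add: r_def)
  moreover have "D_topology X closure_of {x \<in> pts X. r n x \<noteq> 0} \<subseteq> V n" for n
    using \<rho>1(3)[of n] by (cases "first n") (simp_all add: r_def)
  moreover have "\<exists>W. openin (D_topology X) W \<and> x \<in> W \<and> finite {n. \<exists>y\<in>W. r n y \<noteq> 0}"
    if x: "x \<in> pts X" for x
  proof -
    obtain W where W: "openin (D_topology X) W" "x \<in> W" "finite {U \<in> range V. \<exists>y\<in>W. \<rho> U y \<noteq> 0}"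
      using \<rho>2[OF x] by blast
    have sub: "{n. \<exists>y\<in>W. r n y \<noteq> 0} \<subseteq> {n. first n}" by (auto simp: r_def split: if_splits)
    have "V ` {n. \<exists>y\<in>W. r n y \<noteq> 0} \<subseteq> {U \<in> range V. \<exists>y\<in>W. \<rho> U y \<noteq> 0}"
      by (auto simp: r_def split: if_splits)
    then have "finite (V ` {n. \<exists>y\<in>W. r n y \<noteq> 0})" using W(3) by (rule finite_subset)
    then have "finite {n. \<exists>y\<in>W. r n y \<noteq> 0}" by (rule finite_imageD) (rule inj_on_subset[OF inj sub])
    with W show ?thesis by blast
  qed
  moreover have "(\<Sum>n | r n x \<noteq> 0. r n x) = 1" if x: "x \<in> pts X" for x
  proof -
    have "(\<Sum>U | U \<in> range V \<and> \<rho> U x \<noteq> 0. \<rho> U x) = (\<Sum>n | r n x \<noteq> 0. r n x)"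
    proof (rule sum.reindex_cong[of V])
      show "inj_on V {n. r n x \<noteq> 0}"
        by (rule inj_on_subset[OF inj]) (auto simp: r_def split: if_splits)
      show "{U \<in> range V. \<rho> U x \<noteq> 0} = V ` {n. r n x \<noteq> 0}"
      proof
        show "{U \<in> range V. \<rho> U x \<noteq> 0} \<subseteq> V ` {n. r n x \<noteq> 0}"
        proof
          fix U assume U: "U \<in> {U \<in> range V. \<rho> U x \<noteq> 0}"
          then obtain n where "first n" "V n = U" using ex_first by blast
          with U show "U \<in> V ` {n. r n x \<noteq> 0}" by (auto simp: r_def intro!: image_eqI[of _ _ n])
        qed
      qed (auto simp: r_def split: if_splits)
    qed (auto simp: r_def split: if_splits)
    then show ?thesis using \<rho>3[OF x] by simp
  qed
  ultimately show ?thesis unfolding indexed_partition_def by (intro exI[of _ r]) simp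
qed

context
  fixes X :: "'x diffspace" and V and \<rho>
  assumes X: "diffeological_space X" and \<rho>: "indexed_partition X V \<rho>"
begin

lemma
  shows partition_smooth: "smooth_map X real_diff (\<rho> n)"
    and partition_nonneg: "x \<in> pts X \<Longrightarrow> 0 \<le> \<rho> n x"
    and partition_sum: "x \<in> pts X \<Longrightarrow> (\<Sum>n | \<rho> n x \<noteq> 0. \<rho> n x) = 1"
  using \<rho> by (auto simp: indexed_partition_def)

lemma partition_locally_finite:
  assumes "x \<in> pts X"
  obtains W where "openin (D_topology X) W" "x \<in> W" "finite {n. \<exists>y\<in>W. \<rho> n y \<noteq> 0}"
proof -
  have "\<exists>W. openin (D_topology X) W \<and> x \<in> W \<and> finite {n. \<exists>y\<in>W. \<rho> n y \<noteq> 0}"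
    using \<rho> assms by (simp add: indexed_partition_def)
  then show ?thesis using that by blast
qed

text \<open>The closure condition yields a dichotomy: in \<open>V n\<close> data over
  \<open>V n\<close> are available, elsewhere the weight vanishes on a whole neighbourhood. This is
  what makes definitions by cases on \<open>V n\<close> smooth.\<close>

lemma partition_support:
  assumes "x \<in> pts X"
  shows "x \<in> V n \<or> (\<exists>W. openin (D_topology X) W \<and> x \<in> W \<and> (\<forall>y\<in>W. \<rho> n y = 0))"
proof -
  let ?C = "D_topology X closure_of {x \<in> pts X. \<rho> n x \<noteq> 0}"
  have C: "?C \<subseteq> V n" using \<rho> by (simp add: indexed_partition_def)
  show ?thesis
  proof (cases "x \<in> ?C")
    case True then show ?thesis using C by blast
  next
    case False
    have top: "topspace (D_topology X) = pts X" by (rule topspace_D_topology[OF X])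
    have "{x \<in> pts X. \<rho> n x \<noteq> 0} \<subseteq> ?C" by (rule closure_of_subset) (auto simp: top)
    then have "\<forall>y\<in>pts X - ?C. \<rho> n y = 0" by blast
    moreover have "openin (D_topology X) (pts X - ?C)"
      using openin_diff[OF openin_topspace closedin_closure_of, of "D_topology X" "{x \<in> pts X. \<rho> n x \<noteq> 0}"]
      by (simp add: top)
    ultimately show ?thesis using False assms by blast
  qed
qed

lemma partition_pos_imp:
  assumes "x \<in> pts X" "\<rho> n x \<noteq> 0" shows "x \<in> V n"
  using partition_support[OF assms(1), of n] assms(2) by blast

lemma partition_finite: assumes "x \<in> pts X" shows "finite {n. \<rho> n x \<noteq> 0}"
proof -
  obtain W where "x \<in> W" "finite {n. \<exists>y\<in>W. \<rho> n y \<noteq> 0}"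
    using partition_locally_finite[OF assms] .
  then show ?thesis by (auto intro: finite_subset[rotated])
qed

lemma partition_le_one: assumes "x \<in> pts X" shows "\<rho> n x \<le> 1"
proof (cases "\<rho> n x = 0")
  case False
  then have "\<rho> n x \<le> (\<Sum>n | \<rho> n x \<noteq> 0. \<rho> n x)"
    using partition_nonneg[OF assms] partition_finite[OF assms]
    by (intro member_le_sum) auto
  then show ?thesis using partition_sum[OF assms] by simp
qed simp

end

lemma (in torsor) countable_sections:
  assumes sc: "second_countable (D_topology X)" and ls: "locally_sectioned P \<kappa> X"
  shows "\<exists>V \<sigma>. (\<forall>n::nat. smooth_section P \<kappa> X (V n) (\<sigma> n)) \<and> (\<Union>n. V n) = pts X"
proof -
  let ?U = "{U. \<exists>\<sigma>. smooth_section P \<kappa> X U \<sigma>}"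
  have op: "\<forall>U\<in>?U. openin (D_topology X) U" by (auto dest: smooth_sectionD(1))
  have cov: "\<Union>?U = topspace (D_topology X)"
  proof
    show "\<Union>?U \<subseteq> topspace (D_topology X)" using op openin_subset by (intro Union_least) blast
    show "topspace (D_topology X) \<subseteq> \<Union>?U"
    proof
      fix x assume "x \<in> topspace (D_topology X)"
      then obtain U \<sigma> where "x \<in> U" "smooth_section P \<kappa> X U \<sigma>"
        using ls unfolding topspace_D_topology[OF X] locally_sectioned_def by blast
      then show "x \<in> \<Union>?U" by blast
    qed
  qed
  obtain \<V> where \<V>: "countable \<V>" "\<V> \<subseteq> ?U" "\<Union>\<V> = topspace (D_topology X)"
    using second_countable_imp_Lindelof_space[OF sc] op cov unfolding Lindelof_space_def by meson
  \<comment> \<open>The empty set, over which anything is a section, is inserted so that the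
    countable family is nonempty and can be enumerated by all naturals.\<close>
  have "{} \<in> ?U" by (simp add: smooth_section_def)
  with \<V>(2) have "insert {} \<V> \<subseteq> ?U" by (intro insert_subsetI)
  moreover have rg: "range (from_nat_into (insert {} \<V>)) = insert {} \<V>"
    using \<V>(1) by (intro range_from_nat_into) auto
  ultimately have "\<forall>n. \<exists>\<sigma>. smooth_section P \<kappa> X (from_nat_into (insert {} \<V>) n) \<sigma>" by blast
  then obtain \<sigma> where "\<forall>n. smooth_section P \<kappa> X (from_nat_into (insert {} \<V>) n) (\<sigma> n)" by metis
  moreover have "(\<Union>n. from_nat_into (insert {} \<V>) n) = pts X"
    using \<V>(3) rg by (simp add: topspace_D_topology[OF X])
  ultimately show ?thesis by blast
qed

lemma (in torsor) equivariant_map_to_milnor: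
  assumes hsp: "HSP X" and ls: "locally_sectioned P \<kappa> X"
  shows "\<exists>\<Theta>. smooth_map P (milnor_E G DG) \<Theta> \<and>
    (\<forall>g\<in>carrier G. \<forall>e\<in>pts P. \<Theta> (\<phi> g e) = milnor_action G g (\<Theta> e))"
proof -
  have sc: "second_countable (D_topology X)" and sp: "smoothly_paracompact X"
    using hsp by (auto simp: HSP_def)
  obtain V \<sigma> where V: "\<And>n::nat. smooth_section P \<kappa> X (V n) (\<sigma> n)" "(\<Union>n. V n) = pts X"
    using countable_sections[OF sc ls] by blast
  note s = smooth_sectionD[OF V(1)]
  obtain \<rho> where \<rho>: "indexed_partition X V \<rho>"
    using indexed_partition_exists[OF X sp s(1) V(2)] by blast
  note \<kappa>p = smooth_map_pts[OF proj_smooth]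
  \<comment> \<open>These are the g_n of the overview; outside \<open>V n\<close> the unit is a
    placeholder, in force only where the weight is zero.\<close>
  define c where "c e n = (if \<kappa> e \<in> V n then quot e (\<sigma> n (\<kappa> e)) else \<one>)" for e n
  define \<Theta> where "\<Theta> e = wjoin (\<lambda>n. \<rho> n (\<kappa> e)) (c e)" for e
  have c_carrier: "c e n \<in> carrier G" if "e \<in> pts P" for e n
    using that s(2,3) by (auto simp: c_def quot)
  have S: "(\<lambda>n. \<rho> n (\<kappa> e), g) \<in> pts SG" if "e \<in> pts P" "\<And>n. g n \<in> carrier G" for e g
    using that \<kappa>p partition_nonneg[OF X \<rho>] partition_le_one[OF X \<rho>] partition_finite[OF X \<rho>]
      partition_sum[OF X \<rho>] by (simp add: pts_SG)
  have eq: "\<Theta> (\<phi> g e) = milnor_action G g (\<Theta> e)" if g: "g \<in> carrier G" and e: "e \<in> pts P" for g e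
  proof -
    have "c (\<phi> g e) n = c e n \<otimes> inv g" if "\<rho> n (\<kappa> e) \<noteq> 0" for n
      using partition_pos_imp[OF X \<rho> \<kappa>p[OF e] that] s(2,3) g e
      by (simp add: c_def proj_act quot_act_left)
    moreover have "milnor_action G g (\<Theta> e) = wjoin (\<lambda>n. \<rho> n (\<kappa> e)) (\<lambda>n. c e n \<otimes> inv g)"
      using milnor_action_wjoin[OF S g, of e "c e"] e c_carrier by (simp add: \<Theta>_def)
    moreover have "\<Theta> (\<phi> g e) = wjoin (\<lambda>n. \<rho> n (\<kappa> e)) (c (\<phi> g e))"
      using g e by (simp add: \<Theta>_def proj_act)
    ultimately show ?thesis
      using S[OF e, of "c (\<phi> g e)"] S[OF e, of "\<lambda>n. c e n \<otimes> inv g"] c_carrier g e act_closed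
      by (simp add: wjoin_eq_iff)
  qed
  have "smooth_map P EG \<Theta>"
  proof (rule smooth_mapI[OF E diffeological_EG])
    show "\<Theta> e \<in> pts EG" if "e \<in> pts P" for e
      unfolding \<Theta>_def by (intro wjoin_in_EG S that c_carrier)
    fix n u p assume p: "lplot P n u p"
    define a where "a v = \<kappa> (p v)" for v
    have a: "lplot X n u a" unfolding a_def by (rule smooth_map_lplot[OF proj_smooth p])
    note ax = lplot_pts[OF X a]
    obtain W where W: "openin (D_topology X) W" "a u \<in> W" "finite {i. \<exists>y\<in>W. \<rho> i y \<noteq> 0}"
      by (rule partition_locally_finite[OF X \<rho> ax])
    let ?N = "{i. \<exists>y\<in>W. \<rho> i y \<noteq> 0}"
    let ?J = "{i\<in>?N. a u \<in> V i}"
    \<comment> \<open>Only the finitely many indices active on \<open>W\<close> have to be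
      controlled, so one neighbourhood serves all of them, as \<open>lplot_SG_I\<close>
      requires.\<close>
    have fin: "eventually (\<lambda>v. \<forall>i\<in>?N. if a u \<in> V i then a v \<in> V i else \<rho> i (a v) = 0) (eucl_nhds n u)"
    proof (rule eventually_ball_finite[OF W(3)], rule ballI)
      fix i assume "i \<in> ?N"
      show "eventually (\<lambda>v. if a u \<in> V i then a v \<in> V i else \<rho> i (a v) = 0) (eucl_nhds n u)"
      proof (cases "a u \<in> V i")
        case True
        from eventually_plot_in_D_open[OF X s(1) a this] True show ?thesis by simp
      next
        case False
        then obtain W' where W': "openin (D_topology X) W'" "a u \<in> W'" "\<forall>y\<in>W'. \<rho> i y = 0"
          using partition_support[OF X \<rho> ax, of i] by blast
        from eventually_plot_in_D_open[OF X W'(1) a W'(2)] show ?thesis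
          by eventually_elim (use W' False in simp)
      qed
    qed
    have "eventually (\<lambda>v. a v \<in> W \<and> lplot P n v p \<and>
        (\<forall>i\<in>?N. if a u \<in> V i then a v \<in> V i else \<rho> i (a v) = 0)) (eucl_nhds n u)"
      using fin lplot_eventually[OF E p] eventually_plot_in_D_open[OF X W(1) a W(2)]
      by eventually_elim simp
    then obtain B where B: "openin (Euclidean_space n) B" "u \<in> B"
      and BW: "\<And>v. v \<in> B \<Longrightarrow> a v \<in> W" and Bp: "\<And>v. v \<in> B \<Longrightarrow> lplot P n v p"
      and BV: "\<And>v i. v \<in> B \<Longrightarrow> i \<in> ?N \<Longrightarrow> if a u \<in> V i then a v \<in> V i else \<rho> i (a v) = 0"
      using lplot_topspace[OF p] unfolding eventually_nhdsin by auto
    \<comment> \<open>\<open>c\<close> itself may jump at the boundary of \<open>V i\<close>. Near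
      \<open>u\<close> it is replaced by the unit unless \<open>i\<close> is active on
      \<open>W\<close> and \<open>a u\<close> lies in \<open>V i\<close>; the two differ only where
      the weight vanishes, so the class in \<open>EG\<close> is the same.\<close>
    define c' where "c' v i = (if i \<in> ?J then quot (p v) (\<sigma> i (a v)) else \<one>)" for v i
    have c'_carrier: "c' v i \<in> carrier G" if "v \<in> B" for v i
    proof (cases "i \<in> ?J")
      case True
      then have avV: "a v \<in> V i" using BV[OF that, of i] by auto
      have "quot (p v) (\<sigma> i (a v)) \<in> carrier G"
        using s(2,3)[OF avV] lplot_pts[OF E Bp[OF that]] by (intro quot(1)) (simp_all add: a_def)
      with True show ?thesis by (simp add: c'_def)
    next
      case False
      then show ?thesis by (simp only: c'_def if_False one_closed)
    qed
    have "lplot SG n u (\<lambda>v. (\<lambda>i. \<rho> i (a v), c' v))"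
    proof (rule lplot_SG_I[OF B])
      fix v i assume v: "v \<in> B"
      have av: "lplot X n v a" unfolding a_def by (rule smooth_map_lplot[OF proj_smooth Bp[OF v]])
      show "lplot real_diff n v (\<lambda>v. \<rho> i (a v))" by (rule smooth_map_lplot[OF partition_smooth[OF X \<rho>] av])
      show "lplot DG n v (\<lambda>v. c' v i)"
      proof (cases "i \<in> ?J")
        case True
        then have avV: "a v \<in> V i" using BV[OF v, of i] by auto
        have "lplot DG n v (\<lambda>v. quot (p v) (\<sigma> i (a v)))"
        proof (rule lplot_quot[OF Bp[OF v] s(4)[OF av avV]])
          show "eventually (\<lambda>v. \<kappa> (p v) = \<kappa> (\<sigma> i (a v))) (eucl_nhds n v)"
            using eventually_plot_in_D_open[OF X s(1) av avV]
            by eventually_elim (simp add: s(3) a_def[symmetric])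
        qed
        then show ?thesis using True by (simp add: c'_def)
      next
        case False
        have "lplot DG n v (\<lambda>v. \<one>)"
          by (rule lplot_const[OF DG lplot_topspace[OF av]]) (simp add: pts_DG)
        then show ?thesis using False by (simp only: c'_def if_False)
      qed
    next
      fix v assume v: "v \<in> B"
      show "(\<lambda>i. \<rho> i (a v), c' v) \<in> pts SG"
        unfolding a_def by (intro S lplot_pts[OF E Bp[OF v]] c'_carrier[OF v])
    qed
    moreover have "eventually (\<lambda>v. \<Theta> (p v) = wjoin (\<lambda>i. \<rho> i (a v)) (c' v)) (eucl_nhds n u)"
      using eventually_in_openin[OF B]
    proof eventually_elim
      case (elim v)
      have pv: "p v \<in> pts P" by (rule lplot_pts[OF E Bp[OF elim]])
      have "c (p v) i = c' v i" if i: "\<rho> i (a v) \<noteq> 0" for i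
      proof -
        have "i \<in> ?N" using BW[OF elim] i by blast
        with BV[OF elim this] i have "i \<in> ?J \<and> a v \<in> V i" by (auto split: if_splits)
        then show ?thesis by (simp add: c_def c'_def a_def)
      qed
      then show ?case
        using S[OF pv, of "c (p v)"] S[OF pv, of "c' v"] c_carrier[OF pv] c'_carrier[OF elim]
        by (simp add: \<Theta>_def wjoin_eq_iff a_def)
    qed
    ultimately show "lplot EG n u (\<lambda>v. \<Theta> (p v))"
      unfolding lplot_EG by (intro exI[of _ "\<lambda>v i. \<rho> i (a v)"] exI[of _ c']) simp
  qed
  with eq show ?thesis by blast
qed

text \<open>A point of each fibre is chosen arbitrarily to define \<open>f\<close>; equivariance
  makes the value independent of it, and lifts of base germs make it smooth.\<close>

lemma equivariant_map_descends:
  assumes tP: "torsor G DG P \<phi> \<kappa> X" and tQ: "torsor G DG Q \<omega> \<mu> B"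
    and \<Theta>: "smooth_map P Q \<Theta>"
    and equiv: "\<And>g e. g \<in> carrier G \<Longrightarrow> e \<in> pts P \<Longrightarrow> \<Theta> (\<phi> g e) = \<omega> g (\<Theta> e)"
  shows "\<exists>f. smooth_map X B f \<and> (\<forall>e\<in>pts P. \<mu> (\<Theta> e) = f (\<kappa> e))"
proof -
  interpret P: torsor G DG P \<phi> \<kappa> X by (rule tP)
  interpret Q: torsor G DG Q \<omega> \<mu> B by (rule tQ)
  have "\<exists>e. e \<in> pts P \<and> \<kappa> e = x" if "x \<in> pts X" for x
    using P.proj_surj[OF that] by blast
  then obtain s where s: "\<And>x. x \<in> pts X \<Longrightarrow> s x \<in> pts P \<and> \<kappa> (s x) = x" by metis
  define f where "f x = \<mu> (\<Theta> (s x))" for x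
  have f: "\<mu> (\<Theta> e) = f (\<kappa> e)" if e: "e \<in> pts P" for e
  proof -
    have x: "\<kappa> e \<in> pts X" by (rule smooth_map_pts[OF P.proj_smooth e])
    have k: "P.quot (s (\<kappa> e)) e \<in> carrier G" "\<phi> (P.quot (s (\<kappa> e)) e) (s (\<kappa> e)) = e"
      using s[OF x] e by (simp_all add: P.quot)
    then have "\<Theta> e = \<omega> (P.quot (s (\<kappa> e)) e) (\<Theta> (s (\<kappa> e)))"
      using equiv[OF k(1), of "s (\<kappa> e)"] s[OF x] by simp
    then show ?thesis
      using Q.proj_act[OF k(1) smooth_map_pts[OF \<Theta>, of "s (\<kappa> e)"]] s[OF x] by (simp add: f_def)
  qed
  have "smooth_map X B f"
  proof (rule smooth_mapI[OF P.X Q.X])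
    show "f x \<in> pts B" if "x \<in> pts X" for x
      using s[OF that] smooth_map_pts[OF Q.proj_smooth] smooth_map_pts[OF \<Theta>] by (simp add: f_def)
    fix n u a assume "lplot X n u a"
    then obtain q where q: "lplot P n u q" "eventually (\<lambda>v. \<kappa> (q v) = a v) (eucl_nhds n u)"
      using P.lift by blast
    have "lplot B n u (\<lambda>v. \<mu> (\<Theta> (q v)))"
      by (rule smooth_map_lplot[OF Q.proj_smooth smooth_map_lplot[OF \<Theta> q(1)]])
    then show "lplot B n u (\<lambda>v. f (a v))"
      by (rule lplot_cong[OF Q.X])
        (use q(2) lplot_eventually_pts[OF P.E q(1)] in \<open>eventually_elim, simp add: f\<close>)
  qed
  with f show ?thesis by blast
qed

section \<open>Homotopy invariance\<close>

text \<open>The product of \<open>V\<close> with a line inside the next Euclidean space: the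
  additional parameter is coordinate \<open>n\<close>, and resetting it to 0 is the
  projection.\<close>

lemma openin_drop_last_coordinate:
  assumes V: "openin (Euclidean_space n) V"
  shows "openin (Euclidean_space (Suc n)) {w \<in> topspace (Euclidean_space (Suc n)). w(n := 0) \<in> V}"
  unfolding openin_eventually_iff
proof (intro conjI ballI)
  fix w assume w: "w \<in> {w \<in> topspace (Euclidean_space (Suc n)). w(n := 0) \<in> V}"
  have drop: "w(n := 0) \<in> topspace (Euclidean_space n)" if "w \<in> topspace (Euclidean_space (Suc n))" for w
    using that by (auto simp: topspace_Euclidean_space)
  have "filterlim (\<lambda>w. w(n := 0)) (eucl_nhds n (w(n := 0))) (eucl_nhds (Suc n) w)"
  proof (rule filterlim_eucl_nhds)
    show "((\<lambda>z. (z(n := 0)) i) \<longlongrightarrow> (w(n := 0)) i) (eucl_nhds (Suc n) w)" if "i < n" for i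
      using that tendsto_coordinate[of w "Suc n" i] w by simp
    show "eventually (\<lambda>z. z(n := 0) \<in> topspace (Euclidean_space n)) (eucl_nhds (Suc n) w)"
      using eventually_nhdsin_topspace by eventually_elim (rule drop)
  qed (use w drop in blast)
  moreover have "eventually (\<lambda>z. z \<in> V) (eucl_nhds n (w(n := 0)))"
    using w by (intro eventually_in_openin[OF V]) simp
  ultimately have "eventually (\<lambda>z. z(n := 0) \<in> V) (eucl_nhds (Suc n) w)"
    unfolding filterlim_iff by blast
  with eventually_nhdsin_topspace
  show "eventually (\<lambda>z. z \<in> {w \<in> topspace (Euclidean_space (Suc n)). w(n := 0) \<in> V}) (eucl_nhds (Suc n) w)"
    by eventually_elim simp
qed auto

text \<open>The tube lemma for the \<open>D\<close>-topology of \<open>Y \<times> \<real>\<close>, reduced to Euclidean spaces along plots.\<close>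

lemma openin_D_tube:
  assumes Y: "diffeological_space Y" and O: "openin (D_topology (prod_diff Y real_diff)) O'"
  shows "openin (D_topology Y) {y \<in> pts Y. \<forall>s\<in>{a..b}. (y, s) \<in> O'}"
proof (rule openin_D_topologyI[OF Y])
  fix n u p assume p: "lplot Y n u p" and pu: "p u \<in> {y \<in> pts Y. \<forall>s\<in>{a..b}. (y, s) \<in> O'}"
  obtain V where V: "openin (Euclidean_space n) V" "u \<in> V" "plots Y n V p"
    using p unfolding lplot_def by blast
  \<comment> \<open>The product of \<open>p\<close> with the parameter line becomes the plot
    \<open>?P\<close> on an open subset of the next Euclidean space.\<close>
  let ?E = "Euclidean_space (Suc n)" and ?P = "\<lambda>w. (p (w(n := 0)), w n)"
  define V' where "V' = {w \<in> topspace ?E. w(n := 0) \<in> V}"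
  have V': "openin ?E V'" unfolding V'_def by (rule openin_drop_last_coordinate[OF V(1)])
  have coord: "smooth_real (Suc n) V' (\<lambda>w. w j)" for j
    unfolding smooth_real_def using Ck_on_coordinate[OF V'] by simp
  have "smooth_eucl (Suc n) V' n V (\<lambda>w. w(n := 0))"
    using coord by (auto simp: smooth_eucl_def V'_def)
  from plots_compose[OF Y V(3) V' this]
  have "plots (prod_diff Y real_diff) (Suc n) V' ?P"
    using coord V' by (simp add: prod_diff_def comp_def real_diff_def)
  then have O1: "openin ?E {w \<in> V'. ?P w \<in> O'}"
    using O unfolding openin_D_topology by blast
  have uT: "u \<in> topspace (Euclidean_space n)" by (rule lplot_topspace[OF p])
  have "\<exists>e>0. eucl_box (Suc n) (u(n := s)) e \<subseteq> {w \<in> V'. ?P w \<in> O'}" if s: "s \<in> {a..b}" for s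
  proof (rule eucl_box_subset_open[OF O1])
    have "u n = 0" using uT by (simp add: topspace_Euclidean_space)
    then have "u(n := 0) = u" by (metis fun_upd_triv)
    moreover have "u(n := s) \<in> topspace ?E" using uT by (auto simp: topspace_Euclidean_space)
    ultimately show "u(n := s) \<in> {w \<in> V'. ?P w \<in> O'}" using pu s V(2) by (simp add: V'_def)
  qed
  then have "\<forall>s\<in>{a..b}. \<exists>e>0. eucl_box (Suc n) (u(n := s)) e \<subseteq> {w \<in> V'. ?P w \<in> O'}" by (rule ballI)
  from bchoice[OF this] obtain e where
    e': "\<forall>s\<in>{a..b}. e s > 0 \<and> eucl_box (Suc n) (u(n := s)) (e s) \<subseteq> {w \<in> V'. ?P w \<in> O'}" ..
  have e: "e s > 0" "eucl_box (Suc n) (u(n := s)) (e s) \<subseteq> {w \<in> V'. ?P w \<in> O'}" if "s \<in> {a..b}" for s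
    by (rule conjunct1[OF bspec[OF e' that]], rule conjunct2[OF bspec[OF e' that]])
  have "{a..b} \<subseteq> (\<Union>s\<in>{a..b}. ball s (e s))" using e(1) by force
  then obtain C where C: "C \<subseteq> {a..b}" "finite C" "{a..b} \<subseteq> (\<Union>s\<in>C. ball s (e s))"
    using compactE_image[OF compact_Icc, of "{a..b}" "\<lambda>s. ball s (e s)" a b] by auto
  \<comment> \<open>Smallest cube radius among the finitely many centres selected by compactness;
    the entry 1 covers an empty interval.\<close>
  define d where "d = Min (insert 1 (e ` C))"
  have d: "d > 0" "\<And>s. s \<in> C \<Longrightarrow> d \<le> e s"
    using C e(1) by (auto simp: d_def subset_iff)
  have "(p v, s) \<in> O'" if v: "v \<in> eucl_box n u d" and s: "s \<in> {a..b}" for v s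
  proof -
    obtain c where c: "c \<in> C" "\<bar>s - c\<bar> < e c"
      using C(3) s by (auto simp: dist_real_def abs_minus_commute)
    have vn: "v n = 0" "v \<in> topspace (Euclidean_space n)"
      using v by (auto simp: eucl_box_def topspace_Euclidean_space)
    have "v(n := s) \<in> eucl_box (Suc n) (u(n := c)) (e c)"
      using v c d(2)[OF c(1)]
      by (auto simp: eucl_box_def topspace_Euclidean_space less_Suc_eq intro: less_le_trans)
    then have "?P (v(n := s)) \<in> O'" using e(2) c(1) C(1) by blast
    moreover have "(v(n := s))(n := 0) = v" using vn(1) by (metis fun_upd_triv fun_upd_upd)
    ultimately show ?thesis by simp
  qed
  then have "eventually (\<lambda>v. \<forall>s\<in>{a..b}. (p v, s) \<in> O') (eucl_nhds n u)"
    unfolding eventually_eucl_nhds[OF uT] using d(1) by blast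
  with lplot_eventually_pts[OF Y p]
  show "eventually (\<lambda>v. p v \<in> {y \<in> pts Y. \<forall>s\<in>{a..b}. (y, s) \<in> O'}) (eucl_nhds n u)"
    by eventually_elim simp
qed auto

text \<open>The real line enters as the plot \<open>w \<mapsto> (y, w 0)\<close> on
  \<open>Euclidean_space 1\<close>, along which D-open sets pull back to open sets.\<close>

lemma open_D_slice:
  assumes Y: "diffeological_space Y" and O: "openin (D_topology (prod_diff Y real_diff)) O'"
    and y: "y \<in> pts Y"
  shows "open {s. (y, s) \<in> O'}"
  unfolding open_dist
proof
  fix s assume s: "s \<in> {s. (y, s) \<in> O'}"
  let ?w = "(\<lambda>_. 0)(0 := s) :: nat \<Rightarrow> real"
  have wT: "?w \<in> topspace (Euclidean_space 1)" by (auto simp: topspace_Euclidean_space)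
  have "lplot real_diff 1 ?w (\<lambda>w. w 0)"
    unfolding lplot_real smooth_real_def
    using Ck_on_coordinate[OF openin_topspace] wT by blast
  then have "lplot (prod_diff Y real_diff) 1 ?w (\<lambda>w. (y, w 0))"
    using lplot_const[OF Y wT y] by (simp add: lplot_prod_diff[OF Y diffeological_real])
  from eventually_plot_in_D_open[OF diffeological_prod[OF Y diffeological_real] O this] s
  obtain e where e: "e > 0" "\<forall>w\<in>eucl_box 1 ?w e. (y, w 0) \<in> O'"
    unfolding eventually_eucl_nhds[OF wT] by auto
  have "(y, s') \<in> O'" if "dist s' s < e" for s'
  proof -
    have "(\<lambda>_. 0)(0 := s') \<in> eucl_box 1 ?w e"
      using that by (auto simp: eucl_box_def topspace_Euclidean_space dist_real_def)
    then show ?thesis using e(2) by force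
  qed
  then show "\<exists>e>0. \<forall>s'. dist s' s < e \<longrightarrow> s' \<in> {s. (y, s) \<in> O'}" using e(1) by blast
qed

section \<open>Partial sums of a partition of unity as time functions\<close>

context
  fixes X :: "'x diffspace" and V and \<rho>
  assumes X: "diffeological_space X" and \<rho>: "indexed_partition X V \<rho>"
begin

lemma lplot_partial_sum:
  assumes "lplot X n u a" shows "lplot real_diff n u (\<lambda>v. \<Sum>i<k. \<rho> i (a v))"
  by (intro lplot_real_sum lplot_topspace[OF assms] smooth_map_lplot[OF partition_smooth[OF X \<rho>] assms])

lemma partial_sum_nonneg: "x \<in> pts X \<Longrightarrow> 0 \<le> (\<Sum>i<k. \<rho> i x)"
  by (intro sum_nonneg partition_nonneg[OF X \<rho>])

lemma partial_sum_le_one: assumes x: "x \<in> pts X" shows "(\<Sum>i<k. \<rho> i x) \<le> 1"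
proof -
  have "(\<Sum>i<k. \<rho> i x) = (\<Sum>i\<in>{i. i < k \<and> \<rho> i x \<noteq> 0}. \<rho> i x)"
    by (rule sum.mono_neutral_right) auto
  also have "\<dots> \<le> (\<Sum>i | \<rho> i x \<noteq> 0. \<rho> i x)"
    using partition_finite[OF X \<rho> x] partition_nonneg[OF X \<rho> x] by (intro sum_mono2) auto
  finally show ?thesis using partition_sum[OF X \<rho> x] by simp
qed

text \<open>Local finiteness bounds the active indices by one \<open>N\<close> for all points of
  \<open>W\<close>; this uniformity makes the infinite composites below smooth.\<close>

lemma partition_stabilises:
  assumes x: "x \<in> pts X"
  obtains W N where "openin (D_topology X) W" "x \<in> W"
    "\<forall>y\<in>W. \<forall>k\<ge>N. \<rho> k y = 0 \<and> (\<Sum>i<k. \<rho> i y) = 1"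
proof -
  obtain W where W: "openin (D_topology X) W" "x \<in> W" and fin: "finite {n. \<exists>y\<in>W. \<rho> n y \<noteq> 0}"
    by (rule partition_locally_finite[OF X \<rho> x])
  obtain N where N: "\<forall>n\<in>{n. \<exists>y\<in>W. \<rho> n y \<noteq> 0}. n < N"
    using finite_nat_set_iff_bounded fin by blast
  have "\<rho> k y = 0 \<and> (\<Sum>i<k. \<rho> i y) = 1" if y: "y \<in> W" and k: "k \<ge> N" for y k
  proof
    have less: "i < k" if "\<rho> i y \<noteq> 0" for i
    proof -
      have "i \<in> {n. \<exists>y\<in>W. \<rho> n y \<noteq> 0}" using that y by blast
      then show ?thesis using N k by force
    qed
    then show "\<rho> k y = 0" by blast
    have "(\<Sum>i<k. \<rho> i y) = (\<Sum>i | \<rho> i y \<noteq> 0. \<rho> i y)"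
      by (rule sum.mono_neutral_right) (use less in auto)
    also have "\<dots> = 1" using y openin_D_subset[OF W(1)] by (intro partition_sum[OF X \<rho>]) blast
    finally show "(\<Sum>i<k. \<rho> i y) = 1" .
  qed
  with W show ?thesis by (intro that[of W N]) blast+
qed

end

section \<open>Equivariant maps between pullbacks of a torsor\<close>

context torsor
begin

text \<open>An equivariant map over \<open>Y\<close> from the pullback of \<open>P\<close> along
  \<open>f\<close> to the one along \<open>f'\<close>, written on \<open>P\<close> itself so that
  composition takes place in the second argument. Isomorphisms arise from it by
  \<open>associated_pullback_iso\<close>, which asks for equivariance only.\<close>

definition fibre_map :: "'y diffspace \<Rightarrow> ('y \<Rightarrow> 'x) \<Rightarrow> ('y \<Rightarrow> 'x) \<Rightarrow> ('y \<Rightarrow> 'e \<Rightarrow> 'e) \<Rightarrow> bool" where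
  "fibre_map Y f f' \<Phi> \<longleftrightarrow>
     (\<forall>y\<in>pts Y. \<forall>e\<in>pts P. \<kappa> e = f y \<longrightarrow> \<Phi> y e \<in> pts P \<and> \<kappa> (\<Phi> y e) = f' y \<and>
        (\<forall>g\<in>carrier G. \<Phi> y (\<phi> g e) = \<phi> g (\<Phi> y e))) \<and>
     (\<forall>n u a q. lplot Y n u a \<longrightarrow> lplot P n u q \<longrightarrow> eventually (\<lambda>v. \<kappa> (q v) = f (a v)) (eucl_nhds n u) \<longrightarrow>
        lplot P n u (\<lambda>v. \<Phi> (a v) (q v)))"

lemma fibre_mapD:
  assumes "fibre_map Y f f' \<Phi>"
  shows "y \<in> pts Y \<Longrightarrow> e \<in> pts P \<Longrightarrow> \<kappa> e = f y \<Longrightarrow> \<Phi> y e \<in> pts P"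
    and "y \<in> pts Y \<Longrightarrow> e \<in> pts P \<Longrightarrow> \<kappa> e = f y \<Longrightarrow> \<kappa> (\<Phi> y e) = f' y"
    and "y \<in> pts Y \<Longrightarrow> e \<in> pts P \<Longrightarrow> \<kappa> e = f y \<Longrightarrow> g \<in> carrier G \<Longrightarrow> \<Phi> y (\<phi> g e) = \<phi> g (\<Phi> y e)"
    and "lplot Y n u a \<Longrightarrow> lplot P n u q \<Longrightarrow> eventually (\<lambda>v. \<kappa> (q v) = f (a v)) (eucl_nhds n u) \<Longrightarrow>
      lplot P n u (\<lambda>v. \<Phi> (a v) (q v))"
  using assms unfolding fibre_map_def by simp_all

lemma fibre_map_id: "fibre_map Y f f (\<lambda>_ e. e)"
  by (simp add: fibre_map_def)

lemma fibre_map_comp: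
  assumes Y: "diffeological_space Y" and 1: "fibre_map Y f f' \<Phi>" and 2: "fibre_map Y f' f'' \<Phi>'"
  shows "fibre_map Y f f'' (\<lambda>y e. \<Phi>' y (\<Phi> y e))"
  unfolding fibre_map_def
proof (intro conjI ballI allI impI)
  note d1 = fibre_mapD[OF 1] and d2 = fibre_mapD[OF 2]
  fix y e assume ye: "y \<in> pts Y" "e \<in> pts P" "\<kappa> e = f y"
  note a = d1(1,2)[OF ye]
  show "\<Phi>' y (\<Phi> y e) \<in> pts P" "\<kappa> (\<Phi>' y (\<Phi> y e)) = f'' y" using d2(1,2)[OF ye(1) a] by auto
  fix g assume g: "g \<in> carrier G"
  show "\<Phi>' y (\<Phi> y (\<phi> g e)) = \<phi> g (\<Phi>' y (\<Phi> y e))"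
    using d1(3)[OF ye g] d2(3)[OF ye(1) a g] by simp
next
  note d1 = fibre_mapD[OF 1] and d2 = fibre_mapD[OF 2]
  fix n u a q assume a: "lplot Y n u a" and q: "lplot P n u q"
    and ev: "eventually (\<lambda>v. \<kappa> (q v) = f (a v)) (eucl_nhds n u)"
  have "eventually (\<lambda>v. \<kappa> (\<Phi> (a v) (q v)) = f' (a v)) (eucl_nhds n u)"
    using ev lplot_eventually_pts[OF Y a] lplot_eventually_pts[OF E q]
    by eventually_elim (rule d1(2))
  then show "lplot P n u (\<lambda>v. \<Phi>' (a v) (\<Phi> (a v) (q v)))"
    by (rule d2(4)[OF a d1(4)[OF a q ev]])
qed

text \<open>Infinite composition of steps that are the identity from some stage on, locally
  uniformly in the base. The second conclusion, that trivial steps compose to the identity, allows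
  the limit to be used again as a single step of another composite.\<close>

lemma fibre_map_limit:
  assumes Y: "diffeological_space Y"
    and \<Phi>: "\<And>k::nat. fibre_map Y (f k) (f (Suc k)) (\<Phi> k)"
    and stable: "\<And>y. y \<in> pts Y \<Longrightarrow> \<exists>W N. openin (D_topology Y) W \<and> y \<in> W \<and>
      (\<forall>z\<in>W. \<forall>k\<ge>N. f k z = f' z \<and> (\<forall>e\<in>pts P. \<kappa> e = f k z \<longrightarrow> \<Phi> k z e = e))"
  shows "\<exists>\<Psi>. fibre_map Y (f 0) f' \<Psi> \<and>
    (\<forall>y\<in>pts Y. (\<forall>k. \<forall>e\<in>pts P. \<kappa> e = f k y \<longrightarrow> \<Phi> k y e = e) \<longrightarrow>
      (\<forall>e\<in>pts P. \<kappa> e = f 0 y \<longrightarrow> \<Psi> y e = e))"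
proof -
  define \<Omega> where "\<Omega> = rec_nat (\<lambda>_ e. e) (\<lambda>k F y e. \<Phi> k y (F y e))"
  have \<Omega>0: "\<Omega> 0 = (\<lambda>_ e. e)" and \<Omega>S: "\<Omega> (Suc k) = (\<lambda>y e. \<Phi> k y (\<Omega> k y e))" for k
    by (simp_all add: \<Omega>_def)
  have \<Omega>: "fibre_map Y (f 0) (f k) (\<Omega> k)" for k
  proof (induction k)
    case 0 show ?case unfolding \<Omega>0 by (rule fibre_map_id)
  next
    case (Suc k) show ?case unfolding \<Omega>S by (rule fibre_map_comp[OF Y Suc \<Phi>])
  qed
  define good where "good z N \<longleftrightarrow> (\<forall>k\<ge>N. f k z = f' z \<and> (\<forall>e\<in>pts P. \<kappa> e = f k z \<longrightarrow> \<Phi> k z e = e))" for z N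
  \<comment> \<open>The stage is chosen pointwise; \<open>\<Psi>eq\<close> shows that any good stage
    gives the same value, so near a point one uniform \<open>N\<close> can be used.\<close>
  define M where "M z = (SOME N. good z N)" for z
  define \<Psi> where "\<Psi> z e = \<Omega> (M z) z e" for z e
  have eventually_const: "\<Omega> k z e = \<Omega> N z e"
    if "good z N" "k \<ge> N" "z \<in> pts Y" "e \<in> pts P" "\<kappa> e = f 0 z" for z N k e
    using \<open>k \<ge> N\<close>
  proof (induction k rule: dec_induct)
    case (step k)
    have "\<Omega> k z e \<in> pts P" "\<kappa> (\<Omega> k z e) = f k z" using fibre_mapD(1,2)[OF \<Omega> that(3-5)] by auto
    then have "\<Phi> k z (\<Omega> k z e) = \<Omega> k z e" using that(1) step(1) by (simp add: good_def)
    then show ?case using step by (simp add: \<Omega>S)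
  qed simp
  have \<Psi>eq: "\<Psi> z e = \<Omega> N z e" if g: "good z N" and z: "z \<in> pts Y" "e \<in> pts P" "\<kappa> e = f 0 z" for z N e
  proof -
    have M: "good z (M z)" unfolding M_def using g by (rule someI)
    have "\<Omega> (max N (M z)) z e = \<Omega> N z e" by (rule eventually_const[OF g _ z]) simp
    moreover have "\<Omega> (max N (M z)) z e = \<Omega> (M z) z e" by (rule eventually_const[OF M _ z]) simp
    ultimately show ?thesis by (simp add: \<Psi>_def)
  qed
  have ex_good: "\<exists>N. good z N" if "z \<in> pts Y" for z
    using stable[OF that] unfolding good_def by blast
  have "fibre_map Y (f 0) f' \<Psi>"
    unfolding fibre_map_def
  proof (intro conjI ballI allI impI)
    fix y e assume ye: "y \<in> pts Y" "e \<in> pts P" "\<kappa> e = f 0 y"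
    obtain N where N: "good y N" using ex_good[OF ye(1)] by blast
    have fN: "f N y = f' y" using N by (simp add: good_def)
    note d = fibre_mapD[OF \<Omega>[of N]]
    show "\<Psi> y e \<in> pts P" "\<kappa> (\<Psi> y e) = f' y"
      using d(1,2)[OF ye] fN \<Psi>eq[OF N ye] by auto
    fix g assume g: "g \<in> carrier G"
    show "\<Psi> y (\<phi> g e) = \<phi> g (\<Psi> y e)"
      using d(3)[OF ye g] \<Psi>eq[OF N ye] \<Psi>eq[OF N ye(1) act_closed[OF g ye(2)]] ye proj_act[OF g ye(2)]
      by simp
  next
    fix n u a q assume a: "lplot Y n u a" and q: "lplot P n u q"
      and ev: "eventually (\<lambda>v. \<kappa> (q v) = f 0 (a v)) (eucl_nhds n u)"
    obtain W N where W: "openin (D_topology Y) W" "a u \<in> W" "\<forall>z\<in>W. good z N"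
      using stable[OF lplot_pts[OF Y a]] unfolding good_def by blast
    have "eventually (\<lambda>v. \<Psi> (a v) (q v) = \<Omega> N (a v) (q v)) (eucl_nhds n u)"
      using ev lplot_eventually_pts[OF Y a] lplot_eventually_pts[OF E q]
        eventually_plot_in_D_open[OF Y W(1) a W(2)]
      by eventually_elim (use \<Psi>eq W(3) in blast)
    then show "lplot P n u (\<lambda>v. \<Psi> (a v) (q v))"
      by (rule lplot_cong[OF E fibre_mapD(4)[OF \<Omega> a q ev]])
  qed
  moreover have "\<Psi> y e = e" if y: "y \<in> pts Y" and id: "\<forall>k. \<forall>e\<in>pts P. \<kappa> e = f k y \<longrightarrow> \<Phi> k y e = e"
    and e: "e \<in> pts P" "\<kappa> e = f 0 y" for y e
  proof -
    have "\<Omega> k y e = e \<and> \<kappa> e = f k y" for k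
    proof (induction k)
      case (Suc k)
      then have "\<Omega> (Suc k) y e = e" using id e by (simp add: \<Omega>S)
      then show ?case using fibre_mapD(2)[OF \<Omega>[of "Suc k"] y e] by simp
    qed (use e in \<open>simp add: \<Omega>0\<close>)
    then show ?thesis by (simp add: \<Psi>_def)
  qed
  ultimately show ?thesis by (intro exI[of _ \<Psi>] conjI ballI impI) auto
qed

section \<open>Transport along homotopies by a countable family of sections\<close>

context
  fixes U :: "nat \<Rightarrow> 'x set" and \<sigma> :: "nat \<Rightarrow> 'x \<Rightarrow> 'e"
  assumes sec: "smooth_section P \<kappa> X (U j) (\<sigma> j)" and cover: "(\<Union>j. U j) = pts X"
begin

lemmas sec' = smooth_sectionD[OF sec]

text \<open>Transport for which the section \<open>\<sigma> j\<close> is parallel: the group element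
  relating \<open>e\<close> to the section is kept while the base point moves to
  \<open>b\<close>.\<close>

definition transport :: "nat \<Rightarrow> 'e \<Rightarrow> 'x \<Rightarrow> 'e" where
  "transport j e b = \<phi> (quot (\<sigma> j (\<kappa> e)) e) (\<sigma> j b)"

lemma transport:
  assumes e: "e \<in> pts P" "\<kappa> e \<in> U j" and b: "b \<in> U j"
  shows "transport j e b \<in> pts P" "\<kappa> (transport j e b) = b" "transport j e (\<kappa> e) = e"
    "g \<in> carrier G \<Longrightarrow> transport j (\<phi> g e) b = \<phi> g (transport j e b)"
proof -
  note s = sec'(2,3)[OF e(2)] and s' = sec'(2,3)[OF b]
  have k: "quot (\<sigma> j (\<kappa> e)) e \<in> carrier G" "\<phi> (quot (\<sigma> j (\<kappa> e)) e) (\<sigma> j (\<kappa> e)) = e"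
    using s e by (simp_all add: quot)
  show "transport j e b \<in> pts P" "\<kappa> (transport j e b) = b" "transport j e (\<kappa> e) = e"
    using k s' by (simp_all add: transport_def act_closed proj_act)
  show "transport j (\<phi> g e) b = \<phi> g (transport j e b)" if "g \<in> carrier G"
    using that k s s' e by (simp add: transport_def proj_act quot_act_right act_mult)
qed

lemma lplot_transport:
  assumes q: "lplot P n u q" "\<kappa> (q u) \<in> U j" and b: "lplot X n u b" "b u \<in> U j"
  shows "lplot P n u (\<lambda>v. transport j (q v) (b v))"
proof -
  have kq: "lplot X n u (\<lambda>v. \<kappa> (q v))" by (rule smooth_map_lplot[OF proj_smooth q(1)])
  have "eventually (\<lambda>v. \<kappa> (\<sigma> j (\<kappa> (q v))) = \<kappa> (q v)) (eucl_nhds n u)"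
    using eventually_plot_in_D_open[OF X sec'(1) kq q(2)] by eventually_elim (rule sec'(3))
  then show ?thesis
    unfolding transport_def by (intro act_lplot lplot_quot sec'(4)[OF kq q(2)] q(1) sec'(4)[OF b])
qed

lemma openin_homotopy_preimage:
  assumes Y: "diffeological_space Y" and H: "smooth_map (prod_diff Y real_diff) X H"
  shows "openin (D_topology (prod_diff Y real_diff)) {z \<in> pts (prod_diff Y real_diff). H z \<in> U j}"
  by (rule openin_D_preimage[OF diffeological_prod[OF Y diffeological_real] X H sec'(1)])

lemma openin_homotopy_tube:
  assumes Y: "diffeological_space Y" and H: "smooth_map (prod_diff Y real_diff) X H"
  shows "openin (D_topology Y) {y \<in> pts Y. \<forall>s\<in>{a..b}. H (y, s) \<in> U j}"
proof -
  have "{y \<in> pts Y. \<forall>s\<in>{a..b}. H (y, s) \<in> U j} =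
      {y \<in> pts Y. \<forall>s\<in>{a..b}. (y, s) \<in> {z \<in> pts (prod_diff Y real_diff). H z \<in> U j}}" by auto
  then show ?thesis using openin_D_tube[OF Y openin_homotopy_preimage[OF Y H, of j], of a b] by simp
qed

lemma lplot_homotopy:
  assumes Y: "diffeological_space Y" and H: "smooth_map (prod_diff Y real_diff) X H"
    and a: "lplot Y n u a" and t: "lplot real_diff n u t"
  shows "lplot X n u (\<lambda>v. H (a v, t v))"
  using smooth_map_lplot[OF H, of n u "\<lambda>v. (a v, t v)"] a t
  by (simp add: lplot_prod_diff[OF Y diffeological_real])

text \<open>Stage \<open>k\<close> moves the time from one partial sum to the next by transport with
  the \<open>k\<close>-th section, available on \<open>V k\<close>. The clause on constant paths is
  for \<open>fibre_map_homotopy\<close>, whose stages must be the identity where their weight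
  vanishes.\<close>

lemma fibre_map_short_homotopy:
  assumes Y: "diffeological_space Y" and sp: "smoothly_paracompact Y"
    and H: "smooth_map (prod_diff Y real_diff) X H"
    and short: "\<And>y. y \<in> pts Y \<Longrightarrow> \<exists>j. \<forall>s\<in>{0..1}. H (y, s) \<in> U j"
  shows "\<exists>\<Phi>. fibre_map Y (\<lambda>y. H (y, 0)) (\<lambda>y. H (y, 1)) \<Phi> \<and>
    (\<forall>y\<in>pts Y. (\<forall>s\<in>{0..1}. H (y, s) = H (y, 0)) \<longrightarrow>
      (\<forall>e\<in>pts P. \<kappa> e = H (y, 0) \<longrightarrow> \<Phi> y e = e))"
proof -
  define V where "V j = {y \<in> pts Y. \<forall>s\<in>{0..1}. H (y, s) \<in> U j}" for j
  have V: "openin (D_topology Y) (V j)" for j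
    unfolding V_def by (rule openin_homotopy_tube[OF Y H])
  have "(\<Union>j. V j) = pts Y" using short by (auto simp: V_def)
  from indexed_partition_exists[OF Y sp V this] obtain \<rho> where \<rho>: "indexed_partition Y V \<rho>" ..
  define \<tau> where "\<tau> k y = (\<Sum>i<k. \<rho> i y)" for k y
  have \<tau>01: "\<tau> k y \<in> {0..1}" if "y \<in> pts Y" for k y
    using partial_sum_nonneg[OF Y \<rho> that] partial_sum_le_one[OF Y \<rho> that] by (simp add: \<tau>_def)
  define f where "f k y = H (y, \<tau> k y)" for k y
  have f_same: "f (Suc k) y = f k y" if "\<rho> k y = 0" for k y
    using that by (simp add: f_def \<tau>_def)
  have fV: "f i y \<in> U k" if "y \<in> V k" for i k y
    using that \<tau>01 by (auto simp: V_def f_def)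
  \<comment> \<open>Off \<open>V k\<close> the weight \<open>\<rho> k\<close> vanishes, hence the
    two times agree and the identity maps between the right fibres.\<close>
  define \<Phi> where "\<Phi> k y e = (if y \<in> V k then transport k e (f (Suc k) y) else e)" for k y e
  \<comment> \<open>Transport to the same base point is the identity, so both branches agree
    wherever the stage does not move; this glues them smoothly across the boundary of
    \<open>V k\<close>.\<close>
  have \<Phi>_id: "\<Phi> k y e = e" if "e \<in> pts P" "\<kappa> e = f k y" "f (Suc k) y = f k y" for k y e
    using that transport(3)[of e k "f k y"] fV[of y k k] by (simp add: \<Phi>_def)
  have fm: "fibre_map Y (f k) (f (Suc k)) (\<Phi> k)" for k
    unfolding fibre_map_def
  proof (intro conjI ballI allI impI)
    fix y e assume ye: "y \<in> pts Y" "e \<in> pts P" "\<kappa> e = f k y"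
    show "\<Phi> k y e \<in> pts P" "\<kappa> (\<Phi> k y e) = f (Suc k) y"
    proof -
      have "\<Phi> k y e \<in> pts P \<and> \<kappa> (\<Phi> k y e) = f (Suc k) y"
      proof (cases "y \<in> V k")
        case True
        then show ?thesis using transport(1,2)[OF ye(2)] fV ye(3) by (simp add: \<Phi>_def)
      next
        case False
        then have "\<rho> k y = 0" using partition_pos_imp[OF Y \<rho> ye(1)] by blast
        then show ?thesis using ye \<Phi>_id f_same by simp
      qed
      then show "\<Phi> k y e \<in> pts P" "\<kappa> (\<Phi> k y e) = f (Suc k) y" by auto
    qed
    fix g assume g: "g \<in> carrier G"
    show "\<Phi> k y (\<phi> g e) = \<phi> g (\<Phi> k y e)"
      using transport(4)[OF ye(2) _ _ g] fV ye(3) by (simp add: \<Phi>_def)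
  next
    fix n u a q assume a: "lplot Y n u a" and q: "lplot P n u q"
      and ev: "eventually (\<lambda>v. \<kappa> (q v) = f k (a v)) (eucl_nhds n u)"
    show "lplot P n u (\<lambda>v. \<Phi> k (a v) (q v))"
    proof (cases "a u \<in> V k")
      case True
      have fa: "lplot X n u (\<lambda>v. f (Suc k) (a v))"
        unfolding f_def \<tau>_def by (intro lplot_homotopy[OF Y H a] lplot_partial_sum[OF Y \<rho> a])
      have qU: "\<kappa> (q u) \<in> U k"
        using eventually_nhdsin_self[OF ev lplot_topspace[OF a]] fV[OF True] by simp
      have "eventually (\<lambda>v. \<Phi> k (a v) (q v) = transport k (q v) (f (Suc k) (a v))) (eucl_nhds n u)"
        using eventually_plot_in_D_open[OF Y V a True] by eventually_elim (simp add: \<Phi>_def)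
      then show ?thesis
        by (rule lplot_cong[OF E lplot_transport[OF q qU fa fV[OF True]]])
    next
      case False
      then obtain W where W: "openin (D_topology Y) W" "a u \<in> W" "\<forall>y\<in>W. \<rho> k y = 0"
        using partition_support[OF Y \<rho> lplot_pts[OF Y a]] by blast
      have "eventually (\<lambda>v. \<Phi> k (a v) (q v) = q v) (eucl_nhds n u)"
        using ev eventually_plot_in_D_open[OF Y W(1) a W(2)] lplot_eventually_pts[OF E q]
        by eventually_elim (use W(3) \<Phi>_id f_same in simp)
      then show ?thesis by (rule lplot_cong[OF E q])
    qed
  qed
  have stable: "\<exists>W N. openin (D_topology Y) W \<and> y \<in> W \<and>
      (\<forall>z\<in>W. \<forall>k\<ge>N. f k z = H (z, 1) \<and> (\<forall>e\<in>pts P. \<kappa> e = f k z \<longrightarrow> \<Phi> k z e = e))"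
    if y: "y \<in> pts Y" for y
  proof -
    obtain W N where W: "openin (D_topology Y) W" "y \<in> W"
      "\<forall>z\<in>W. \<forall>k\<ge>N. \<rho> k z = 0 \<and> (\<Sum>i<k. \<rho> i z) = 1"
      by (rule partition_stabilises[OF Y \<rho> y])
    have "f k z = H (z, 1) \<and> (\<forall>e\<in>pts P. \<kappa> e = f k z \<longrightarrow> \<Phi> k z e = e)" if "z \<in> W" "k \<ge> N" for z k
    proof -
      have "f k z = H (z, 1)" using W(3)[rule_format, OF that] by (simp add: f_def \<tau>_def)
      moreover have "f (Suc k) z = f k z" using W(3)[rule_format, OF that] by (intro f_same) simp
      ultimately show ?thesis using \<Phi>_id by simp
    qed
    with W(1,2) show ?thesis by blast
  qed
  have "\<exists>\<Psi>. fibre_map Y (f 0) (\<lambda>y. H (y, 1)) \<Psi> \<and>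
    (\<forall>y\<in>pts Y. (\<forall>k. \<forall>e\<in>pts P. \<kappa> e = f k y \<longrightarrow> \<Phi> k y e = e) \<longrightarrow>
      (\<forall>e\<in>pts P. \<kappa> e = f 0 y \<longrightarrow> \<Psi> y e = e))"
    by (rule fibre_map_limit[OF Y fm stable])
  then obtain \<Psi> where \<Psi>': "fibre_map Y (f 0) (\<lambda>y. H (y, 1)) \<Psi> \<and>
    (\<forall>y\<in>pts Y. (\<forall>k. \<forall>e\<in>pts P. \<kappa> e = f k y \<longrightarrow> \<Phi> k y e = e) \<longrightarrow>
      (\<forall>e\<in>pts P. \<kappa> e = f 0 y \<longrightarrow> \<Psi> y e = e))" ..
  note \<Psi> = conjunct1[OF \<Psi>'] conjunct2[OF \<Psi>']
  have f0: "f 0 = (\<lambda>y. H (y, 0))" by (simp add: f_def \<tau>_def fun_eq_iff)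
  have "\<forall>k. \<forall>e\<in>pts P. \<kappa> e = f k y \<longrightarrow> \<Phi> k y e = e"
    if y: "y \<in> pts Y" and const: "\<forall>s\<in>{0..1}. H (y, s) = H (y, 0)" for y
  proof -
    have "f k y = H (y, 0)" for k unfolding f_def by (rule bspec[OF const \<tau>01[OF y]])
    then show ?thesis using \<Phi>_id by simp
  qed
  then have "\<forall>y\<in>pts Y. (\<forall>s\<in>{0..1}. H (y, s) = H (y, 0)) \<longrightarrow>
      (\<forall>e\<in>pts P. \<kappa> e = f 0 y \<longrightarrow> \<Psi> y e = e)"
    using \<Psi>(2) by blast
  with \<Psi>(1) show ?thesis unfolding f0 by (intro exI[of _ \<Psi>] conjI)
qed

text \<open>The windows are two cells of width \<open>1 / real (Suc N)\<close> wide: an interval no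
  longer than one cell starts in some cell and ends at the latest in the next one, so it fits into a
  window.\<close>

definition subdivided :: "'y diffspace \<Rightarrow> ('y \<times> real \<Rightarrow> 'x) \<Rightarrow> nat \<Rightarrow> 'y set" where
  "subdivided Y H N = {y \<in> pts Y. \<forall>k\<le>N. \<exists>j. \<forall>s\<in>{real k / real (Suc N)..real (k + 2) / real (Suc N)}. H (y, s) \<in> U j}"

lemma openin_subdivided:
  assumes Y: "diffeological_space Y" and H: "smooth_map (prod_diff Y real_diff) X H"
  shows "openin (D_topology Y) (subdivided Y H N)"
proof -
  let ?I = "\<lambda>k. {real k / real (Suc N)..real (k + 2) / real (Suc N)}"
  have "subdivided Y H N = (\<Inter>k\<in>{..N}. \<Union>j. {y \<in> pts Y. \<forall>s\<in>?I k. H (y, s) \<in> U j})"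
    by (auto simp: subdivided_def)
  moreover have "openin (D_topology Y) (\<Inter>k\<in>{..N}. \<Union>j. {y \<in> pts Y. \<forall>s\<in>?I k. H (y, s) \<in> U j})"
    by (intro openin_INT2 openin_Union ballI) (auto intro: openin_homotopy_tube[OF Y H])
  ultimately show ?thesis by simp
qed

lemma subdivided_cover:
  assumes Y: "diffeological_space Y" and H: "smooth_map (prod_diff Y real_diff) X H"
    and y: "y \<in> pts Y"
  shows "\<exists>N. y \<in> subdivided Y H N"
proof -
  let ?C = "range (\<lambda>j. {s. H (y, s) \<in> U j})"
  have op: "open {s. H (y, s) \<in> U j}" for j
    using open_D_slice[OF Y openin_homotopy_preimage[OF Y H, of j] y] y by simp
  \<comment> \<open>The windows with \<open>k \<le> N\<close> reach beyond 1, up to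
    \<open>(N + 2) / (N + 1)\<close>; the interval \<open>{0..3}\<close> contains them all.\<close>
  have "{0..3} \<subseteq> \<Union>?C"
  proof
    fix s :: real
    have "H (y, s) \<in> (\<Union>j. U j)" using smooth_map_pts[OF H, of "(y, s)"] y cover by simp
    then show "s \<in> \<Union>?C" by simp
  qed
  moreover have "open B" if "B \<in> ?C" for B using that op by auto
  ultimately obtain \<delta> where \<delta>: "0 < \<delta>" "\<And>T. T \<subseteq> {0..3::real} \<Longrightarrow> diameter T < \<delta> \<Longrightarrow> \<exists>B\<in>?C. T \<subseteq> B"
    using Lebesgue_number_lemma[OF compact_Icc, of ?C 0 3] by blast
  \<comment> \<open>A window has length \<open>2 / real (Suc N)\<close>, which has to be below the
    Lebesgue number \<open>\<delta>\<close>.\<close>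
  obtain N where N: "2 / \<delta> < real (Suc N)" using reals_Archimedean2[of "2 / \<delta>"]
    by (metis less_trans lessI of_nat_less_iff)
  have "\<exists>j. \<forall>s\<in>{real k / real (Suc N)..real (k + 2) / real (Suc N)}. H (y, s) \<in> U j" if k: "k \<le> N" for k
  proof -
    let ?T = "{real k / real (Suc N)..real (k + 2) / real (Suc N)}"
    have "real (k + 2) / real (Suc N) \<le> 3" using k by (simp add: divide_le_eq)
    then have sub: "?T \<subseteq> {0..3}" by auto
    have "real k / real (Suc N) \<le> real (k + 2) / real (Suc N)" by (simp add: divide_right_mono)
    then have "diameter ?T = real (k + 2) / real (Suc N) - real k / real (Suc N)"
      unfolding diameter_closed_interval by (simp only: not_less[symmetric] if_False)
    also have "\<dots> = 2 / real (Suc N)" by (simp add: diff_divide_distrib[symmetric])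
    also have "\<dots> < \<delta>" using N \<delta>(1) by (simp add: divide_less_eq mult.commute)
    finally have "diameter ?T < \<delta>" .
    from \<delta>(2)[OF sub this] show ?thesis by auto
  qed
  with y have "y \<in> subdivided Y H N" by (simp add: subdivided_def)
  then show ?thesis ..
qed

lemma fibre_map_homotopy:
  assumes Y: "diffeological_space Y" and sp: "smoothly_paracompact Y"
    and H: "smooth_map (prod_diff Y real_diff) X H"
  shows "\<exists>\<Phi>. fibre_map Y (\<lambda>y. H (y, 0)) (\<lambda>y. H (y, 1)) \<Phi>"
proof -
  note YR = diffeological_prod[OF Y diffeological_real]
  have "(\<Union>N. subdivided Y H N) = pts Y"
    using subdivided_cover[OF Y H] by (auto simp: subdivided_def)
  from indexed_partition_exists[OF Y sp openin_subdivided[OF Y H] this]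
  obtain \<rho> where \<rho>: "indexed_partition Y (subdivided Y H) \<rho>" ..
  define \<tau> where "\<tau> N y = (\<Sum>i<N. \<rho> i y)" for N y
  have \<tau>: "0 \<le> \<tau> N y" "\<tau> N y + \<rho> N y \<le> 1" "0 \<le> \<rho> N y" if "y \<in> pts Y" for N y
    using partial_sum_nonneg[OF Y \<rho> that, of N] partial_sum_le_one[OF Y \<rho> that, of "Suc N"]
      partition_nonneg[OF Y \<rho> that] by (simp_all add: \<tau>_def)
  \<comment> \<open>The time after \<open>c\<close> of the \<open>Suc N\<close> equal parts of stage
    \<open>N\<close>: it runs from \<open>\<tau> N\<close> to \<open>\<tau> (Suc N)\<close> and does
    not depend on \<open>c\<close> where \<open>\<rho> N\<close> vanishes.\<close>
  define h where "h N c y = \<tau> N y + c / real (Suc N) * \<rho> N y" for N c y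
  have step: "\<exists>\<Phi>. fibre_map Y (\<lambda>y. H (y, h N (real k) y)) (\<lambda>y. H (y, h N (real (Suc k)) y)) \<Phi> \<and>
      (\<forall>y\<in>pts Y. \<rho> N y = 0 \<longrightarrow> (\<forall>e\<in>pts P. \<kappa> e = H (y, h N (real k) y) \<longrightarrow> \<Phi> y e = e))"
    if k: "k \<le> N" for N k
  proof -
    \<comment> \<open>Part \<open>k\<close> of stage \<open>N\<close>, rescaled so that its time
      runs over \<open>{0..1}\<close>, is again a smooth homotopy.\<close>
    let ?H = "\<lambda>z. H (fst z, h N (real k + snd z) (fst z))"
    have H': "smooth_map (prod_diff Y real_diff) X ?H"
    proof (rule smooth_mapI[OF YR X])
      show "?H z \<in> pts X" if "z \<in> pts (prod_diff Y real_diff)" for z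
        using that by (intro smooth_map_pts[OF H]) auto
      fix n u p assume p: "lplot (prod_diff Y real_diff) n u p"
      then have p1: "lplot Y n u (\<lambda>v. fst (p v))" and p2: "lplot real_diff n u (\<lambda>v. snd (p v))"
        by (auto simp: lplot_prod_diff[OF Y diffeological_real])
      have "lplot real_diff n u (\<lambda>v. \<tau> N (fst (p v)) +
          ((real k + snd (p v)) * (1 / real (Suc N))) * \<rho> N (fst (p v)))"
        unfolding \<tau>_def
        by (intro lplot_real_add lplot_real_mult lplot_real_const lplot_topspace[OF p1] p2
            lplot_partial_sum[OF Y \<rho> p1] smooth_map_lplot[OF partition_smooth[OF Y \<rho>] p1])
      then show "lplot X n u (\<lambda>v. ?H (p v))"
        by (intro lplot_homotopy[OF Y H p1]) (simp add: h_def)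
    qed
    have short: "\<exists>j. \<forall>s\<in>{0..1}. ?H (y, s) \<in> U j" if y: "y \<in> pts Y" for y
    proof (cases "\<rho> N y = 0")
      case True
      have "H (y, \<tau> N y) \<in> (\<Union>j. U j)" using smooth_map_pts[OF H, of "(y, \<tau> N y)"] y cover by simp
      then show ?thesis using True by (simp add: h_def)
    next
      case False
      then have yN: "y \<in> subdivided Y H N" using partition_pos_imp[OF Y \<rho> y] by blast
      let ?n = "real (Suc N)"
      define c where "c = h N (real k) y"
      have c0: "0 \<le> c" using \<tau>[OF y, of N] by (simp add: c_def h_def)
      have "real k / ?n * \<rho> N y \<le> 1 * \<rho> N y"
        using k \<tau>(3)[OF y, of N] by (intro mult_right_mono) (simp_all add: divide_le_eq)
      then have c1: "c \<le> 1" using \<tau>(2)[OF y, of N] by (simp add: c_def h_def)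
      \<comment> \<open>Index of the grid cell in which the part starts. For \<open>c = 1\<close>
        the floor would be \<open>N + 1\<close>, so it is capped at \<open>N\<close>, the last
        window.\<close>
      define m where "m = min N (nat \<lfloor>c * ?n\<rfloor>)"
      have m1: "real m \<le> c * ?n"
      proof -
        have "real m \<le> real (nat \<lfloor>c * ?n\<rfloor>)" by (simp add: m_def)
        also have "\<dots> \<le> c * ?n" using c0 by (intro of_nat_floor) simp
        finally show ?thesis .
      qed
      have m2: "c * ?n \<le> real m + 1"
      proof (cases "nat \<lfloor>c * ?n\<rfloor> \<le> N")
        case True
        then show ?thesis using c0 by (simp add: m_def)
      next
        case False
        then have "real m = real N" by (simp add: m_def)
        moreover have "c * ?n \<le> 1 * ?n" by (rule mult_right_mono[OF c1]) simp
        moreover have "1 * ?n = real N + 1" by simp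
        ultimately show ?thesis by linarith
      qed
      have "m \<le> N" by (simp add: m_def)
      moreover have "\<forall>k\<le>N. \<exists>j. \<forall>s\<in>{real k / ?n..real (k + 2) / ?n}. H (y, s) \<in> U j"
        using yN unfolding subdivided_def mem_Collect_eq by (rule conjunct2)
      ultimately obtain j where j: "\<forall>s\<in>{real m / ?n..real (m + 2) / ?n}. H (y, s) \<in> U j"
        by blast
      have "?H (y, s) \<in> U j" if s: "s \<in> {0..1}" for s
      proof -
        have r1: "\<rho> N y \<le> 1" using \<tau>[OF y, of N] by linarith
        \<comment> \<open>Measured in cells, the part has length \<open>\<rho> N y\<close>, at most
          1; starting between \<open>m\<close> and \<open>m + 1\<close> it ends at the latest at
          \<open>m + 2\<close>.\<close>
        have hs: "h N (real k + s) y * ?n = c * ?n + s * \<rho> N y"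
          by (simp add: h_def c_def field_simps)
        have "0 \<le> s * \<rho> N y" "s * \<rho> N y \<le> 1"
          using s \<tau>(3)[OF y, of N] r1 by (auto intro: mult_le_one)
        then have "real m \<le> h N (real k + s) y * ?n" "h N (real k + s) y * ?n \<le> real (m + 2)"
          using hs m1 m2 by auto
        then have "h N (real k + s) y \<in> {real m / ?n..real (m + 2) / ?n}"
          by (simp add: divide_le_eq le_divide_eq)
        then show ?thesis using j by simp
      qed
      then show ?thesis by blast
    qed
    obtain \<Phi> where \<Phi>: "fibre_map Y (\<lambda>y. ?H (y, 0)) (\<lambda>y. ?H (y, 1)) \<Phi>"
      "\<forall>y\<in>pts Y. (\<forall>s\<in>{0..1}. ?H (y, s) = ?H (y, 0)) \<longrightarrow>
        (\<forall>e\<in>pts P. \<kappa> e = ?H (y, 0) \<longrightarrow> \<Phi> y e = e)"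
      using fibre_map_short_homotopy[OF Y sp H' short] by blast
    have "\<forall>y\<in>pts Y. \<rho> N y = 0 \<longrightarrow> (\<forall>e\<in>pts P. \<kappa> e = H (y, h N (real k) y) \<longrightarrow> \<Phi> y e = e)"
      using \<Phi>(2) by (simp add: h_def)
    with \<Phi>(1) show ?thesis by (intro exI[of _ \<Phi>]) (simp add: add.commute)
  qed
  have steps: "\<exists>\<Phi>. fibre_map Y (\<lambda>y. H (y, h N 0 y)) (\<lambda>y. H (y, h N (real k) y)) \<Phi> \<and>
      (\<forall>y\<in>pts Y. \<rho> N y = 0 \<longrightarrow> (\<forall>e\<in>pts P. \<kappa> e = H (y, h N 0 y) \<longrightarrow> \<Phi> y e = e))"
    if "k \<le> Suc N" for N k
    using that
  proof (induction k)
    case 0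
    show ?case using fibre_map_id[of Y "\<lambda>y. H (y, h N 0 y)"] by (intro exI[of _ "\<lambda>_ e. e"]) simp
  next
    case (Suc k)
    obtain \<Phi> where \<Phi>: "fibre_map Y (\<lambda>y. H (y, h N 0 y)) (\<lambda>y. H (y, h N (real k) y)) \<Phi>"
      "\<forall>y\<in>pts Y. \<rho> N y = 0 \<longrightarrow> (\<forall>e\<in>pts P. \<kappa> e = H (y, h N 0 y) \<longrightarrow> \<Phi> y e = e)"
      using Suc.IH Suc.prems by auto
    have "k \<le> N" using Suc.prems by simp
    from step[OF this] obtain \<Phi>' where
      \<Phi>': "fibre_map Y (\<lambda>y. H (y, h N (real k) y)) (\<lambda>y. H (y, h N (real (Suc k)) y)) \<Phi>'"
      "\<forall>y\<in>pts Y. \<rho> N y = 0 \<longrightarrow> (\<forall>e\<in>pts P. \<kappa> e = H (y, h N (real k) y) \<longrightarrow> \<Phi>' y e = e)"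
      by blast
    \<comment> \<open>Where the weight vanishes all times of stage \<open>N\<close> coincide, so the
      identity clauses of both maps concern the same fibre.\<close>
    have "\<Phi>' y (\<Phi> y e) = e" if "y \<in> pts Y" "\<rho> N y = 0" "e \<in> pts P" "\<kappa> e = H (y, h N 0 y)" for y e
    proof -
      have "h N (real k) y = h N 0 y" using that(2) by (simp add: h_def)
      then show ?thesis using \<Phi>(2) \<Phi>'(2) that by simp
    qed
    then show ?case
      using fibre_map_comp[OF Y \<Phi>(1) \<Phi>'(1)] by (intro exI[of _ "\<lambda>y e. \<Phi>' y (\<Phi> y e)"]) simp
  qed
  have h0: "h N 0 y = \<tau> N y" and hS: "h N (real (Suc N)) y = \<tau> (Suc N) y" for N y
    by (simp_all add: h_def \<tau>_def del: of_nat_Suc)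
  have "\<exists>\<Phi>. fibre_map Y (\<lambda>y. H (y, \<tau> N y)) (\<lambda>y. H (y, \<tau> (Suc N) y)) \<Phi> \<and>
      (\<forall>y\<in>pts Y. \<rho> N y = 0 \<longrightarrow> (\<forall>e\<in>pts P. \<kappa> e = H (y, \<tau> N y) \<longrightarrow> \<Phi> y e = e))" for N
    using steps[of "Suc N" N] unfolding h0 hS by simp
  then obtain \<Phi> where \<Phi>: "\<And>N. fibre_map Y (\<lambda>y. H (y, \<tau> N y)) (\<lambda>y. H (y, \<tau> (Suc N) y)) (\<Phi> N)"
    and \<Phi>_id: "\<And>N y e. y \<in> pts Y \<Longrightarrow> \<rho> N y = 0 \<Longrightarrow> e \<in> pts P \<Longrightarrow> \<kappa> e = H (y, \<tau> N y) \<Longrightarrow> \<Phi> N y e = e"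
    by metis
  have stable: "\<exists>W N. openin (D_topology Y) W \<and> y \<in> W \<and>
      (\<forall>z\<in>W. \<forall>k\<ge>N. H (z, \<tau> k z) = H (z, 1) \<and> (\<forall>e\<in>pts P. \<kappa> e = H (z, \<tau> k z) \<longrightarrow> \<Phi> k z e = e))"
    if y: "y \<in> pts Y" for y
  proof -
    obtain W N where W: "openin (D_topology Y) W" "y \<in> W"
      "\<forall>z\<in>W. \<forall>k\<ge>N. \<rho> k z = 0 \<and> (\<Sum>i<k. \<rho> i z) = 1"
      by (rule partition_stabilises[OF Y \<rho> y])
    have "H (z, \<tau> k z) = H (z, 1) \<and> (\<forall>e\<in>pts P. \<kappa> e = H (z, \<tau> k z) \<longrightarrow> \<Phi> k z e = e)"
      if z: "z \<in> W" "k \<ge> N" for z k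
    proof -
      have "z \<in> pts Y" using z(1) openin_D_subset[OF W(1)] by blast
      then show ?thesis using W(3)[rule_format, OF z] \<Phi>_id by (simp add: \<tau>_def)
    qed
    with W(1,2) show ?thesis by blast
  qed
  have "\<exists>\<Psi>. fibre_map Y (\<lambda>y. H (y, \<tau> 0 y)) (\<lambda>y. H (y, 1)) \<Psi> \<and>
    (\<forall>y\<in>pts Y. (\<forall>k. \<forall>e\<in>pts P. \<kappa> e = H (y, \<tau> k y) \<longrightarrow> \<Phi> k y e = e) \<longrightarrow>
      (\<forall>e\<in>pts P. \<kappa> e = H (y, \<tau> 0 y) \<longrightarrow> \<Psi> y e = e))"
    by (rule fibre_map_limit[OF Y \<Phi> stable])
  then show ?thesis by (auto simp: \<tau>_def)
qed

end

end

section \<open>The classification\<close>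

context associated
begin

lemma associated_of_pullback:
  assumes Y: "diffeological_space Y" and f: "smooth_map Y X f"
  shows "bundle_iso (associated_space G (pullback_space Y f P \<kappa>) (\<lambda>g z. (fst z, \<phi> g (snd z))) F \<psi>)
    (associated_proj fst) (pullback_space Y f A A_proj) fst"
proof (rule associated_pullback_iso[OF associated_axioms torsor_pullback[OF Y f]])
  show "smooth_map (pullback_space Y f P \<kappa>) P snd"
    by (rule smooth_mapI[OF diffeological_pullback[OF Y E] E])
      (auto simp: pts_pullback_space lplot_pullback[OF Y E])
qed (auto simp: pts_pullback_space)

lemma pullback_structured_model:
  fixes Y :: "'y diffspace"
  assumes Y: "diffeological_space Y" and f: "smooth_map Y X f" and ls: "locally_sectioned P \<kappa> X"
  shows "\<exists>(B :: ('y \<times> 'f) diffspace) \<pi>. structured_bundle G DG F \<psi> Y B \<pi> \<and>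
    bundle_iso B \<pi> (pullback_space Y f A A_proj) fst"
proof -
  interpret Q: torsor G DG "pullback_space Y f P \<kappa>" "\<lambda>g z. (fst z, \<phi> g (snd z))" fst Y
    by (rule torsor_pullback[OF Y f])
  interpret Q: associated G DG "pullback_space Y f P \<kappa>" "\<lambda>g z. (fst z, \<phi> g (snd z))" fst Y F \<psi>
    by unfold_locales
  obtain B :: "('y \<times> 'f) diffspace" and \<pi> where B: "structured_bundle G DG F \<psi> Y B \<pi>"
    and iso: "bundle_iso B \<pi> Q.A Q.A_proj"
    using Q.structured_model[OF locally_sectioned_pullback[OF Y f ls]] by blast
  have "diffeological_space B"
    using B by (simp add: structured_bundle_def diffeological_fibre_bundle_def)
  from bundle_iso_trans[OF this Q.diffeological_A diffeological_pullback[OF Y diffeological_A]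
      iso associated_of_pullback[OF Y f]]
  show ?thesis using B by blast
qed

text \<open>On the pullback of \<open>P\<close> along \<open>f\<close>, the map
  \<open>z \<mapsto> \<Phi> (fst z) (snd z)\<close> covers \<open>f'\<close>, whereas
  \<open>snd\<close> covers \<open>f\<close>; the bundle associated with that pullback is thus
  isomorphic to both sides.\<close>

lemma homotopic_pullback_iso:
  assumes sec: "\<And>j::nat. smooth_section P \<kappa> X (U j) (\<sigma> j)" and cover: "(\<Union>j. U j) = pts X"
    and Y: "diffeological_space Y" and sp: "smoothly_paracompact Y"
    and hom: "(f, f') \<in> smooth_homotopy_rel Y X"
  shows "bundle_iso (pullback_space Y f A A_proj) fst (pullback_space Y f' A A_proj) fst"
proof -
  obtain H where f: "smooth_map Y X f" and H: "smooth_map (prod_diff Y real_diff) X H"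
    and H01: "\<And>y. y \<in> pts Y \<Longrightarrow> H (y, 0) = f y" "\<And>y. y \<in> pts Y \<Longrightarrow> H (y, 1) = f' y"
    using hom by (auto simp: smooth_homotopy_rel_def)
  have "\<exists>\<Phi>. fibre_map Y (\<lambda>y. H (y, 0)) (\<lambda>y. H (y, 1)) \<Phi>"
    by (rule fibre_map_homotopy[OF sec cover Y sp H])
  then obtain \<Phi> where \<Phi>: "fibre_map Y (\<lambda>y. H (y, 0)) (\<lambda>y. H (y, 1)) \<Phi>" ..
  note d = fibre_mapD[OF \<Phi>]
  note pb = diffeological_pullback[OF Y E, of f \<kappa>]
  let ?Q = "pullback_space Y f P \<kappa>" and ?\<omega> = "\<lambda>g z. (fst z, \<phi> g (snd z))"
  have Q: "fst z \<in> pts Y" "snd z \<in> pts P" "\<kappa> (snd z) = H (fst z, 0)" if "z \<in> pts ?Q" for z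
    using that H01(1) by (auto simp: pts_pullback_space)
  interpret Q: torsor G DG ?Q ?\<omega> fst Y by (rule torsor_pullback[OF Y f])
  interpret Q: associated G DG ?Q ?\<omega> fst Y F \<psi> by unfold_locales
  have 1: "bundle_iso Q.A Q.A_proj (pullback_space Y f' A A_proj) fst"
  proof (rule associated_pullback_iso[OF associated_axioms Q.torsor_axioms])
    show "smooth_map ?Q P (\<lambda>z. \<Phi> (fst z) (snd z))"
    proof (rule smooth_mapI[OF pb E])
      fix n u p assume p: "lplot ?Q n u p"
      have "eventually (\<lambda>v. \<kappa> (snd (p v)) = H (fst (p v), 0)) (eucl_nhds n u)"
        using lplot_eventually_pts[OF pb p] by eventually_elim (rule Q(3))
      then show "lplot P n u (\<lambda>v. \<Phi> (fst (p v)) (snd (p v)))"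
        using p by (intro d(4)) (simp_all add: lplot_pullback[OF Y E])
    qed (use d(1) Q in blast)
    show "\<kappa> (\<Phi> (fst e) (snd e)) = f' (fst e)" if "e \<in> pts ?Q" for e
      using d(2)[OF Q[OF that]] H01(2) Q(1)[OF that] by simp
    show "\<Phi> (fst (?\<omega> g e)) (snd (?\<omega> g e)) = \<phi> g (\<Phi> (fst e) (snd e))"
      if "g \<in> carrier G" "e \<in> pts ?Q" for g e
      using d(3)[OF Q[OF that(2)] that(1)] by simp
  qed
  note A0 = diffeological_pullback[OF Y diffeological_A, of f A_proj]
    and A1 = diffeological_pullback[OF Y diffeological_A, of f' A_proj]
  show ?thesis
    by (rule bundle_iso_trans[OF A0 Q.diffeological_A A1
          bundle_iso_sym[OF Q.diffeological_A A0 associated_of_pullback[OF Y f]] 1])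
qed

end

section \<open>The natural map and its properties\<close>

locale milnor_associated = smooth_gspace G DG F \<psi>
  for G (structure) and DG :: "'g diffspace" and F :: "'f diffspace" and \<psi> :: "'g \<Rightarrow> 'f \<Rightarrow> 'f"
begin

sublocale MA: associated G DG EG "milnor_action G" M_proj BG F \<psi>
  by unfold_locales

text \<open>The natural map. Collecting all bundles isomorphic to a pullback along some member of
  \<open>c\<close> yields an isomorphism class in the prescribed type without choosing a
  representative.\<close>

definition classified ::
  "'y diffspace \<Rightarrow> ('y \<Rightarrow> ((nat \<Rightarrow> real) \<times> (nat \<Rightarrow> 'g)) set set) set \<Rightarrow> ('y, 'f) fbundle set" where
  "classified Y c = {(B, \<pi>). (B, \<pi>) \<in> bundles G DG F \<psi> Y \<and>
     (\<exists>f\<in>c. bundle_iso B \<pi> (pullback_space Y f MA.A MA.A_proj) fst)}"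

lemma bundles_diffeological: "(B, \<pi>) \<in> bundles G DG F \<psi> Y \<Longrightarrow> diffeological_space B"
  by (simp add: bundles_def structured_bundle_def diffeological_fibre_bundle_def)

lemma homotopic_iso:
  assumes "HSP Y" "(f, f') \<in> smooth_homotopy_rel Y BG"
  shows "bundle_iso (pullback_space Y f MA.A MA.A_proj) fst (pullback_space Y f' MA.A MA.A_proj) fst"
proof (rule MA.homotopic_pullback_iso[OF smooth_section_M])
  show "(\<Union>j. M_proj ` nonzero_at j) = pts BG"
    using M_section_cover nonzero_at_subset smooth_map_pts[OF EG.proj_smooth] by fast
qed (use assms in \<open>auto simp: HSP_def\<close>)

lemma homotopy_refl:
  assumes Y: "diffeological_space Y" and f: "smooth_map Y BG f"
  shows "(f, f) \<in> smooth_homotopy_rel Y BG"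
proof -
  have "smooth_map (prod_diff Y real_diff) Y fst"
    by (rule smooth_mapI[OF diffeological_prod[OF Y diffeological_real] Y])
      (auto simp: lplot_prod_diff[OF Y diffeological_real])
  from smooth_map_comp[OF this f] f show ?thesis
    by (auto simp: smooth_homotopy_rel_def intro!: exI[of _ "\<lambda>x. f (fst x)"])
qed

lemma bundle_model:
  assumes Y: "diffeological_space Y" and f: "smooth_map Y BG f"
  obtains B \<pi> where "(B, \<pi>) \<in> bundles G DG F \<psi> Y"
    "bundle_iso B \<pi> (pullback_space Y f MA.A MA.A_proj) fst"
  using MA.pullback_structured_model[OF Y f locally_sectioned_EG] that by (auto simp: bundles_def)

abbreviation "iso_rel Y \<equiv> {((B, \<pi>), (B', \<pi>')). (B, \<pi>) \<in> bundles G DG F \<psi> Y \<and>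
  (B', \<pi>') \<in> bundles G DG F \<psi> Y \<and> bundle_iso B \<pi> B' \<pi>'}"

text \<open>One representative \<open>f\<close> with one model \<open>B\<close> determines the
  value: every member of the class is joined to \<open>f\<close> by a homotopy, and
  \<open>homotopic_iso\<close> identifies the pullbacks.\<close>

lemma classified_homotopy_class:
  assumes hsp: "HSP Y" and f: "smooth_map Y BG f"
    and B: "(B, \<pi>) \<in> bundles G DG F \<psi> Y" and iso: "bundle_iso B \<pi> (pullback_space Y f MA.A MA.A_proj) fst"
  shows "classified Y (smooth_homotopy_rel Y BG `` {f}) = iso_rel Y `` {(B, \<pi>)}"
proof -
  have Y: "diffeological_space Y" using hsp by (simp add: HSP_def)
  note Bd = bundles_diffeological[OF B] and pb = diffeological_pullback[OF Y MA.diffeological_A]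
  have "(\<exists>f'\<in>smooth_homotopy_rel Y BG `` {f}.
      bundle_iso B' \<pi>' (pullback_space Y f' MA.A MA.A_proj) fst) \<longleftrightarrow> bundle_iso B \<pi> B' \<pi>'"
    if B': "(B', \<pi>') \<in> bundles G DG F \<psi> Y" for B' \<pi>'
  proof
    note Bd' = bundles_diffeological[OF B']
    assume "\<exists>f'\<in>smooth_homotopy_rel Y BG `` {f}. bundle_iso B' \<pi>' (pullback_space Y f' MA.A MA.A_proj) fst"
    then obtain f' where f': "(f, f') \<in> smooth_homotopy_rel Y BG"
      and iso': "bundle_iso B' \<pi>' (pullback_space Y f' MA.A MA.A_proj) fst"
      by blast
    have "bundle_iso B \<pi> (pullback_space Y f' MA.A MA.A_proj) fst"
      by (rule bundle_iso_trans[OF Bd pb pb iso homotopic_iso[OF hsp f']])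
    then show "bundle_iso B \<pi> B' \<pi>'"
      by (rule bundle_iso_trans[OF Bd pb Bd' _ bundle_iso_sym[OF Bd' pb iso']])
  next
    note Bd' = bundles_diffeological[OF B']
    assume "bundle_iso B \<pi> B' \<pi>'"
    then have "bundle_iso B' \<pi>' (pullback_space Y f MA.A MA.A_proj) fst"
      by (rule bundle_iso_trans[OF Bd' Bd pb bundle_iso_sym[OF Bd Bd'] iso])
    moreover have "f \<in> smooth_homotopy_rel Y BG `` {f}" using homotopy_refl[OF Y f] by simp
    ultimately show "\<exists>f'\<in>smooth_homotopy_rel Y BG `` {f}.
        bundle_iso B' \<pi>' (pullback_space Y f' MA.A MA.A_proj) fst"
      by (rule bexI)
  qed
  then show ?thesis using B by (auto simp: classified_def)
qed

text \<open>The principal bundle behind \<open>B\<close> is a torsor with local sections, so it has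
  an equivariant map to \<open>EG\<close>; the map \<open>f\<close> induced on the bases exhibits
  \<open>B\<close> as a pullback.\<close>

lemma structured_bundle_classified:
  assumes hsp: "HSP Y" and B: "(B, \<pi>) \<in> bundles G DG F \<psi> (Y :: 'y diffspace)"
  shows "\<exists>f. smooth_map Y BG f \<and> bundle_iso B \<pi> (pullback_space Y f MA.A MA.A_proj) fst"
proof -
  have Y: "diffeological_space Y" using hsp by (simp add: HSP_def)
  obtain P :: "('y \<times> 'g) diffspace" and \<kappa> \<phi> where P: "principal_bundle G DG P \<kappa> Y \<phi>"
      "locally_trivial P \<kappa> Y DG"
    and iso: "bundle_iso B \<pi> (associated_space G P \<phi> F \<psi>) (associated_proj \<kappa>)"
    using B unfolding bundles_def structured_bundle_def by auto
  interpret P: torsor G DG P \<phi> \<kappa> Y by (rule principal_bundle_imp_torsor[OF dgroup Y P(1)])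
  interpret P: associated G DG P \<phi> \<kappa> Y F \<psi> by unfold_locales
  have ls: "locally_sectioned P \<kappa> Y" using P.locally_trivial_iff_sectioned P(2) by simp
  obtain \<Theta> where \<Theta>: "smooth_map P EG \<Theta>"
    "\<forall>g\<in>carrier G. \<forall>e\<in>pts P. \<Theta> (\<phi> g e) = milnor_action G g (\<Theta> e)"
    using P.equivariant_map_to_milnor[OF hsp ls] by blast
  obtain f where f: "smooth_map Y BG f" "\<forall>e\<in>pts P. M_proj (\<Theta> e) = f (\<kappa> e)"
    using equivariant_map_descends[OF P.torsor_axioms EG.torsor_axioms \<Theta>(1)] \<Theta>(2) by blast
  have "bundle_iso P.A P.A_proj (pullback_space Y f MA.A MA.A_proj) fst"
    by (rule associated_pullback_iso[OF MA.associated_axioms P.torsor_axioms \<Theta>(1)]) (use f \<Theta> in auto)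
  from bundle_iso_trans[OF bundles_diffeological[OF B] P.diffeological_A
      diffeological_pullback[OF Y MA.diffeological_A] iso this] f(1)
  show ?thesis by blast
qed

lemma classified_surjective:
  assumes hsp: "HSP Y"
  shows "classified Y ` homotopy_classes Y BG = bundle_classes G DG F \<psi> Y"
proof
  have Y: "diffeological_space Y" using hsp by (simp add: HSP_def)
  show "classified Y ` homotopy_classes Y BG \<subseteq> bundle_classes G DG F \<psi> Y"
  proof
    fix d assume "d \<in> classified Y ` homotopy_classes Y BG"
    then obtain f where f: "smooth_map Y BG f" and d: "d = classified Y (smooth_homotopy_rel Y BG `` {f})"
      by (auto simp: homotopy_classes_def elim!: quotientE)
    obtain B \<pi> where B: "(B, \<pi>) \<in> bundles G DG F \<psi> Y"
      "bundle_iso B \<pi> (pullback_space Y f MA.A MA.A_proj) fst"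
      by (rule bundle_model[OF Y f])
    show "d \<in> bundle_classes G DG F \<psi> Y"
      unfolding d classified_homotopy_class[OF hsp f B] bundle_classes_def
      by (rule quotientI[OF B(1)])
  qed
  show "bundle_classes G DG F \<psi> Y \<subseteq> classified Y ` homotopy_classes Y BG"
  proof
    fix d assume "d \<in> bundle_classes G DG F \<psi> Y"
    then obtain z where z: "z \<in> bundles G DG F \<psi> Y" "d = iso_rel Y `` {z}"
      unfolding bundle_classes_def by (rule quotientE)
    then obtain B \<pi> where B: "(B, \<pi>) \<in> bundles G DG F \<psi> Y" and d: "d = iso_rel Y `` {(B, \<pi>)}"
      by (cases z) auto
    obtain f where f: "smooth_map Y BG f"
      and iso: "bundle_iso B \<pi> (pullback_space Y f MA.A MA.A_proj) fst"
      using structured_bundle_classified[OF hsp B] by blast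
    have "d = classified Y (smooth_homotopy_rel Y BG `` {f})"
      unfolding d by (rule classified_homotopy_class[OF hsp f B iso, symmetric])
    moreover have "smooth_homotopy_rel Y BG `` {f} \<in> homotopy_classes Y BG"
      unfolding homotopy_classes_def using f by (intro quotientI) simp
    ultimately show "d \<in> classified Y ` homotopy_classes Y BG" by (rule image_eqI)
  qed
qed

text \<open>Pulling back in two steps agrees with pulling back along the composite; a homotopy from
  that composite to another representative is absorbed by \<open>homotopic_iso\<close>.\<close>

lemma classified_natural:
  assumes X: "HSP X" and Y: "HSP Y" and f: "smooth_map X Y f" and c: "c \<in> homotopy_classes Y BG"
  shows "classified X (homotopy_pullback X BG f c) = bundle_pullback G DG F \<psi> X f (classified Y c)"
proof -
  have Xd: "diffeological_space X" and Yd: "diffeological_space Y" using X Y by (auto simp: HSP_def)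
  have c_smooth: "smooth_map Y BG g" if "g \<in> c" for g
    using c that by (auto simp: homotopy_classes_def smooth_homotopy_rel_def elim!: quotientE)
  note pbX = diffeological_pullback[OF Xd] and pbY = diffeological_pullback[OF Yd MA.diffeological_A]
  note comp = bundle_iso_pullback_comp[OF Xd Yd MA.diffeological_A f]
  have "(\<exists>h\<in>homotopy_pullback X BG f c. bundle_iso B' \<pi>' (pullback_space X h MA.A MA.A_proj) fst) \<longleftrightarrow>
      (\<exists>(B, \<pi>)\<in>classified Y c. bundle_iso B' \<pi>' (pullback_space X f B \<pi>) fst)"
    if B': "(B', \<pi>') \<in> bundles G DG F \<psi> X" for B' \<pi>'
  proof
    note Bd' = bundles_diffeological[OF B']
    assume "\<exists>h\<in>homotopy_pullback X BG f c. bundle_iso B' \<pi>' (pullback_space X h MA.A MA.A_proj) fst"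
    then obtain h where h: "h \<in> homotopy_pullback X BG f c"
      and iso: "bundle_iso B' \<pi>' (pullback_space X h MA.A MA.A_proj) fst"
      by (rule bexE)
    then obtain g where g: "g \<in> c" "(\<lambda>x. g (f x), h) \<in> smooth_homotopy_rel X BG"
      unfolding homotopy_pullback_def comp_def by blast
    \<comment> \<open>Membership in \<open>classified Y c\<close> needs a bundle over
      \<open>Y\<close> in the prescribed type, so a model of the pullback along \<open>g\<close> is
      taken.\<close>
    obtain B \<pi> where B: "(B, \<pi>) \<in> bundles G DG F \<psi> Y"
      and isoB: "bundle_iso B \<pi> (pullback_space Y g MA.A MA.A_proj) fst"
      by (rule bundle_model[OF Yd c_smooth[OF g(1)]])
    note Bd = bundles_diffeological[OF B]
    have 1: "bundle_iso (pullback_space X f B \<pi>) fst (pullback_space X (\<lambda>x. g (f x)) MA.A MA.A_proj) fst"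
      by (rule bundle_iso_trans[OF pbX[OF Bd] pbX[OF pbY] pbX[OF MA.diffeological_A]
            bundle_iso_pullback[OF Xd Bd pbY isoB] comp])
    have 2: "bundle_iso (pullback_space X f B \<pi>) fst (pullback_space X h MA.A MA.A_proj) fst"
      by (rule bundle_iso_trans[OF pbX[OF Bd] pbX[OF MA.diffeological_A] pbX[OF MA.diffeological_A]
            1 homotopic_iso[OF X g(2)]])
    have "bundle_iso B' \<pi>' (pullback_space X f B \<pi>) fst"
      by (rule bundle_iso_trans[OF Bd' pbX[OF MA.diffeological_A] pbX[OF Bd] iso
            bundle_iso_sym[OF pbX[OF Bd] pbX[OF MA.diffeological_A] 2]])
    moreover have "(B, \<pi>) \<in> classified Y c" using B isoB g(1) by (auto simp: classified_def)
    ultimately show "\<exists>(B, \<pi>)\<in>classified Y c. bundle_iso B' \<pi>' (pullback_space X f B \<pi>) fst"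
      by (intro bexI[of _ "(B, \<pi>)"]) simp_all
  next
    note Bd' = bundles_diffeological[OF B']
    assume "\<exists>(B, \<pi>)\<in>classified Y c. bundle_iso B' \<pi>' (pullback_space X f B \<pi>) fst"
    then obtain B \<pi> where "(B, \<pi>) \<in> classified Y c" and iso: "bundle_iso B' \<pi>' (pullback_space X f B \<pi>) fst"
      by (auto simp: case_prod_unfold)
    then obtain g where B: "(B, \<pi>) \<in> bundles G DG F \<psi> Y" and g: "g \<in> c"
      and isoB: "bundle_iso B \<pi> (pullback_space Y g MA.A MA.A_proj) fst"
      unfolding classified_def by blast
    note Bd = bundles_diffeological[OF B]
    have 1: "bundle_iso (pullback_space X f B \<pi>) fst (pullback_space X (\<lambda>x. g (f x)) MA.A MA.A_proj) fst"
      by (rule bundle_iso_trans[OF pbX[OF Bd] pbX[OF pbY] pbX[OF MA.diffeological_A]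
            bundle_iso_pullback[OF Xd Bd pbY isoB] comp])
    have "bundle_iso B' \<pi>' (pullback_space X (\<lambda>x. g (f x)) MA.A MA.A_proj) fst"
      by (rule bundle_iso_trans[OF Bd' pbX[OF Bd] pbX[OF MA.diffeological_A] iso 1])
    moreover have "(\<lambda>x. g (f x)) \<in> homotopy_pullback X BG f c"
      unfolding homotopy_pullback_def comp_def
      using homotopy_refl[OF Xd smooth_map_comp[OF f c_smooth[OF g]]] g by blast
    ultimately show "\<exists>h\<in>homotopy_pullback X BG f c. bundle_iso B' \<pi>' (pullback_space X h MA.A MA.A_proj) fst"
      by (rule bexI)
  qed
  then have eq: "(B', \<pi>') \<in> classified X (homotopy_pullback X BG f c) \<longleftrightarrow>
      (B', \<pi>') \<in> bundle_pullback G DG F \<psi> X f (classified Y c)" for B' \<pi>'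
    unfolding classified_def[of X] bundle_pullback_def mem_Collect_eq prod.case by (rule conj_cong[OF refl])
  show ?thesis
  proof (rule Set.set_eqI)
    fix z
    show "z \<in> classified X (homotopy_pullback X BG f c) \<longleftrightarrow>
        z \<in> bundle_pullback G DG F \<psi> X f (classified Y c)"
      using eq[of "fst z" "snd z"] by simp
  qed
qed

end

theorem corollary5p9:
  fixes G :: "('g, 'm) monoid_scheme" and DG :: "'g diffspace"
    and F :: "'f diffspace" and \<psi> :: "'g \<Rightarrow> 'f \<Rightarrow> 'f"
  assumes "diffeological_group G DG"
    and "diffeological_space F"
    and "smooth_action G DG F \<psi>"
  shows "\<exists>\<eta> :: 'x diffspace \<Rightarrow> ('x \<Rightarrow> ((nat \<Rightarrow> real) \<times> (nat \<Rightarrow> 'g)) set set) set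
              \<Rightarrow> ('x, 'f) fbundle set.
    (\<forall>X. HSP X \<longrightarrow>
       \<eta> X ` homotopy_classes X (milnor_B G DG) = bundle_classes G DG F \<psi> X) \<and>
    (\<forall>X Y f. HSP X \<and> HSP Y \<and> smooth_map X Y f \<longrightarrow>
       (\<forall>c \<in> homotopy_classes Y (milnor_B G DG).
          \<eta> X (homotopy_pullback X (milnor_B G DG) f c) =
          bundle_pullback G DG F \<psi> X f (\<eta> Y c)))"
proof -
  interpret smooth_gspace G DG F \<psi> by (rule smooth_action_imp_gspace[OF assms])
  interpret milnor_associated G DG F \<psi> by unfold_locales
  show ?thesis
  proof (intro exI[of _ classified] conjI allI impI ballI)
    show "classified X ` homotopy_classes X BG = bundle_classes G DG F \<psi> X" if "HSP X" for X :: "'x diffspace"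
      by (rule classified_surjective[OF that])
    show "classified X (homotopy_pullback X BG f c) = bundle_pullback G DG F \<psi> X f (classified Y c)"
      if "HSP X \<and> HSP Y \<and> smooth_map X Y f" "c \<in> homotopy_classes Y BG" for X Y :: "'x diffspace" and f c
      using that by (intro classified_natural) simp_all
  qed
qed

end
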